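(* Assume the QBD with transition matrix $P$ is not null recurrent, and let $(\boldsymbol g_r)_{r\ge1}$ be a sequence of vectors in $\mathbb C^m$. A particular solution of the difference equation $$A_{-1}\boldsymbol u_r+(A_0-I)\boldsymbol u_{r+1}+A_1\boldsymbol u_{r+2}=-\boldsymbol g_{r+1},\qquad r\ge0,$$ is given by $$\boldsymbol\sigma_r=-\sum_{k=1}^{r}\left(G^{r-k}-LV_1^{k-r}E\right)W\boldsymbol g_k-\sum_{j=1}^{\nu-1}KV_0^jFW\boldsymbol g_{j+r},\qquad r\ge 0,$$ where $\nu$ is the smallest positive integer such that $V_0^\nu=0$, with the convention $\boldsymbol g_0:=$ any fixed vector of $\mathbb C^m$ (it does not occur in the formula). The general solution of the difference equation is $$\boldsymbol u_r=G^r\boldsymbol x+LV_1^{-r}\boldsymbol y+\boldsymbol\sigma_r,\qquad r\ge0,$$ where $\boldsymbol x\in\mathbb C^m$ and $\boldsymbol y\in\mathbb C^p$ are arbitrary.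
   Context: QBD process. Let $m\ge1$ be an integer and let $B,A_{-1},A_0,A_1$ be nonnegative $m\times m$ matrices such that the infinite block tridiagonal matrix $P=(P_{i,j})_{i,j\ge 0}$ with $m\times m$ blocks $P_{0,0}=B$, $P_{i,i}=A_0$ for $i\ge1$, $P_{i,i+1}=A_1$ for $i\ge 0$, $P_{i,i-1}=A_{-1}$ for $i\ge1$, and all other blocks zero, is row-stochastic. $P$ is the transition matrix of a discrete-time Markov chain (a QBD) on $\mathbb N\times\mathcal E$, $\mathcal E=\{1,\dots,m\}$; "null recurrent" refers to this chain. Standing assumptions: $P$ is irreducible; $A_{-1}+A_0+A_1$ is irreducible; and the doubly infinite QBD on $\mathbb Z\times\mathcal E$ (with transition blocks $A_{-1},A_0,A_1$ for level changes $-1,0,+1$) has only one final class $\mathbb Z\times\mathcal E_*$, with $\emptyset\ne\mathcal E_*\subseteq\mathcal E$, and every other state is on a path to the final class. $G$, $\widehat G$, $R$ are the minimal nonnegative solutions of $A_{-1}+(A_0-I)X+A_1X^2=0$, $A_1+(A_0-I)X+A_{-1}X^2=0$ and $A_1+X(A_0-I)+X^2A_{-1}=0$, respectively. Put $U=A_0+RA_{-1}$ (equivalently $U=A_0+A_1G$). When the QBD is not null recurrent, the series $W=\sum_{j=0}^\infty G^j(U-I)^{-1}R^j$ converges. $M$ is a nonsingular matrix such that $\widehat GM=MJ$ with $J=\mathrm{diag}(V_1,V_0)$, where $V_1$ is a nonsingular $p\times p$ matrix, $0\le p\le m$, and $V_0$ is an $(m-p)\times(m-p)$ matrix with spectral radius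 $0$. Write $M=[\,L\mid K\,]$ with $L$ of size $m\times p$ and $K$ of size $m\times(m-p)$, and $M^{-1}=\begin{bmatrix}E\\ F\end{bmatrix}$ with $E$ of size $p\times m$ and $F$ of size $(m-p)\times m$. (Terms involving empty blocks are absent when $p=0$ or $p=m$.) *)

theory Defs
  imports
    "HOL-Analysis.Infinite_Sum"
    "Jordan_Normal_Form.Spectral_Radius"
    "Jordan_Normal_Form.Gauss_Jordan_Elimination"
begin

definition row_stochastic :: "'s set \<Rightarrow> ('s \<Rightarrow> 's \<Rightarrow> real) \<Rightarrow> bool" where
  "row_stochastic S P \<longleftrightarrow> (\<forall>i\<in>S. (\<forall>j\<in>S. 0 \<le> P i j) \<and> (P i has_sum 1) S)"

definition step_rel :: "'s set \<Rightarrow> ('s \<Rightarrow> 's \<Rightarrow> real) \<Rightarrow> ('s \<times> 's) set" where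
  "step_rel S P = {(i, j). i \<in> S \<and> j \<in> S \<and> 0 < P i j}"

definition irreducible_kernel :: "'s set \<Rightarrow> ('s \<Rightarrow> 's \<Rightarrow> real) \<Rightarrow> bool" where
  "irreducible_kernel S P \<longleftrightarrow> (\<forall>i\<in>S. \<forall>j\<in>S. (i, j) \<in> (step_rel S P)\<^sup>*)"

text \<open>A final class is a communicating class that cannot be left.\<close>

definition final_class :: "'s set \<Rightarrow> ('s \<Rightarrow> 's \<Rightarrow> real) \<Rightarrow> 's set \<Rightarrow> bool" where
  "final_class S P C \<longleftrightarrow>
     (\<exists>i\<in>S. C = {j\<in>S. (i, j) \<in> (step_rel S P)\<^sup>* \<and> (j, i) \<in> (step_rel S P)\<^sup>*}) \<and>
     (\<forall>i j. i \<in> C \<and> (i, j) \<in> step_rel S P \<longrightarrow> j \<in> C)"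

text \<open>\<open>first_passage S P n i j\<close> is the probability that the chain started in \<open>i\<close> visits \<open>j\<close>
  at time \<open>n\<close>, for the first time among the times \<open>1, 2, \<dots>\<close>.\<close>

fun first_passage :: "'s set \<Rightarrow> ('s \<Rightarrow> 's \<Rightarrow> real) \<Rightarrow> nat \<Rightarrow> 's \<Rightarrow> 's \<Rightarrow> real" where
  "first_passage S P 0 i j = 0"
| "first_passage S P (Suc 0) i j = P i j"
| "first_passage S P (Suc (Suc n)) i j =
     (\<Sum>\<^sub>\<infinity>k\<in>S - {j}. P i k * first_passage S P (Suc n) k j)"

text \<open>A state is recurrent if the chain returns to it almost surely, and null recurrent if
  moreover the expected return time is infinite.\<close>

definition recurrent_state :: "'s set \<Rightarrow> ('s \<Rightarrow> 's \<Rightarrow> real) \<Rightarrow> 's \<Rightarrow> bool" where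
  "recurrent_state S P i \<longleftrightarrow> (\<lambda>n. first_passage S P n i i) sums 1"

definition null_recurrent_state :: "'s set \<Rightarrow> ('s \<Rightarrow> 's \<Rightarrow> real) \<Rightarrow> 's \<Rightarrow> bool" where
  "null_recurrent_state S P i \<longleftrightarrow>
     recurrent_state S P i \<and> \<not> summable (\<lambda>n. real n * first_passage S P n i i)"

text \<open>In an irreducible chain all states are of the same type.\<close>

definition null_recurrent_chain :: "'s set \<Rightarrow> ('s \<Rightarrow> 's \<Rightarrow> real) \<Rightarrow> bool" where
  "null_recurrent_chain S P \<longleftrightarrow> (\<forall>i\<in>S. null_recurrent_state S P i)"

text \<open>States are pairs (level, phase); the phases \<open>1, \<dots>, m\<close> are numbered \<open>0, \<dots>, m - 1\<close>,
  following the index convention for matrices.\<close>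

definition qbd_states :: "nat \<Rightarrow> (nat \<times> nat) set" where
  "qbd_states m = UNIV \<times> {..<m}"

fun qbd_kernel :: "real mat \<Rightarrow> real mat \<Rightarrow> real mat \<Rightarrow> real mat \<Rightarrow>
    nat \<times> nat \<Rightarrow> nat \<times> nat \<Rightarrow> real" where
  "qbd_kernel B Am1 A0 A1 (k, i) (l, j) =
     (if k = 0 \<and> l = 0 then B $$ (i, j)
      else if l = k then A0 $$ (i, j)
      else if l = k + 1 then A1 $$ (i, j)
      else if k = l + 1 then Am1 $$ (i, j)
      else 0)"

definition dqbd_states :: "nat \<Rightarrow> (int \<times> nat) set" where
  "dqbd_states m = UNIV \<times> {..<m}"

fun dqbd_kernel :: "real mat \<Rightarrow> real mat \<Rightarrow> real mat \<Rightarrow>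
    int \<times> nat \<Rightarrow> int \<times> nat \<Rightarrow> real" where
  "dqbd_kernel Am1 A0 A1 (k, i) (l, j) =
     (if l = k then A0 $$ (i, j)
      else if l = k + 1 then A1 $$ (i, j)
      else if l = k - 1 then Am1 $$ (i, j)
      else 0)"

definition irreducible_matrix :: "nat \<Rightarrow> real mat \<Rightarrow> bool" where
  "irreducible_matrix m A \<longleftrightarrow> irreducible_kernel {..<m} (\<lambda>i j. A $$ (i, j))"

definition qbd :: "nat \<Rightarrow> real mat \<Rightarrow> real mat \<Rightarrow> real mat \<Rightarrow> real mat \<Rightarrow> bool" where
  "qbd m B Am1 A0 A1 \<longleftrightarrow>
     1 \<le> m \<and> {B, Am1, A0, A1} \<subseteq> carrier_mat m m \<and>
     0\<^sub>m m m \<le> B \<and> 0\<^sub>m m m \<le> Am1 \<and> 0\<^sub>m m m \<le> A0 \<and> 0\<^sub>m m m \<le> A1 \<and>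
     row_stochastic (qbd_states m) (qbd_kernel B Am1 A0 A1)"

definition qbd_standing_assumptions ::
    "nat \<Rightarrow> real mat \<Rightarrow> real mat \<Rightarrow> real mat \<Rightarrow> real mat \<Rightarrow> bool" where
  "qbd_standing_assumptions m B Am1 A0 A1 \<longleftrightarrow>
     irreducible_kernel (qbd_states m) (qbd_kernel B Am1 A0 A1) \<and>
     irreducible_matrix m (Am1 + A0 + A1) \<and>
     (\<exists>Es. Es \<noteq> {} \<and> Es \<subseteq> {..<m} \<and>
        {C. final_class (dqbd_states m) (dqbd_kernel Am1 A0 A1) C} = {UNIV \<times> Es} \<and>
        (\<forall>s\<in>dqbd_states m. \<exists>t\<in>UNIV \<times> Es.
           (s, t) \<in> (step_rel (dqbd_states m) (dqbd_kernel Am1 A0 A1))\<^sup>*))"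

definition qbd_null_recurrent ::
    "nat \<Rightarrow> real mat \<Rightarrow> real mat \<Rightarrow> real mat \<Rightarrow> real mat \<Rightarrow> bool" where
  "qbd_null_recurrent m B Am1 A0 A1 \<longleftrightarrow>
     null_recurrent_chain (qbd_states m) (qbd_kernel B Am1 A0 A1)"

definition minimal_nonneg_solution :: "nat \<Rightarrow> (real mat \<Rightarrow> real mat) \<Rightarrow> real mat \<Rightarrow> bool" where
  "minimal_nonneg_solution m F X \<longleftrightarrow>
     X \<in> carrier_mat m m \<and> 0\<^sub>m m m \<le> X \<and> F X = 0\<^sub>m m m \<and>
     (\<forall>Y\<in>carrier_mat m m. 0\<^sub>m m m \<le> Y \<and> F Y = 0\<^sub>m m m \<longrightarrow> X \<le> Y)"

text \<open>The inverse; its value on singular matrices is unspecified.\<close>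

definition mat_inv :: "'a :: field mat \<Rightarrow> 'a mat" where
  "mat_inv A = the (mat_inverse A)"

definition mat_suminf :: "nat \<Rightarrow> nat \<Rightarrow> (nat \<Rightarrow> real mat) \<Rightarrow> real mat" where
  "mat_suminf nr nc A = mat nr nc (\<lambda>(i, j). \<Sum>n. A n $$ (i, j))"

abbreviation cmat :: "real mat \<Rightarrow> complex mat" where
  "cmat \<equiv> map_mat complex_of_real"

abbreviation vsum :: "nat \<Rightarrow> (nat \<Rightarrow> complex vec) \<Rightarrow> nat set \<Rightarrow> complex vec" where
  "vsum m \<equiv> finsum_vec TYPE(complex) m"

definition difference_solution :: "nat \<Rightarrow> real mat \<Rightarrow> real mat \<Rightarrow> real mat \<Rightarrow>
    (nat \<Rightarrow> complex vec) \<Rightarrow> (nat \<Rightarrow> complex vec) \<Rightarrow> bool" where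
  "difference_solution m Am1 A0 A1 g u \<longleftrightarrow>
     (\<forall>r. u r \<in> carrier_vec m) \<and>
     (\<forall>r. cmat Am1 *\<^sub>v u r + cmat (A0 - 1\<^sub>m m) *\<^sub>v u (r + 1) + cmat A1 *\<^sub>v u (r + 2)
          = - g (r + 1))"

end

theory Submission
  imports Defs "Jordan_Normal_Form.Jordan_Normal_Form_Existence"
begin

text \<open>
  Put \<open>T = U - I\<close>. The quadratic equations for \<open>G\<close> and \<open>R\<close> amount to the factorisation
  \<open>A\<^sub>-\<^sub>1 + z (A\<^sub>0 - I) + z\<^sup>2 A\<^sub>1 = (I - z R) T (z I - G)\<close>, and the solution of the difference equation rests
  on it, on the equation of \<open>Gh\<close> and on two facts about \<open>W\<close>: \<open>W - G W R = T\<^sup>-\<^sup>1\<close> and \<open>W R = Gh W\<close>. If \<open>u\<close> solves the homogeneous equation, then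
  \<open>v\<^sub>r = T (u\<^sub>r\<^sub>+\<^sub>1 - G u\<^sub>r)\<close> satisfies \<open>v\<^sub>r = R v\<^sub>r\<^sub>+\<^sub>1\<close>, so \<open>w\<^sub>r = W v\<^sub>r\<close> satisfies \<open>w\<^sub>r = Gh w\<^sub>r\<^sub>+\<^sub>1\<close>. The
  nilpotent part of \<open>Gh\<close> forces \<open>w\<^sub>r\<close> into the range of \<open>L\<close>, where \<open>Gh\<close> can be inverted, so that
  \<open>t\<^sub>r = Gh w\<^sub>r\<close> has the form \<open>L V\<^sub>1\<^sup>-\<^sup>r y\<close>; and \<open>u - t\<close> satisfies the first-order recurrence
  \<open>x\<^sub>r\<^sub>+\<^sub>1 = G x\<^sub>r\<close>. The particular solution is \<open>\<sigma> = \<rho> - \<alpha>\<close>, where \<open>\<alpha>\<close> solves the forward recurrence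
  \<open>\<alpha>\<^sub>r\<^sub>+\<^sub>1 = G \<alpha>\<^sub>r + W g\<^sub>r\<^sub>+\<^sub>1\<close> and \<open>\<rho>\<close> the backward recurrence \<open>\<rho>\<^sub>r = Gh (\<rho>\<^sub>r\<^sub>+\<^sub>1 - W g\<^sub>r\<^sub>+\<^sub>1)\<close>
  (\<open>homogeneous_solution\<close>, \<open>solution_of_split\<close>, \<open>particular_solution\<close>).

  The two facts about \<open>W\<close> come from the Green matrix of the walk on \<open>\<int>\<close>. Kill the walk with
  probability \<open>1 - s\<close> at each step, that is, replace \<open>A\<^sub>i\<close> by \<open>s A\<^sub>i\<close> with \<open>s < 1\<close>. The matrix
  \<open>s (A\<^sub>-\<^sub>1 + A\<^sub>0 + A\<^sub>1)\<close> then has row sums at most \<open>s\<close>, all inverses are Neumann series, and with \<open>N = (I - U)\<^sup>-\<^sup>1\<close> the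
  Green matrix \<open>H = (I - A\<^sub>0 - A\<^sub>1 G - A\<^sub>-\<^sub>1 Gh)\<^sup>-\<^sup>1\<close> satisfies \<open>H = N + G H R\<close> and \<open>H R = Gh H\<close> by pure
  algebra (\<open>strict_green\<close>). As \<open>s\<close> increases to 1, everything increases; the limits of \<open>G\<close>, \<open>R\<close>, \<open>Gh\<close> are the
  minimal solutions by minimality (\<open>passage_limit\<close>), and the identities survive provided that \<open>H\<close> stays
  bounded. Since \<open>H = (\<Sum>j<k. G\<^sup>j N R\<^sup>j) + G\<^sup>k H R\<^sup>k\<close> and \<open>G\<^sup>k H R\<^sup>k = G\<^sup>k Gh\<^sup>k H\<close>, it does as soon as some power of \<open>G\<close>
  has row sums at most 1/2 or some power of \<open>R\<close> is small (\<open>green_limit\<close>). The limit of \<open>H\<close> is \<open>- W\<close>.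

  One of these two alternatives holds whenever some state \<open>j\<close> of the QBD is not null recurrent
  (\<open>not_null_recurrent_contraction\<close>).
  If \<open>j\<close> is not recurrent, then \<open>G\<close> cannot be stochastic: otherwise the probability of hitting \<open>j\<close>,
  being superharmonic, would attain its minimum on level 0, and by irreducibility it would be 1.
  As \<open>A\<^sub>-\<^sub>1 + A\<^sub>0 + A\<^sub>1\<close> is irreducible, a nonstochastic \<open>G\<close> has \<open>G\<^sup>k \<longlonglongrightarrow> 0\<close>. If \<open>j\<close> is recurrent with finite
  mean return time, the expected time to hit \<open>j\<close> bounds \<open>N (\<Sum>l<n. R\<^sup>l) 1\<close> for all \<open>n\<close>, so \<open>R\<^sup>k \<longlonglongrightarrow> 0\<close>.
  That \<open>I - U\<close> is nonsingular at all is due to the irreducibility of the QBD (\<open>U_neumann\<close>).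

  Below, \<open>a\<close>, \<open>b\<close>, \<open>c\<close> stand for \<open>A\<^sub>-\<^sub>1\<close>, \<open>A\<^sub>0\<close>, \<open>A\<^sub>1\<close>; \<open>Gh\<close> is the minimal
  solution of the equation with \<open>A\<^sub>-\<^sub>1\<close> and \<open>A\<^sub>1\<close> interchanged. In the real part of the development a
  column vector is represented by a square matrix whose columns are all equal to it, which keeps all
  computations within one ring.
\<close>

section \<open>Entrywise order and convergence of square matrices\<close>

lemma mult_entry_sum:
  assumes "A \<in> carrier_mat n k" "B \<in> carrier_mat k l" "i < n" "j < l"
  shows "(A * B) $$ (i, j) = (\<Sum>q<k. A $$ (i, q) * B $$ (q, j))"
  using assms by (simp add: scalar_prod_def atLeast0LessThan)

lemma pow_mat_Suc_left:
  "X \<in> carrier_mat n n \<Longrightarrow> X ^\<^sub>m Suc k = X * X ^\<^sub>m k"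
  by (induction k) (simp_all add: assoc_mult_mat[of _ n n _ n _ n])

locale square_mats =
  fixes m :: nat
  assumes m_pos: "0 < m"
begin

abbreviation Mat :: "real mat set" where "Mat \<equiv> carrier_mat m m"
abbreviation Zero :: "real mat" where "Zero \<equiv> 0\<^sub>m m m"
abbreviation One :: "real mat" where "One \<equiv> 1\<^sub>m m"

text \<open>The constant function 1 on the phases, as a matrix with equal columns: \<open>X * all_ones\<close> holds the row sums of \<open>X\<close>.\<close>

definition all_ones :: "real mat" where "all_ones = mat m m (\<lambda>_. 1)"

lemma all_ones_carrier [simp]: "all_ones \<in> Mat"
  by (simp add: all_ones_def)

lemma mult_closed [simp]: "X \<in> Mat \<Longrightarrow> Y \<in> Mat \<Longrightarrow> X * Y \<in> Mat"
  by (rule mult_carrier_mat)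

lemma mult_one [simp]: "X \<in> Mat \<Longrightarrow> One * X = X" "X \<in> Mat \<Longrightarrow> X * One = X"
  by (rule left_mult_one_mat right_mult_one_mat, assumption)+

lemmas mat_assoc = assoc_mult_mat[of _ m m _ m _ m]
lemmas mat_distrib = mat_assoc
  add_mult_distrib_mat[of _ m m _ _ m] mult_add_distrib_mat[of _ m m _ m]
  minus_mult_distrib_mat[of _ m m _ _ m] mult_minus_distrib_mat[of _ m m _ m]

lemma le_matI:
  assumes "X \<in> Mat" "Y \<in> Mat" "\<And>i j. i < m \<Longrightarrow> j < m \<Longrightarrow> X $$ (i, j) \<le> Y $$ (i, j)"
  shows "X \<le> Y"
  using assms by (auto simp: less_eq_mat_def)

lemma le_matD: "X \<le> Y \<Longrightarrow> Y \<in> Mat \<Longrightarrow> i < m \<Longrightarrow> j < m \<Longrightarrow> X $$ (i, j) \<le> Y $$ (i, j)"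
  by (auto simp: less_eq_mat_def)

lemma nonneg_matD: "Zero \<le> X \<Longrightarrow> X \<in> Mat \<Longrightarrow> i < m \<Longrightarrow> j < m \<Longrightarrow> 0 \<le> X $$ (i, j)"
  by (auto simp: less_eq_mat_def)

lemmas mult_entry = mult_entry_sum[of _ m m _ m]

lemma mult_all_ones_entry:
  "X \<in> Mat \<Longrightarrow> i < m \<Longrightarrow> j < m \<Longrightarrow> (X * all_ones) $$ (i, j) = (\<Sum>k<m. X $$ (i, k))"
  by (subst mult_entry) (auto simp: all_ones_def)

lemma nonneg_all_ones [simp]: "Zero \<le> all_ones"
  by (rule le_matI) (auto simp: all_ones_def)

lemma nonneg_One [simp]: "Zero \<le> One"
  by (rule le_matI) auto

lemma mult_mono_mat:
  assumes "X \<in> Mat" "X' \<in> Mat" "Y \<in> Mat" "Y' \<in> Mat" "Zero \<le> X" "X \<le> X'" "Zero \<le> Y" "Y \<le> Y'"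
  shows "X * Y \<le> X' * Y'"
proof (rule le_matI)
  fix i j assume ij: "i < m" "j < m"
  show "(X * Y) $$ (i, j) \<le> (X' * Y') $$ (i, j)"
    unfolding mult_entry[OF assms(1,3) ij] mult_entry[OF assms(2,4) ij]
  proof (intro sum_mono mult_mono)
    fix k assume "k \<in> {..<m}"
    hence k: "k < m" by simp
    show "X $$ (i, k) \<le> X' $$ (i, k)" "Y $$ (k, j) \<le> Y' $$ (k, j)"
      using assms ij k by (simp_all add: le_matD)
    show "0 \<le> Y $$ (k, j)" using nonneg_matD[OF assms(7,3)] ij k by simp
    have "0 \<le> X $$ (i, k)" using nonneg_matD[OF assms(5,1)] ij k by simp
    thus "0 \<le> X' $$ (i, k)" using le_matD[OF assms(6,2) ij(1) k] by linarith
  qed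
qed (use assms in auto)

lemma mult_nonneg_mat:
  assumes "X \<in> Mat" "Y \<in> Mat" "Zero \<le> X" "Zero \<le> Y"
  shows "Zero \<le> X * Y"
proof (rule le_matI)
  fix i j assume ij: "i < m" "j < m"
  show "Zero $$ (i, j) \<le> (X * Y) $$ (i, j)"
    unfolding mult_entry[OF assms(1,2) ij] using assms ij
    by (auto intro!: sum_nonneg mult_nonneg_nonneg nonneg_matD)
qed (use assms in auto)

lemma mult_left_mono_mat:
  "X \<in> Mat \<Longrightarrow> Y \<in> Mat \<Longrightarrow> Y' \<in> Mat \<Longrightarrow> Zero \<le> X \<Longrightarrow> Y \<le> Y' \<Longrightarrow> X * Y \<le> X * Y'"
  by (rule le_matI)
    (auto simp: mult_entry simp del: index_mult_mat(1) intro!: sum_mono mult_left_mono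
      intro: le_matD nonneg_matD)

lemma mult_right_mono_mat:
  "X \<in> Mat \<Longrightarrow> X' \<in> Mat \<Longrightarrow> Y \<in> Mat \<Longrightarrow> X \<le> X' \<Longrightarrow> Zero \<le> Y \<Longrightarrow> X * Y \<le> X' * Y"
  by (rule le_matI)
    (auto simp: mult_entry simp del: index_mult_mat(1) intro!: sum_mono mult_right_mono
      intro: le_matD nonneg_matD)

lemma add_mono_mat:
  assumes "X \<in> Mat" "X' \<in> Mat" "Y \<in> Mat" "Y' \<in> Mat" "X \<le> X'" "Y \<le> Y'"
  shows "X + Y \<le> X' + Y'"
  using assms by (intro le_matI) (auto intro!: add_mono le_matD)

lemma add_nonneg_mat:
  assumes "X \<in> Mat" "Y \<in> Mat" "Zero \<le> X" "Zero \<le> Y"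
  shows "Zero \<le> X + Y"
  using assms by (intro le_matI) (auto intro!: add_nonneg_nonneg nonneg_matD)

lemma pow_nonneg_mat: "X \<in> Mat \<Longrightarrow> Zero \<le> X \<Longrightarrow> Zero \<le> X ^\<^sub>m k"
  by (induction k) (auto intro!: mult_nonneg_mat)

lemma pow_mono_mat:
  "X \<in> Mat \<Longrightarrow> Y \<in> Mat \<Longrightarrow> Zero \<le> X \<Longrightarrow> X \<le> Y \<Longrightarrow> X ^\<^sub>m k \<le> Y ^\<^sub>m k"
  by (induction k) (auto intro!: mult_mono_mat pow_nonneg_mat)

text \<open>For \<open>t = 1\<close> these are the substochastic matrices.\<close>

definition rows_le :: "real \<Rightarrow> real mat \<Rightarrow> bool" where
  "rows_le t X \<longleftrightarrow> X \<in> Mat \<and> Zero \<le> X \<and> (\<forall>i<m. (\<Sum>j<m. X $$ (i, j)) \<le> t)"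

lemma rows_leD:
  assumes "rows_le t X"
  shows "X \<in> Mat" "Zero \<le> X" "i < m \<Longrightarrow> (\<Sum>j<m. X $$ (i, j)) \<le> t"
  using assms by (auto simp: rows_le_def)

lemma rows_le_mono: "rows_le t X \<Longrightarrow> t \<le> u \<Longrightarrow> rows_le u X"
  unfolding rows_le_def by (meson order_trans)

lemma rows_le_antimono: "rows_le t Y \<Longrightarrow> X \<in> Mat \<Longrightarrow> Zero \<le> X \<Longrightarrow> X \<le> Y \<Longrightarrow> rows_le t X"
  unfolding rows_le_def
proof (intro conjI allI impI, goal_cases)
  case (3 i)
  have "(\<Sum>j<m. X $$ (i, j)) \<le> (\<Sum>j<m. Y $$ (i, j))"
    using 3 by (intro sum_mono le_matD) auto
  thus ?case using 3 by force
qed auto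

lemma rows_le_nonneg: "rows_le t X \<Longrightarrow> 0 \<le> t"
proof -
  assume "rows_le t X"
  hence "(\<Sum>j<m. X $$ (0, j)) \<le> t" "X \<in> Mat" "Zero \<le> X" using m_pos by (auto simp: rows_le_def)
  moreover have "0 \<le> (\<Sum>j<m. X $$ (0, j))"
    using m_pos calculation by (intro sum_nonneg) (auto intro: nonneg_matD)
  ultimately show ?thesis by linarith
qed

lemma rows_le_entry:
  assumes "rows_le t X" "i < m" "j < m"
  shows "X $$ (i, j) \<le> t"
proof -
  have "X $$ (i, j) \<le> (\<Sum>j<m. X $$ (i, j))"
    using assms by (intro member_le_sum) (auto intro!: nonneg_matD dest: rows_leD)
  also have "\<dots> \<le> t" using assms by (auto dest: rows_leD)
  finally show ?thesis .
qed

lemma rows_le_mult_entry: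
  assumes "rows_le t X" "Y \<in> Mat" "i < m" "j < m" "\<And>k. k < m \<Longrightarrow> Y $$ (k, j) \<le> c" "0 \<le> c"
  shows "(X * Y) $$ (i, j) \<le> t * c"
proof -
  have "(X * Y) $$ (i, j) = (\<Sum>k<m. X $$ (i, k) * Y $$ (k, j))"
    using assms by (intro mult_entry) (auto dest: rows_leD)
  also have "\<dots> \<le> (\<Sum>k<m. X $$ (i, k) * c)"
    using assms by (intro sum_mono mult_left_mono) (auto intro!: nonneg_matD dest: rows_leD)
  also have "\<dots> = (\<Sum>k<m. X $$ (i, k)) * c" by (simp add: sum_distrib_right)
  also have "\<dots> \<le> t * c" using assms by (intro mult_right_mono) (auto dest: rows_leD)
  finally show ?thesis .
qed

lemma rows_le_mult:
  assumes X: "rows_le t X" and Y: "rows_le u Y"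
  shows "rows_le (t * u) (X * Y)"
  unfolding rows_le_def
proof (intro conjI allI impI)
  note XY = rows_leD[OF X] rows_leD[OF Y]
  show "X * Y \<in> Mat" using XY by auto
  show "Zero \<le> X * Y" using XY by (intro mult_nonneg_mat) auto
  fix i assume i: "i < m"
  have "(\<Sum>j<m. (X * Y) $$ (i, j)) = (X * Y * all_ones) $$ (i, 0)"
    using i m_pos XY by (subst mult_all_ones_entry) auto
  also have "\<dots> = (X * (Y * all_ones)) $$ (i, 0)"
    using XY by (simp add: mat_assoc del: index_mult_mat(1))
  also have "\<dots> \<le> t * u"
    using i m_pos XY rows_le_nonneg[OF Y]
    by (intro rows_le_mult_entry[OF X]) (auto simp: mult_all_ones_entry simp del: index_mult_mat(1))
  finally show "(\<Sum>j<m. (X * Y) $$ (i, j)) \<le> t * u" .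
qed

lemma rows_le_One: "rows_le 1 One"
  unfolding rows_le_def
proof (intro conjI allI impI)
  fix i assume i: "i < m"
  have "(\<Sum>j<m. One $$ (i, j)) = (\<Sum>j<m. if i = j then 1 else 0)"
    using i by (intro sum.cong) auto
  thus "(\<Sum>j<m. One $$ (i, j)) \<le> 1" using i by simp
qed auto

lemma rows_le_pow: "rows_le t X \<Longrightarrow> rows_le (t ^ k) (X ^\<^sub>m k)"
proof (induction k)
  case 0
  thus ?case using rows_le_One by (auto dest: rows_leD(1))
next
  case (Suc k)
  thus ?case using rows_le_mult[of "t ^ k" "X ^\<^sub>m k" t X] by (simp add: mult.commute)
qed

definition mconv :: "(nat \<Rightarrow> real mat) \<Rightarrow> real mat \<Rightarrow> bool" where
  "mconv X L \<longleftrightarrow> (\<forall>n. X n \<in> Mat) \<and> L \<in> Mat \<and>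
     (\<forall>i<m. \<forall>j<m. (\<lambda>n. X n $$ (i, j)) \<longlonglongrightarrow> L $$ (i, j))"

lemma mconvD:
  assumes "mconv X L"
  shows "X n \<in> Mat" "L \<in> Mat" "i < m \<Longrightarrow> j < m \<Longrightarrow> (\<lambda>n. X n $$ (i, j)) \<longlonglongrightarrow> L $$ (i, j)"
  using assms by (auto simp: mconv_def)

lemma mconv_const: "X \<in> Mat \<Longrightarrow> mconv (\<lambda>_. X) X"
  by (auto simp: mconv_def)

lemma mconv_add: "mconv X K \<Longrightarrow> mconv Y L \<Longrightarrow> mconv (\<lambda>n. X n + Y n) (K + L)"
  unfolding mconv_def by (auto intro!: tendsto_add simp: carrier_matD[of _ m m])

lemma mconv_minus: "mconv X K \<Longrightarrow> mconv Y L \<Longrightarrow> mconv (\<lambda>n. X n - Y n) (K - L)"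
  unfolding mconv_def by (auto intro!: tendsto_diff simp: carrier_matD[of _ m m] minus_carrier_mat)

lemma mconv_mult:
  assumes "mconv X K" "mconv Y L"
  shows "mconv (\<lambda>n. X n * Y n) (K * L)"
  unfolding mconv_def
proof (intro conjI allI impI)
  note XY = mconvD[OF assms(1)] mconvD[OF assms(2)]
  show "X n * Y n \<in> Mat" "K * L \<in> Mat" for n using XY by simp_all
  show "(\<lambda>n. (X n * Y n) $$ (i, j)) \<longlonglongrightarrow> (K * L) $$ (i, j)" if "i < m" "j < m" for i j
    using that XY by (simp add: mult_entry del: index_mult_mat(1)) (auto intro!: tendsto_intros)
qed

lemma mconv_smult: "t \<longlonglongrightarrow> u \<Longrightarrow> X \<in> Mat \<Longrightarrow> mconv (\<lambda>n. t n \<cdot>\<^sub>m X) (u \<cdot>\<^sub>m X)"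
  unfolding mconv_def by (auto intro!: tendsto_intros simp: carrier_matD[of _ m m])

lemma mconv_unique: "mconv X K \<Longrightarrow> mconv X L \<Longrightarrow> K = L"
proof (rule eq_matI)
  fix i j assume *: "mconv X K" "mconv X L" "i < dim_row L" "j < dim_col L"
  hence "i < m" "j < m" by (auto simp: mconv_def)
  thus "K $$ (i, j) = L $$ (i, j)" using * by (blast intro: LIMSEQ_unique dest: mconvD)
qed (auto simp: mconv_def)

lemma mconv_le: "mconv X K \<Longrightarrow> mconv Y L \<Longrightarrow> (\<And>n. X n \<le> Y n) \<Longrightarrow> K \<le> L"
proof (rule le_matI)
  fix i j assume *: "mconv X K" "mconv Y L" "\<And>n. X n \<le> Y n" "i < m" "j < m"
  show "K $$ (i, j) \<le> L $$ (i, j)"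
    by (rule LIMSEQ_le[of "\<lambda>n. X n $$ (i, j)" _ "\<lambda>n. Y n $$ (i, j)"])
      (use * le_matD mconvD in auto)
qed (simp_all add: mconv_def)

lemma mconv_upper: "mconv X K \<Longrightarrow> L \<in> Mat \<Longrightarrow> (\<And>n. X n \<le> L) \<Longrightarrow> K \<le> L"
  using mconv_le mconv_const by blast

lemma mconv_lower: "mconv X K \<Longrightarrow> L \<in> Mat \<Longrightarrow> (\<And>n. L \<le> X n) \<Longrightarrow> L \<le> K"
  using mconv_le mconv_const by blast

lemma mconv_Suc: "mconv X K \<Longrightarrow> mconv (\<lambda>n. X (Suc n)) K"
  unfolding mconv_def using LIMSEQ_Suc by blast

lemma mono_bounded_mconv:
  assumes X: "\<And>n. X n \<in> Mat" and mono: "\<And>n. X n \<le> X (Suc n)"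
    and bound: "\<And>n i j. i < m \<Longrightarrow> j < m \<Longrightarrow> X n $$ (i, j) \<le> c"
  obtains L where "mconv X L" "\<And>n. X n \<le> L"
proof -
  define L where "L = mat m m (\<lambda>(i, j). lim (\<lambda>n. X n $$ (i, j)))"
  have inc: "incseq (\<lambda>n. X n $$ (i, j))" if "i < m" "j < m" for i j
    using that mono X by (auto intro!: incseq_SucI le_matD)
  have conv: "(\<lambda>n. X n $$ (i, j)) \<longlonglongrightarrow> L $$ (i, j)" if ij: "i < m" "j < m" for i j
  proof -
    obtain l where "(\<lambda>n. X n $$ (i, j)) \<longlonglongrightarrow> l"
      using incseq_convergent[OF inc[OF ij]] bound ij by metis
    thus ?thesis using ij by (simp add: L_def limI)
  qed
  have "mconv X L" unfolding mconv_def using X conv by (auto simp: L_def)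
  moreover have "X n \<le> L" for n
  proof (rule le_matI)
    show "L \<in> Mat" by (simp add: L_def)
    show "X n $$ (i, j) \<le> L $$ (i, j)" if "i < m" "j < m" for i j
      by (rule incseq_le[OF inc[OF that] conv[OF that]])
  qed (rule X)
  ultimately show ?thesis using that by blast
qed

lemma rows_le_mconv:
  assumes "mconv X L" "\<And>n. rows_le t (X n)"
  shows "rows_le t L"
  unfolding rows_le_def
proof (intro conjI allI impI)
  show "L \<in> Mat" using assms mconvD by blast
  show "Zero \<le> L" using assms by (intro mconv_lower[OF assms(1)]) (auto dest: rows_leD)
  fix i assume i: "i < m"
  have "(\<lambda>n. \<Sum>j<m. X n $$ (i, j)) \<longlonglongrightarrow> (\<Sum>j<m. L $$ (i, j))"
    using i assms by (intro tendsto_sum) (auto intro: mconvD)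
  thus "(\<Sum>j<m. L $$ (i, j)) \<le> t"
    using assms i by (intro LIMSEQ_le_const2) (auto dest: rows_leD)
qed

text \<open>Entries of products stay folded, so that products behave as atoms in linear arithmetic on
  entries; and the rules whose dimensions are not determined by the redex are replaced by instances
  for square matrices.\<close>

declare index_mult_mat(1) [simp del] assoc_mult_mat [simp del] mult_carrier_mat [simp del] assoc_add_mat [simp del]
  row_mult [simp del] col_mult [simp del]

lemmas mat_add_assoc [simp] = assoc_add_mat[of _ m m]

lemma add_closed [simp]: "X \<in> Mat \<Longrightarrow> Y \<in> Mat \<Longrightarrow> X + Y \<in> Mat"
  by (rule add_carrier_mat)

lemma minus_closed [simp]: "X \<in> Mat \<Longrightarrow> Y \<in> Mat \<Longrightarrow> X - Y \<in> Mat"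
  by (rule minus_carrier_mat)

lemma add_entry [simp]: "X \<in> Mat \<Longrightarrow> Y \<in> Mat \<Longrightarrow> i < m \<Longrightarrow> j < m \<Longrightarrow>
   (X + Y) $$ (i, j) = X $$ (i, j) + Y $$ (i, j)"
  by simp

lemma minus_entry [simp]: "X \<in> Mat \<Longrightarrow> Y \<in> Mat \<Longrightarrow> i < m \<Longrightarrow> j < m \<Longrightarrow>
   (X - Y) $$ (i, j) = X $$ (i, j) - Y $$ (i, j)"
  by simp

lemma eq_MatI:
  "X \<in> Mat \<Longrightarrow> Y \<in> Mat \<Longrightarrow> (\<And>i j. i < m \<Longrightarrow> j < m \<Longrightarrow> X $$ (i, j) = Y $$ (i, j)) \<Longrightarrow> X = Y"
  by (rule eq_matI) auto

lemma all_ones_entry [simp]: "i < m \<Longrightarrow> j < m \<Longrightarrow> all_ones $$ (i, j) = 1"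
  by (simp add: all_ones_def)

lemma all_ones_dim [simp]: "dim_row all_ones = m" "dim_col all_ones = m"
  by (simp_all add: all_ones_def)

lemma rows_le_iff:
  "rows_le t X \<longleftrightarrow> X \<in> Mat \<and> Zero \<le> X \<and> X * all_ones \<le> t \<cdot>\<^sub>m all_ones"
proof (cases "X \<in> Mat")
  case True
  have "X * all_ones \<le> t \<cdot>\<^sub>m all_ones \<longleftrightarrow> (\<forall>i<m. (\<Sum>j<m. X $$ (i, j)) \<le> t)"
    using True m_pos
    by (auto simp: less_eq_mat_def mult_all_ones_entry)
  thus ?thesis by (auto simp: rows_le_def)
qed (auto simp: rows_le_def)

section \<open>Neumann series\<close>

primrec neumann_sum :: "real mat \<Rightarrow> nat \<Rightarrow> real mat" where
  "neumann_sum Q 0 = Zero"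
| "neumann_sum Q (Suc k) = One + Q * neumann_sum Q k"

text \<open>\<open>N\<close> is the sum of the powers of \<open>Q\<close>. The two equations say that \<open>N\<close> is a two-sided inverse of
  \<open>I - Q\<close>; together with nonnegativity they are all that is used of the series.\<close>

definition neumann :: "real mat \<Rightarrow> real mat \<Rightarrow> bool" where
  "neumann Q N \<longleftrightarrow> Q \<in> Mat \<and> N \<in> Mat \<and> Zero \<le> N \<and> One + Q * N = N \<and> One + N * Q = N"

lemma neumannD:
  assumes "neumann Q N"
  shows "Q \<in> Mat" "N \<in> Mat" "Zero \<le> N" "One + Q * N = N" "One + N * Q = N"
  using assms by (auto simp: neumann_def)

lemma neumann_inverse:
  assumes "neumann Q N"
  shows "(One - Q) * N = One" "N * (One - Q) = One"
proof -
  note N = neumannD[OF assms]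
  show "(One - Q) * N = One"
  proof (rule eq_MatI)
    fix i j assume ij: "i < m" "j < m"
    have "(One + Q * N) $$ (i, j) = N $$ (i, j)" using N(4) by simp
    thus "((One - Q) * N) $$ (i, j) = One $$ (i, j)"
      using ij N(1,2) by (simp add: mat_distrib)
  qed (use N in auto)
  show "N * (One - Q) = One"
  proof (rule eq_MatI)
    fix i j assume ij: "i < m" "j < m"
    have "(One + N * Q) $$ (i, j) = N $$ (i, j)" using N(5) by simp
    thus "(N * (One - Q)) $$ (i, j) = One $$ (i, j)"
      using ij N(1,2) by (simp add: mat_distrib)
  qed (use N in auto)
qed

text \<open>Multiply \<open>X \<le> (I - Q) Y\<close> by the nonnegative matrix \<open>N\<close>. This comparison, and its mirror image
  below, yield every minimality statement of the development.\<close>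

lemma neumann_least_left:
  assumes N: "neumann Q N" and XY: "X \<in> Mat" "Y \<in> Mat" and le: "X + Q * Y \<le> Y"
  shows "N * X \<le> Y"
proof -
  note D = neumannD[OF N]
  have "X \<le> (One - Q) * Y"
  proof (rule le_matI)
    fix i j assume ij: "i < m" "j < m"
    show "X $$ (i, j) \<le> ((One - Q) * Y) $$ (i, j)"
      using le_matD[OF le XY(2) ij] ij XY D(1,2) by (simp add: mat_distrib)
  qed (use XY D in auto)
  hence "N * X \<le> N * ((One - Q) * Y)" using XY D by (intro mult_left_mono_mat) auto
  also have "N * ((One - Q) * Y) = (N * (One - Q)) * Y" using XY D by (simp add: mat_assoc)
  also have "\<dots> = Y" using XY D by (simp add: neumann_inverse[OF N])
  finally show ?thesis .
qed

lemma neumann_least_right: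
  assumes N: "neumann Q N" and XY: "X \<in> Mat" "Y \<in> Mat" and le: "X + Y * Q \<le> Y"
  shows "X * N \<le> Y"
proof -
  note D = neumannD[OF N]
  have "X \<le> Y * (One - Q)"
  proof (rule le_matI)
    fix i j assume ij: "i < m" "j < m"
    show "X $$ (i, j) \<le> (Y * (One - Q)) $$ (i, j)"
      using le_matD[OF le XY(2) ij] ij XY D(1,2) by (simp add: mat_distrib)
  qed (use XY D in auto)
  hence "X * N \<le> (Y * (One - Q)) * N" using XY D by (intro mult_right_mono_mat) auto
  also have "\<dots> = Y * ((One - Q) * N)" using XY D by (simp add: mat_assoc)
  also have "\<dots> = Y" using XY D by (simp add: neumann_inverse[OF N])
  finally show ?thesis .
qed

lemma neumann_mono:
  assumes N: "neumann Q N" and N': "neumann Q' N'" and le: "Q \<le> Q'"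
  shows "N \<le> N'"
proof -
  note D = neumannD[OF N] neumannD[OF N']
  have "One + Q * N' \<le> One + Q' * N'"
    using D le by (intro add_mono_mat mult_right_mono_mat) auto
  also have "\<dots> = N'" using D(9) by simp
  finally have "N * One \<le> N'" using D by (intro neumann_least_left[OF N]) auto
  thus ?thesis using D by simp
qed

lemma neumann_sum_closed [simp]: "Q \<in> Mat \<Longrightarrow> neumann_sum Q k \<in> Mat"
  by (induction k) auto

lemma neumann_sum_nonneg: "Q \<in> Mat \<Longrightarrow> Zero \<le> Q \<Longrightarrow> Zero \<le> neumann_sum Q k"
  by (induction k) (auto intro!: add_nonneg_mat mult_nonneg_mat)

lemma neumann_sum_mono:
  assumes "Q \<in> Mat" "Zero \<le> Q"
  shows "neumann_sum Q k \<le> neumann_sum Q (Suc k)"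
proof (induction k)
  case 0 show ?case using assms neumann_sum_nonneg[of Q 1] by simp
next
  case (Suc k) thus ?case using assms by (auto intro!: add_mono_mat mult_left_mono_mat)
qed

lemma neumann_sum_right:
  "Q \<in> Mat \<Longrightarrow> neumann_sum Q (Suc k) = One + neumann_sum Q k * Q"
proof (induction k)
  case (Suc k)
  have "neumann_sum Q (Suc (Suc k)) = One + Q * neumann_sum Q (Suc k)" by simp
  also have "\<dots> = One + Q * (One + neumann_sum Q k * Q)" using Suc by simp
  also have "\<dots> = One + (One + Q * neumann_sum Q k) * Q"
    using Suc.prems by (simp add: mat_distrib)
  finally show ?case by simp
qed auto

lemma neumann_of_bounded:
  assumes Q: "Q \<in> Mat" "Zero \<le> Q"
    and bound: "\<And>k i j. i < m \<Longrightarrow> j < m \<Longrightarrow> neumann_sum Q k $$ (i, j) \<le> c"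
  obtains N where "neumann Q N"
proof -
  obtain N where N: "mconv (neumann_sum Q) N" and up: "\<And>k. neumann_sum Q k \<le> N"
    using mono_bounded_mconv[of "neumann_sum Q" c] Q bound neumann_sum_mono by auto
  have "mconv (\<lambda>k. One + Q * neumann_sum Q k) (One + Q * N)"
    using Q by (intro mconv_add mconv_mult mconv_const N) auto
  hence "mconv (\<lambda>k. neumann_sum Q (Suc k)) (One + Q * N)" by simp
  from mconv_unique[OF this mconv_Suc[OF N]] have 1: "One + Q * N = N" .
  have "mconv (\<lambda>k. One + neumann_sum Q k * Q) (One + N * Q)"
    using Q by (intro mconv_add mconv_mult mconv_const N) auto
  hence "mconv (\<lambda>k. neumann_sum Q (Suc k)) (One + N * Q)"
    by (simp only: neumann_sum_right[OF Q(1)])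
  from mconv_unique[OF this mconv_Suc[OF N]] have 2: "One + N * Q = N" .
  have "Zero \<le> N" using up[of 0] by simp
  hence "neumann Q N" using 1 2 Q mconvD(2)[OF N] unfolding neumann_def by blast
  thus ?thesis using that by blast
qed

lemma neumann_sum_add:
  "Q \<in> Mat \<Longrightarrow> neumann_sum Q (l + k) = neumann_sum Q l + Q ^\<^sub>m l * neumann_sum Q k"
proof (induction l)
  case (Suc l)
  thus ?case
    by (simp add: mat_distrib pow_mat_Suc_left assoc_add_mat[of _ m m] del: pow_mat.simps)
qed auto

lemma entry_bound:
  assumes "X \<in> Mat"
  obtains c where "0 \<le> c" "\<And>i j. i < m \<Longrightarrow> j < m \<Longrightarrow> X $$ (i, j) \<le> c"
proof -
  define c where "c = (\<Sum>i<m. \<Sum>j<m. \<bar>X $$ (i, j)\<bar>)"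
  have "X $$ (i, j) \<le> c" if "i < m" "j < m" for i j
  proof -
    have "X $$ (i, j) \<le> \<bar>X $$ (i, j)\<bar>" by simp
    also have "\<dots> \<le> (\<Sum>j<m. \<bar>X $$ (i, j)\<bar>)" using that by (intro member_le_sum) auto
    also have "\<dots> \<le> c"
      unfolding c_def using that
      by (intro member_le_sum[of i "{..<m}" "\<lambda>i. \<Sum>j<m. \<bar>X $$ (i, j)\<bar>"] sum_nonneg) (auto intro: sum_nonneg)
    finally show ?thesis .
  qed
  moreover have "0 \<le> c" unfolding c_def by (auto intro: sum_nonneg)
  ultimately show ?thesis using that by blast
qed

text \<open>A bound \<open>c\<close> for the first \<open>l\<close> terms of the series gives the bound \<open>c / (1 - t)\<close> for all partial
  sums, since a longer partial sum is the first \<open>l\<close> terms plus \<open>Q\<^sup>l\<close> times a shorter one.\<close>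

lemma neumann_of_contraction:
  assumes Q: "rows_le t (Q ^\<^sub>m l)" "t < 1" "0 < l" "Q \<in> Mat" "Zero \<le> Q"
  obtains N where "neumann Q N"
proof -
  obtain c where c: "0 \<le> c" "\<And>i j. i < m \<Longrightarrow> j < m \<Longrightarrow> neumann_sum Q l $$ (i, j) \<le> c"
    using entry_bound[of "neumann_sum Q l"] Q by auto
  define d where "d = c / (1 - t)"
  have d: "c + t * d = d" using Q(2) by (simp add: d_def field_simps)
  have t: "0 \<le> t" using rows_le_nonneg Q(1) by blast
  have d0: "0 \<le> d" using c Q(2) by (simp add: d_def)
  have cd: "c \<le> d" using d d0 t by (metis add.commute le_add_same_cancel2 mult_nonneg_nonneg)
  have mono: "k \<le> k' \<Longrightarrow> neumann_sum Q k \<le> neumann_sum Q k'" for k k'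
    using neumann_sum_mono[OF Q(4,5)] by (rule lift_Suc_mono_le)
  have "\<forall>i<m. \<forall>j<m. neumann_sum Q k $$ (i, j) \<le> d" for k
  proof (induction k rule: less_induct)
    case (less k)
    show ?case
    proof (intro allI impI)
      fix i j assume ij: "i < m" "j < m"
      show "neumann_sum Q k $$ (i, j) \<le> d"
      proof (cases "k < l")
        case True
        hence "neumann_sum Q k $$ (i, j) \<le> neumann_sum Q l $$ (i, j)"
          using ij Q by (intro le_matD mono) auto
        thus ?thesis using c(2)[OF ij] cd by linarith
      next
        case False
        then obtain k' where k: "k = l + k'" using le_Suc_ex by (metis linorder_not_less)
        have "(Q ^\<^sub>m l * neumann_sum Q k') $$ (i, j) \<le> t * d"
          using less.IH[of k'] k Q(3,4) ij d0 by (intro rows_le_mult_entry[OF Q(1)]) auto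
        thus ?thesis using c(2)[OF ij] ij Q(4) d
          by (simp add: k neumann_sum_add)
      qed
    qed
  qed
  thus ?thesis using neumann_of_bounded[of Q d] Q that by blast
qed

definition star :: "real mat \<Rightarrow> real mat" where
  "star Q = (SOME N. neumann Q N)"

lemma neumann_star:
  assumes "rows_le t Q" "t < 1"
  shows "neumann Q (star Q)"
proof -
  have "rows_le t (Q ^\<^sub>m 1)" using assms rows_leD(1)[OF assms(1)] by simp
  then obtain N where "neumann Q N"
    using neumann_of_contraction[of t Q 1] assms rows_leD[OF assms(1)] by auto
  thus ?thesis unfolding star_def by (rule someI)
qed

lemma neumann_rows_le:
  assumes N: "neumann Q N" and Q: "rows_le t Q" "t < 1"
  shows "rows_le (1 / (1 - t)) N"
  unfolding rows_le_iff
proof (intro conjI)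
  note D = neumannD[OF N]
  show "N * all_ones \<le> (1 / (1 - t)) \<cdot>\<^sub>m all_ones"
  proof (rule neumann_least_left[OF N])
    show "all_ones + Q * ((1 / (1 - t)) \<cdot>\<^sub>m all_ones) \<le> (1 / (1 - t)) \<cdot>\<^sub>m all_ones"
    proof (rule le_matI)
      fix i j assume ij: "i < m" "j < m"
      have "(Q * ((1 / (1 - t)) \<cdot>\<^sub>m all_ones)) $$ (i, j) \<le> t * (1 / (1 - t))"
        using ij Q by (intro rows_le_mult_entry) auto
      thus "(all_ones + Q * ((1 / (1 - t)) \<cdot>\<^sub>m all_ones)) $$ (i, j) \<le> ((1 / (1 - t)) \<cdot>\<^sub>m all_ones) $$ (i, j)"
        using ij D Q(2) by (simp add: field_simps)
    qed (use D in auto)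
  qed auto
qed (use neumannD[OF N] in auto)

section \<open>First passage in a walk with killing\<close>

text \<open>The \<open>n\<close>-th iterate approximates \<open>U\<close>, the matrix of first returns to a level that do not visit
  lower levels, by excursions that rise at most \<open>n\<close> levels above it.\<close>

primrec taboo_iter :: "real mat \<Rightarrow> real mat \<Rightarrow> real mat \<Rightarrow> nat \<Rightarrow> real mat" where
  "taboo_iter a b c 0 = b"
| "taboo_iter a b c (Suc n) = b + c * (star (taboo_iter a b c n) * a)"

text \<open>With \<open>N = (I - U)\<^sup>-\<^sup>1\<close>, the matrices \<open>N a\<close> and \<open>c N\<close> solve the quadratic equations for \<open>G\<close> and \<open>R\<close>
  (see \<open>passage_equations\<close>). Defining both from one \<open>N\<close> makes the identity \<open>c G = R a\<close> automatic,
  which relates the two descriptions \<open>b + c G\<close> and \<open>b + R a\<close> of \<open>U\<close>.\<close>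

definition passage :: "real mat \<Rightarrow> real mat \<Rightarrow> real mat \<Rightarrow> real mat \<Rightarrow> real mat \<Rightarrow> bool" where
  "passage a b c U N \<longleftrightarrow>
     a \<in> Mat \<and> b \<in> Mat \<and> c \<in> Mat \<and> Zero \<le> a \<and> Zero \<le> b \<and> Zero \<le> c \<and>
     neumann U N \<and> U = b + c * (N * a)"

lemma passageD:
  assumes "passage a b c U N"
  shows "a \<in> Mat" "b \<in> Mat" "c \<in> Mat" "Zero \<le> a" "Zero \<le> b" "Zero \<le> c"
    "neumann U N" "U = b + c * (N * a)" "U \<in> Mat" "N \<in> Mat" "Zero \<le> N" "Zero \<le> U"
proof -
  show D: "a \<in> Mat" "b \<in> Mat" "c \<in> Mat" "Zero \<le> a" "Zero \<le> b" "Zero \<le> c"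
    "neumann U N" "U = b + c * (N * a)"
    using assms by (auto simp: passage_def)
  show "U \<in> Mat" "N \<in> Mat" "Zero \<le> N" using neumannD[OF D(7)] by auto
  thus "Zero \<le> U" using D(1-6) unfolding D(8)
    by (intro add_nonneg_mat mult_nonneg_mat) auto
qed

lemma passage_equations:
  assumes "passage a b c U N"
  shows "a + b * (N * a) + c * (N * a) * (N * a) = N * a"
    and "c + (c * N) * b + (c * N) * (c * N) * a = c * N"
proof -
  note D = passageD[OF assms]
  have "N * a = (One + U * N) * a" using neumannD(4)[OF D(7)] by simp
  also have "\<dots> = a + U * (N * a)" using D by (simp add: mat_distrib)
  also have "\<dots> = a + b * (N * a) + c * (N * a) * (N * a)"
    by (subst D(8)) (use D(1-6,10) in \<open>simp add: mat_distrib\<close>)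
  finally show "a + b * (N * a) + c * (N * a) * (N * a) = N * a" ..
  have "c * N = c * (One + N * U)" using neumannD(5)[OF D(7)] by simp
  also have "\<dots> = c + c * N * U" using D by (simp add: mat_distrib)
  also have "\<dots> = c + (c * N) * b + (c * N) * (c * N) * a"
    by (subst D(8)) (use D(1-6,10) in \<open>simp add: mat_distrib\<close>)
  finally show "c + (c * N) * b + (c * N) * (c * N) * a = c * N" ..
qed

text \<open>\<open>D k\<close> is a nonnegative function on level \<open>k\<close> of the half-line, superharmonic for the walk on
  the levels \<open>k \<ge> 1\<close>, with level 0 as the boundary.\<close>

definition superharmonic :: "real mat \<Rightarrow> real mat \<Rightarrow> real mat \<Rightarrow> (nat \<Rightarrow> real mat) \<Rightarrow> bool" where
  "superharmonic a b c D \<longleftrightarrow>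
     (\<forall>k. D k \<in> Mat \<and> Zero \<le> D k) \<and>
     (\<forall>k. a * D k + b * D (Suc k) + c * D (Suc (Suc k)) \<le> D (Suc k))"

text \<open>All conclusions are proved for the iterates \<open>V n\<close>, \<open>S n = (I - V n)\<^sup>-\<^sup>1\<close> by induction on \<open>n\<close> and passed
  to the limit. The iterates increase, and their row sums stay below those of \<open>b + c\<close> because
  \<open>S n a\<close> is substochastic. The last three conclusions compare \<open>G\<close> and \<open>R\<close> with arbitrary
  supersolutions of their equations, and say that the value of a superharmonic function is at least
  its average over the first visit to the level below.\<close>

lemma passage_strict:
  assumes abc: "a \<in> Mat" "b \<in> Mat" "c \<in> Mat" "Zero \<le> a" "Zero \<le> b" "Zero \<le> c"
    and rows: "rows_le s (a + b + c)" and s: "s < 1"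
  obtains U N where "passage a b c U N" "rows_le s U" "rows_le s (N * a)"
    "\<And>Y. Y \<in> Mat \<Longrightarrow> Zero \<le> Y \<Longrightarrow> a + b * Y + c * Y * Y \<le> Y \<Longrightarrow> N * a \<le> Y"
    "\<And>Y. Y \<in> Mat \<Longrightarrow> Zero \<le> Y \<Longrightarrow> c + Y * b + Y * Y * a \<le> Y \<Longrightarrow> c * N \<le> Y"
    "\<And>D k. superharmonic a b c D \<Longrightarrow> N * a * D k \<le> D (Suc k)"
proof -
  define V where "V = taboo_iter a b c"
  define S where "S n = star (V n)" for n
  have V0: "V 0 = b" and VS: "V (Suc n) = b + c * (S n * a)" for n
    by (simp_all add: V_def S_def)
  have s0: "0 \<le> s" using rows_le_nonneg rows by blast
  have abc_rows: "(a * all_ones) $$ (i, j) + (b * all_ones) $$ (i, j) + (c * all_ones) $$ (i, j) \<le> s"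
    if "i < m" "j < m" for i j
  proof -
    have "(a + b + c) * all_ones \<le> s \<cdot>\<^sub>m all_ones" using rows by (simp add: rows_le_iff)
    from le_matD[OF this _ that] show ?thesis using that abc by (simp add: mat_distrib)
  qed
  have a_ones: "0 \<le> (a * all_ones) $$ (i, j)" if "i < m" "j < m" for i j
    using that abc by (intro nonneg_matD mult_nonneg_mat) auto

  (* S n a 1 <= s 1 holds since a 1 + V n (s 1) <= a 1 + (b + c) 1 <= s 1. *)
  have step: "rows_le s (V n) \<and> V n * all_ones \<le> b * all_ones + c * all_ones \<Longrightarrow>
      neumann (V n) (S n) \<and> rows_le s (S n * a)" for n
  proof (elim conjE)
    assume V: "rows_le s (V n)" and Vo: "V n * all_ones \<le> b * all_ones + c * all_ones"
    have N: "neumann (V n) (S n)" unfolding S_def using neumann_star[OF V s] .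
    note ND = neumannD[OF N]
    have "S n * (a * all_ones) \<le> s \<cdot>\<^sub>m all_ones"
    proof (rule neumann_least_left[OF N])
      show "a * all_ones + V n * (s \<cdot>\<^sub>m all_ones) \<le> s \<cdot>\<^sub>m all_ones"
      proof (rule le_matI)
        fix i j assume ij: "i < m" "j < m"
        have "(V n * (s \<cdot>\<^sub>m all_ones)) $$ (i, j) = s * (V n * all_ones) $$ (i, j)"
          using ND ij by (simp add: mult_entry sum_distrib_left mult_ac)
        also have "\<dots> \<le> 1 * (V n * all_ones) $$ (i, j)"
          using s ij rows_leD[OF V]
          by (intro mult_right_mono nonneg_matD mult_nonneg_mat) auto
        also have "\<dots> \<le> (b * all_ones) $$ (i, j) + (c * all_ones) $$ (i, j)"
          using le_matD[OF Vo _ ij] abc ij by simp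
        finally show "(a * all_ones + V n * (s \<cdot>\<^sub>m all_ones)) $$ (i, j) \<le> (s \<cdot>\<^sub>m all_ones) $$ (i, j)"
          using abc_rows[OF ij] ij abc ND by simp
      qed (use abc ND in auto)
    qed (use abc in auto)
    hence "rows_le s (S n * a)" using abc ND
      unfolding rows_le_iff by (auto simp: mat_assoc intro!: mult_nonneg_mat)
    with N show ?thesis by blast
  qed
  have inv: "rows_le s (V n) \<and> V n * all_ones \<le> b * all_ones + c * all_ones" for n
  proof (induction n)
    case 0
    have le: "b * all_ones \<le> b * all_ones + c * all_ones"
    proof (rule le_matI)
      fix i j assume ij: "i < m" "j < m"
      have "0 \<le> (c * all_ones) $$ (i, j)"
        using ij abc by (intro nonneg_matD mult_nonneg_mat) auto
      thus "(b * all_ones) $$ (i, j) \<le> (b * all_ones + c * all_ones) $$ (i, j)"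
        using ij abc by simp
    qed (use abc in auto)
    have "b * all_ones \<le> s \<cdot>\<^sub>m all_ones"
    proof (rule le_matI)
      fix i j assume ij: "i < m" "j < m"
      show "(b * all_ones) $$ (i, j) \<le> (s \<cdot>\<^sub>m all_ones) $$ (i, j)"
        using le_matD[OF le _ ij] abc_rows[OF ij] a_ones[OF ij] ij abc by simp
    qed (use abc in auto)
    thus ?case using le abc by (auto simp: V0 rows_le_iff)
  next
    case (Suc n)
    note st = step[OF Suc]
    have SM: "S n \<in> Mat" "Zero \<le> S n" using st neumannD by auto
    have "S n * a * all_ones \<le> all_ones"
    proof (rule le_matI)
      fix i j assume ij: "i < m" "j < m"
      have "S n * a * all_ones \<le> s \<cdot>\<^sub>m all_ones" using st by (simp add: rows_le_iff)
      from le_matD[OF this _ ij] show "(S n * a * all_ones) $$ (i, j) \<le> all_ones $$ (i, j)"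
        using ij s by simp
    qed (use abc SM in auto)
    hence "c * (S n * a * all_ones) \<le> c * all_ones"
      using abc SM by (intro mult_left_mono_mat) auto
    hence le: "V (Suc n) * all_ones \<le> b * all_ones + c * all_ones"
      unfolding VS using abc SM by (auto simp: mat_distrib intro!: add_mono_mat)
    have "V (Suc n) * all_ones \<le> s \<cdot>\<^sub>m all_ones"
    proof (rule le_matI)
      fix i j assume ij: "i < m" "j < m"
      show "(V (Suc n) * all_ones) $$ (i, j) \<le> (s \<cdot>\<^sub>m all_ones) $$ (i, j)"
        using le_matD[OF le _ ij] abc_rows[OF ij] a_ones[OF ij] ij abc SM by (simp add: VS)
    qed (use abc SM in \<open>auto simp: VS\<close>)
    moreover have "Zero \<le> V (Suc n)" unfolding VS using abc SM
      by (intro add_nonneg_mat mult_nonneg_mat) auto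
    ultimately show ?case using le abc SM by (auto simp: VS rows_le_iff)
  qed
  have N: "neumann (V n) (S n)" and Gr: "rows_le s (S n * a)" and Vr: "rows_le s (V n)" for n
    using step[OF inv] inv by auto
  note ND = neumannD[OF N]

  have Vmono: "V n \<le> V (Suc n)" for n
  proof (induction n)
    case 0
    have "b + Zero \<le> b + c * (S 0 * a)"
      using abc ND by (intro add_mono_mat mult_nonneg_mat) auto
    thus ?case using abc by (simp add: V0 VS)
  next
    case (Suc n)
    show ?case unfolding VS[of n] VS[of "Suc n"] using abc ND
      by (intro add_mono_mat mult_left_mono_mat mult_right_mono_mat neumann_mono[OF N N Suc]) auto
  qed
  obtain U where U: "mconv V U"
    using mono_bounded_mconv[of V s] ND(1) Vmono rows_le_entry[OF Vr] by metis
  have Sr: "rows_le (1 / (1 - s)) (S n)" for n by (rule neumann_rows_le[OF N Vr s])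
  obtain S' where S': "mconv S S'" and S'up: "\<And>n. S n \<le> S'"
    using mono_bounded_mconv[of S "1 / (1 - s)"] ND(2) neumann_mono[OF N N Vmono] rows_le_entry[OF Sr] by metis
  have 1: "One + U * S' = S'"
    using mconv_unique[OF mconv_add[OF mconv_const mconv_mult[OF U S']], of One S'] S' ND(4) by simp
  have 2: "One + S' * U = S'"
    using mconv_unique[OF mconv_add[OF mconv_const mconv_mult[OF S' U]], of One S'] S' ND(5) by simp
  have S'0: "Zero \<le> S'" using ND(3) by (intro mconv_lower[OF S']) auto
  have nU: "neumann U S'" unfolding neumann_def
    using 1 2 S'0 mconvD(2)[OF U] mconvD(2)[OF S'] by auto
  have "mconv (\<lambda>n. b + c * (S n * a)) (b + c * (S' * a))"
    using abc by (intro mconv_add mconv_mult mconv_const S') auto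
  hence "mconv (\<lambda>n. V (Suc n)) (b + c * (S' * a))" by (simp add: VS)
  from mconv_unique[OF mconv_Suc[OF U] this] have U_eq: "U = b + c * (S' * a)" .
  have GL: "mconv (\<lambda>n. S n * a) (S' * a)"
    using abc by (intro mconv_mult S' mconv_const) auto
  have RL: "mconv (\<lambda>n. c * S n) (c * S')"
    using abc by (intro mconv_mult S' mconv_const) auto
  show ?thesis
  proof (rule that)
    show "passage a b c U S'" unfolding passage_def using abc nU U_eq by blast
    show "rows_le s U" by (rule rows_le_mconv[OF U Vr])
    show "rows_le s (S' * a)" by (rule rows_le_mconv[OF GL Gr])
  next
    fix Y assume Y: "Y \<in> Mat" "Zero \<le> Y" and sup: "a + b * Y + c * Y * Y \<le> Y"
    have step: "S n * a \<le> Y" if V: "V n \<le> b + c * Y" for n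
    proof (rule neumann_least_left[OF N])
      have "a + V n * Y \<le> a + (b + c * Y) * Y"
        using V abc Y ND by (intro add_mono_mat mult_right_mono_mat) auto
      also have "\<dots> = a + b * Y + c * Y * Y" using abc Y by (simp add: mat_distrib)
      also note sup
      finally show "a + V n * Y \<le> Y" .
    qed (use abc Y in auto)
    have "V n \<le> b + c * Y" for n
    proof (induction n)
      case 0
      have "b + Zero \<le> b + c * Y" using abc Y by (intro add_mono_mat mult_nonneg_mat) auto
      thus ?case using abc by (simp add: V0)
    next
      case (Suc n)
      show ?case unfolding VS using step[OF Suc] abc Y ND
        by (intro add_mono_mat mult_left_mono_mat) auto
    qed
    thus "S' * a \<le> Y" using step Y by (intro mconv_upper[OF GL]) auto
  next
    fix Y assume Y: "Y \<in> Mat" "Zero \<le> Y" and sup: "c + Y * b + Y * Y * a \<le> Y"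
    have step: "c * S n \<le> Y" if V: "V n \<le> b + Y * a" for n
    proof (rule neumann_least_right[OF N])
      have "c + Y * V n \<le> c + Y * (b + Y * a)"
        using V abc Y ND by (intro add_mono_mat mult_left_mono_mat) auto
      also have "\<dots> = c + Y * b + Y * Y * a" using abc Y by (simp add: mat_distrib)
      also note sup
      finally show "c + Y * V n \<le> Y" .
    qed (use abc Y in auto)
    have "V n \<le> b + Y * a" for n
    proof (induction n)
      case 0
      have "b + Zero \<le> b + Y * a" using abc Y by (intro add_mono_mat mult_nonneg_mat) auto
      thus ?case using abc by (simp add: V0)
    next
      case (Suc n)
      have "c * S n * a \<le> Y * a" using step[OF Suc] abc Y ND by (intro mult_right_mono_mat) auto
      thus ?case unfolding VS using abc Y ND by (intro add_mono_mat) (auto simp: mat_assoc)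
    qed
    thus "c * S' \<le> Y" using step Y by (intro mconv_upper[OF RL]) auto
  next
    fix D k assume "superharmonic a b c D"
    hence D: "D k \<in> Mat" "Zero \<le> D k"
      and sup: "a * D k + b * D (Suc k) + c * D (Suc (Suc k)) \<le> D (Suc k)" for k
      by (auto simp: superharmonic_def)
    have le: "S n * a * D k \<le> D (Suc k)" for n k
    proof (induction n arbitrary: k)
      case 0
      have "a * D k + V 0 * D (Suc k) + Zero \<le> a * D k + b * D (Suc k) + c * D (Suc (Suc k))"
        using abc D by (intro add_mono_mat mult_nonneg_mat) (auto simp: V0)
      also note sup
      finally have "S 0 * (a * D k) \<le> D (Suc k)"
        using abc D ND by (intro neumann_least_left[OF N]) auto
      thus ?case using abc D ND by (simp add: mat_assoc)
    next
      case (Suc n)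
      have "c * (S n * a * D (Suc k)) \<le> c * D (Suc (Suc k))"
        using abc D ND Suc by (intro mult_left_mono_mat) auto
      hence "a * D k + (b * D (Suc k) + c * (S n * a * D (Suc k)))
          \<le> a * D k + (b * D (Suc k) + c * D (Suc (Suc k)))"
        using abc D ND by (intro add_mono_mat) auto
      also have "\<dots> \<le> D (Suc k)" using sup[of k] abc D by simp
      finally have "a * D k + V (Suc n) * D (Suc k) \<le> D (Suc k)"
        unfolding VS using abc D ND by (simp add: mat_distrib)
      hence "S (Suc n) * (a * D k) \<le> D (Suc k)"
        using abc D ND by (intro neumann_least_left[OF N]) auto
      thus ?case using abc D ND by (simp add: mat_assoc)
    qed
    have "mconv (\<lambda>n. S n * a * D k) (S' * a * D k)"
      using D by (intro mconv_mult[OF GL] mconv_const) auto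
    from mconv_upper[OF this D(1) le] show "S' * a * D k \<le> D (Suc k)" .
  qed
qed

section \<open>The limit of vanishing killing\<close>

lemma mono_le_mconv:
  assumes X: "\<And>n. X n \<in> Mat" and mono: "\<And>n. X n \<le> X (Suc n)"
    and Y: "Y \<in> Mat" "\<And>n. X n \<le> Y"
  obtains L where "mconv X L" "\<And>n. X n \<le> L" "L \<le> Y"
proof -
  obtain e where e: "\<And>i j. i < m \<Longrightarrow> j < m \<Longrightarrow> Y $$ (i, j) \<le> e"
    using entry_bound[OF Y(1)] by metis
  have "X n $$ (i, j) \<le> e" if "i < m" "j < m" for n i j
    using le_matD[OF Y(2,1) that] e[OF that] by (rule order_trans)
  then obtain L where L: "mconv X L" "\<And>n. X n \<le> L"
    using mono_bounded_mconv[of X e] X mono by metis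
  show ?thesis using that L mconv_upper[OF L(1) Y] by blast
qed

text \<open>The survival probability at each step in the \<open>n\<close>-th approximation; it increases to 1.\<close>

definition shrink :: "nat \<Rightarrow> real" where
  "shrink n = real n / (real n + 1)"

lemma shrink_bounds: "0 \<le> shrink n" "shrink n < 1"
  by (auto simp: shrink_def field_simps)

lemma shrink_mono: "shrink n \<le> shrink (Suc n)"
  by (simp add: shrink_def field_simps)

lemma shrink_tendsto: "shrink \<longlonglongrightarrow> 1"
  unfolding shrink_def using LIMSEQ_n_over_Suc_n by (simp add: add.commute)

lemma smult_closed [simp]: "X \<in> Mat \<Longrightarrow> t \<cdot>\<^sub>m X \<in> Mat"
  by simp

lemma shrink_nonneg: "X \<in> Mat \<Longrightarrow> Zero \<le> X \<Longrightarrow> Zero \<le> shrink n \<cdot>\<^sub>m X"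
  using shrink_bounds(1) by (intro le_matI) (auto intro!: mult_nonneg_nonneg nonneg_matD)

lemma shrink_le: "X \<in> Mat \<Longrightarrow> Zero \<le> X \<Longrightarrow> shrink n \<cdot>\<^sub>m X \<le> X"
  using shrink_bounds[of n]
  by (intro le_matI) (auto intro!: mult_left_le_one_le nonneg_matD)

lemma shrink_Suc: "X \<in> Mat \<Longrightarrow> Zero \<le> X \<Longrightarrow> shrink n \<cdot>\<^sub>m X \<le> shrink (Suc n) \<cdot>\<^sub>m X"
  using shrink_mono[of n] by (intro le_matI) (auto intro!: mult_right_mono nonneg_matD)

lemma shrink_mconv: "X \<in> Mat \<Longrightarrow> mconv (\<lambda>n. shrink n \<cdot>\<^sub>m X) X"
proof -
  assume X: "X \<in> Mat"
  have "1 \<cdot>\<^sub>m X = X" using X by (intro eq_MatI) auto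
  thus ?thesis using mconv_smult[OF shrink_tendsto X] by simp
qed

lemma shrink_rows:
  assumes "a \<in> Mat" "b \<in> Mat" "c \<in> Mat" "Zero \<le> a" "Zero \<le> b" "Zero \<le> c" "rows_le 1 (a + b + c)"
  shows "rows_le (shrink n) (shrink n \<cdot>\<^sub>m a + shrink n \<cdot>\<^sub>m b + shrink n \<cdot>\<^sub>m c)"
proof -
  have eq: "shrink n \<cdot>\<^sub>m a + shrink n \<cdot>\<^sub>m b + shrink n \<cdot>\<^sub>m c = shrink n \<cdot>\<^sub>m (a + b + c)"
    using assms by (intro eq_MatI) (auto simp: distrib_left)
  have "(\<Sum>j<m. (shrink n \<cdot>\<^sub>m (a + b + c)) $$ (i, j)) \<le> shrink n" if i: "i < m" for i
  proof -
    have "(\<Sum>j<m. (shrink n \<cdot>\<^sub>m (a + b + c)) $$ (i, j)) = shrink n * (\<Sum>j<m. (a + b + c) $$ (i, j))"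
      using i assms by (subst sum_distrib_left) (intro sum.cong, auto)
    also have "\<dots> \<le> shrink n * 1"
      using i rows_leD(3)[OF assms(7) i] shrink_bounds by (intro mult_left_mono) auto
    finally show ?thesis by simp
  qed
  moreover have "Zero \<le> shrink n \<cdot>\<^sub>m (a + b + c)"
    using assms by (intro shrink_nonneg add_nonneg_mat) auto
  ultimately show ?thesis using assms unfolding eq rows_le_def by auto
qed

text \<open>The equation is written as a fixed point equation, in which nonnegative iteration makes sense.\<close>

definition first_passage_matrix :: "real mat \<Rightarrow> real mat \<Rightarrow> real mat \<Rightarrow> real mat \<Rightarrow> bool" where
  "first_passage_matrix a b c G \<longleftrightarrow> G \<in> Mat \<and> Zero \<le> G \<and> a + b * G + c * G * G = G \<and>
     (\<forall>Y\<in>Mat. Zero \<le> Y \<and> a + b * Y + c * Y * Y = Y \<longrightarrow> G \<le> Y)"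

definition rate_matrix :: "real mat \<Rightarrow> real mat \<Rightarrow> real mat \<Rightarrow> real mat \<Rightarrow> bool" where
  "rate_matrix a b c R \<longleftrightarrow> R \<in> Mat \<and> Zero \<le> R \<and> c + R * b + R * R * a = R \<and>
     (\<forall>Y\<in>Mat. Zero \<le> Y \<and> c + Y * b + Y * Y * a = Y \<longrightarrow> R \<le> Y)"

text \<open>The solutions for the killed walk increase with the survival probability and stay below the minimal
  solution of the limiting equation, because the latter is a supersolution of each killed equation.
  Their limit solves the limiting equation, so by minimality it is the minimal solution.\<close>

lemma passage_limit:
  assumes abc: "a \<in> Mat" "b \<in> Mat" "c \<in> Mat" "Zero \<le> a" "Zero \<le> b" "Zero \<le> c"
    and rows: "rows_le 1 (a + b + c)" and G: "first_passage_matrix a b c G"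
  obtains U N where
    "\<And>n. passage (shrink n \<cdot>\<^sub>m a) (shrink n \<cdot>\<^sub>m b) (shrink n \<cdot>\<^sub>m c) (U n) (N n)"
    "\<And>n. rows_le (shrink n) (N n * (shrink n \<cdot>\<^sub>m a))"
    "\<And>n. N n * (shrink n \<cdot>\<^sub>m a) \<le> N (Suc n) * (shrink (Suc n) \<cdot>\<^sub>m a)"
    "\<And>n. N n * (shrink n \<cdot>\<^sub>m a) \<le> G"
    "mconv (\<lambda>n. N n * (shrink n \<cdot>\<^sub>m a)) G"
    "\<And>n. U n \<le> b + c * G"
    "\<And>n. N n \<le> N (Suc n)"
    "\<And>R n. rate_matrix a b c R \<Longrightarrow> (shrink n \<cdot>\<^sub>m c) * N n \<le> R"
    "\<And>R. rate_matrix a b c R \<Longrightarrow> mconv (\<lambda>n. (shrink n \<cdot>\<^sub>m c) * N n) R"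
    "\<And>D k. superharmonic a b c D \<Longrightarrow> G * D k \<le> D (Suc k)"
proof -
  define a' b' c' where defs: "a' n = shrink n \<cdot>\<^sub>m a" "b' n = shrink n \<cdot>\<^sub>m b" "c' n = shrink n \<cdot>\<^sub>m c" for n
  have abc': "a' n \<in> Mat" "b' n \<in> Mat" "c' n \<in> Mat" "Zero \<le> a' n" "Zero \<le> b' n" "Zero \<le> c' n"
    "a' n \<le> a" "b' n \<le> b" "c' n \<le> c"
    "a' n \<le> a' (Suc n)" "b' n \<le> b' (Suc n)" "c' n \<le> c' (Suc n)" for n
    using abc by (auto simp: defs intro: shrink_nonneg shrink_le shrink_Suc)
  have rows': "rows_le (shrink n) (a' n + b' n + c' n)" for n
    unfolding defs by (rule shrink_rows[OF abc rows])
  have "\<exists>U N. passage (a' n) (b' n) (c' n) U N \<and> rows_le (shrink n) (N * a' n) \<and>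
    (\<forall>Y. Y \<in> Mat \<longrightarrow> Zero \<le> Y \<longrightarrow> a' n + b' n * Y + c' n * Y * Y \<le> Y \<longrightarrow> N * a' n \<le> Y) \<and>
    (\<forall>Y. Y \<in> Mat \<longrightarrow> Zero \<le> Y \<longrightarrow> c' n + Y * b' n + Y * Y * a' n \<le> Y \<longrightarrow> c' n * N \<le> Y) \<and>
    (\<forall>D k. superharmonic (a' n) (b' n) (c' n) D \<longrightarrow> N * a' n * D k \<le> D (Suc k))" for n
    by (rule passage_strict[OF abc'(1-6) rows' shrink_bounds(2), of n]) blast
  then obtain U N where UN:
    "\<And>n. passage (a' n) (b' n) (c' n) (U n) (N n)"
    "\<And>n. rows_le (shrink n) (N n * a' n)"
    "\<And>n Y. Y \<in> Mat \<Longrightarrow> Zero \<le> Y \<Longrightarrow> a' n + b' n * Y + c' n * Y * Y \<le> Y \<Longrightarrow> N n * a' n \<le> Y"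
    "\<And>n Y. Y \<in> Mat \<Longrightarrow> Zero \<le> Y \<Longrightarrow> c' n + Y * b' n + Y * Y * a' n \<le> Y \<Longrightarrow> c' n * N n \<le> Y"
    "\<And>n D k. superharmonic (a' n) (b' n) (c' n) D \<Longrightarrow> N n * a' n * D k \<le> D (Suc k)"
    by metis
  note PD = passageD[OF UN(1)]
  define G' where "G' n = N n * a' n" for n
  define R' where "R' n = c' n * N n" for n
  have GR: "G' n \<in> Mat" "Zero \<le> G' n" "R' n \<in> Mat" "Zero \<le> R' n" for n
    using abc' PD by (auto simp: G'_def R'_def intro!: mult_nonneg_mat)
  have Geq: "a' n + b' n * G' n + c' n * G' n * G' n = G' n" for n
    using passage_equations(1)[OF UN(1)] by (simp add: G'_def)
  have Req: "c' n + R' n * b' n + R' n * R' n * a' n = R' n" for n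
    using passage_equations(2)[OF UN(1)] by (simp add: R'_def)
  (* Y may solve the equation with any larger coefficients x, y, z: the next approximation is
     needed for monotonicity in n, and a, b, c for the upper bound. *)
  have Gsup: "G' n \<le> Y" if Y: "Y \<in> Mat" "Zero \<le> Y" "x + y * Y + z * Y * Y = Y"
    "a' n \<le> x" "b' n \<le> y" "c' n \<le> z" "x \<in> Mat" "y \<in> Mat" "z \<in> Mat" for n Y x y z
  proof -
    have "a' n + b' n * Y + c' n * Y * Y \<le> x + y * Y + z * Y * Y"
      using Y abc' by (intro add_mono_mat mult_right_mono_mat) auto
    thus ?thesis unfolding G'_def using Y by (intro UN(3)) auto
  qed
  have Rsup: "R' n \<le> Y" if Y: "Y \<in> Mat" "Zero \<le> Y" "z + Y * y + Y * Y * x = Y"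
    "a' n \<le> x" "b' n \<le> y" "c' n \<le> z" "x \<in> Mat" "y \<in> Mat" "z \<in> Mat" for n Y x y z
  proof -
    have "c' n + Y * b' n + Y * Y * a' n \<le> z + Y * y + Y * Y * x"
      using Y abc' by (intro add_mono_mat mult_left_mono_mat mult_nonneg_mat) auto
    thus ?thesis unfolding R'_def using Y by (intro UN(4)) auto
  qed
  have Gmono: "G' n \<le> G' (Suc n)" for n
    using GR abc' by (intro Gsup[OF _ _ Geq]) auto
  have Rmono: "R' n \<le> R' (Suc n)" for n
    using GR abc' by (intro Rsup[OF _ _ Req]) auto
  have GD: "G \<in> Mat" "Zero \<le> G" "a + b * G + c * G * G = G"
    and Gmin: "Y \<in> Mat \<Longrightarrow> Zero \<le> Y \<Longrightarrow> a + b * Y + c * Y * Y = Y \<Longrightarrow> G \<le> Y" for Y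
    using G by (auto simp: first_passage_matrix_def)
  have Gle: "G' n \<le> G" for n using GD abc abc' by (intro Gsup[OF _ _ GD(3)]) auto
  have conv: "mconv a' a" "mconv b' b" "mconv c' c"
    using abc unfolding defs by (auto intro: shrink_mconv)
  have Gconv: "mconv G' G"
  proof -
    obtain L where L: "mconv G' L"
      using mono_le_mconv[of G' G] GR Gmono Gle GD(1) by metis
    have "mconv (\<lambda>n. a' n + b' n * G' n + c' n * G' n * G' n) (a + b * L + c * L * L)"
      by (intro mconv_add mconv_mult conv L)
    hence "mconv G' (a + b * L + c * L * L)" by (simp add: Geq)
    from mconv_unique[OF this L] have "a + b * L + c * L * L = L" .
    moreover have "Zero \<le> L" using GR by (intro mconv_lower[OF L]) auto
    ultimately have "G \<le> L" using mconvD(2)[OF L] by (intro Gmin) auto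
    moreover have "L \<le> G" using Gle GD by (intro mconv_upper[OF L]) auto
    ultimately show ?thesis using L by simp
  qed
  have Rle: "R' n \<le> R" and Rconv: "mconv R' R" if R: "rate_matrix a b c R" for n R
  proof -
    have RD: "R \<in> Mat" "Zero \<le> R" "c + R * b + R * R * a = R"
      and Rmin: "Y \<in> Mat \<Longrightarrow> Zero \<le> Y \<Longrightarrow> c + Y * b + Y * Y * a = Y \<Longrightarrow> R \<le> Y" for Y
      using R by (auto simp: rate_matrix_def)
    show Rle: "R' n \<le> R" for n using RD abc abc' by (intro Rsup[OF _ _ RD(3)]) auto
    obtain L where L: "mconv R' L"
      using mono_le_mconv[of R' R] GR Rmono Rle RD(1) by metis
    have "mconv (\<lambda>n. c' n + R' n * b' n + R' n * R' n * a' n) (c + L * b + L * L * a)"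
      by (intro mconv_add mconv_mult conv L)
    hence "mconv R' (c + L * b + L * L * a)" by (simp add: Req)
    from mconv_unique[OF this L] have "c + L * b + L * L * a = L" .
    moreover have "Zero \<le> L" using GR by (intro mconv_lower[OF L]) auto
    ultimately have "R \<le> L" using mconvD(2)[OF L] by (intro Rmin) auto
    moreover have "L \<le> R" using Rle RD by (intro mconv_upper[OF L]) auto
    ultimately show "mconv R' R" using L by simp
  qed
  have Umono: "U n \<le> U (Suc n)" for n
    unfolding PD(8)[of n] PD(8)[of "Suc n"] G'_def[symmetric]
    using Gmono[of n] GR abc' by (intro add_mono_mat mult_mono_mat) auto
  have Ule: "U n \<le> b + c * G" for n
    unfolding PD(8)[of n] G'_def[symmetric]
    using Gle[of n] GR abc abc' GD by (intro add_mono_mat mult_mono_mat) auto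
  have Nmono: "N n \<le> N (Suc n)" for n
    using neumann_mono[OF PD(7) PD(7) Umono] .
  have harm: "G * D k \<le> D (Suc k)" if D: "superharmonic a b c D" for D k
  proof -
    have DM: "D k \<in> Mat" "Zero \<le> D k" for k using D by (auto simp: superharmonic_def)
    have "superharmonic (a' n) (b' n) (c' n) D" for n
      unfolding superharmonic_def
    proof (intro conjI allI)
      fix k
      have "a' n * D k + b' n * D (Suc k) + c' n * D (Suc (Suc k))
        \<le> a * D k + b * D (Suc k) + c * D (Suc (Suc k))"
        using abc abc' DM by (intro add_mono_mat mult_right_mono_mat) auto
      also have "\<dots> \<le> D (Suc k)" using D by (auto simp: superharmonic_def)
      finally show "a' n * D k + b' n * D (Suc k) + c' n * D (Suc (Suc k)) \<le> D (Suc k)" .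
    qed (use DM in auto)
    hence le: "G' n * D k \<le> D (Suc k)" for n unfolding G'_def by (rule UN(5))
    show ?thesis by (rule mconv_upper[OF mconv_mult[OF Gconv mconv_const[OF DM(1)]] DM(1) le])
  qed
  show ?thesis
    by (rule that[of U N]) (use UN(1,2) Gmono Gle Gconv Ule Nmono Rle Rconv harm in
      \<open>unfold defs G'_def R'_def, blast+\<close>)
qed

section \<open>The Green matrix of the walk on all levels\<close>

text \<open>The hypothesis says that \<open>I - U - a X\<close> has right inverse \<open>H\<close>. Because \<open>a = (I - U) N a\<close>, that matrix is
  \<open>(I - U) (I - N a X)\<close>.\<close>

lemma passage_resolvent:
  assumes p: "passage a b c U N" and X: "X \<in> Mat" and HM: "H \<in> Mat"
    and H: "One + (b + c * (N * a) + a * X) * H = H"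
  shows "N + N * a * (X * H) = H"
proof -
  note D = passageD[OF p]
  note E = D(1-7) D(9-12)
  define G where "G = N * a"
  have GM: "G \<in> Mat" using E by (simp add: G_def)
  have "(One - U) * (G * (X * H)) = (One - U) * N * a * (X * H)"
    using E X HM by (simp add: G_def mat_assoc)
  also have "\<dots> = a * (X * H)" using E X HM by (simp add: neumann_inverse[OF D(7)])
  finally have e: "(One - U) * (G * (X * H)) = a * (X * H)" .
  have "(One - U) * (N + G * (X * H)) = (One - U) * N + (One - U) * (G * (X * H))"
    using E GM X HM by (intro mult_add_distrib_mat[of _ m m _ m]) auto
  also have "\<dots> = One + a * (X * H)" unfolding e by (simp add: neumann_inverse[OF D(7)])
  also have "\<dots> = (One - U) * H"
  proof (rule eq_MatI)
    fix i j assume ij: "i < m" "j < m"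
    have "(One + (b + c * G + a * X) * H) $$ (i, j) = H $$ (i, j)" using H by (simp add: G_def)
    moreover have "((b + c * G) * H) $$ (i, j) = (U * H) $$ (i, j)" using D(8) by (simp add: G_def)
    ultimately show "(One + a * (X * H)) $$ (i, j) = ((One - U) * H) $$ (i, j)"
      using ij D(1-3,9) HM GM X by (simp add: mat_distrib)
  qed (use E GM X HM in auto)
  finally have "N * ((One - U) * (N + G * (X * H))) = N * ((One - U) * H)" by simp
  hence "N * (One - U) * (N + G * (X * H)) = N * (One - U) * H"
    using E GM X HM by (simp add: mat_assoc)
  thus ?thesis using E GM X HM by (simp add: neumann_inverse[OF D(7)] G_def)
qed

text \<open>Splitting off first the downward or first the upward passages gives
  \<open>(I - G Gh) H = N\<close> and \<open>(I - Gh G) H = Nh\<close>. As \<open>R = c N\<close> and \<open>Gh = Nh c\<close>, both \<open>H R\<close> and \<open>Gh H\<close> become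
  \<open>Gh N\<close> when multiplied by \<open>I - Gh G\<close> from the left: for \<open>Gh H\<close> this is
  \<open>(I - Gh G) Gh = Gh (I - G Gh)\<close>. In terms of the walk, \<open>H R\<close> and \<open>Gh H\<close> both count the expected visits
  to the level above the starting one.\<close>

lemma strict_green:
  assumes p: "passage a b c U N" and ph: "passage c b a Uh Nh"
    and r: "rows_le s (N * a)" "rows_le s (Nh * c)" and s: "s < 1"
    and H: "neumann (b + c * (N * a) + a * (Nh * c)) H"
  shows "H = N + N * a * (Nh * c * H)" "H * (c * N) = Nh * c * H"
proof -
  note D = passageD[OF p] and Dh = passageD[OF ph] and HD = neumannD[OF H]
  note E = D(1-7) D(9-12) and Eh = Dh(1-7) Dh(9-12)
  define G Gh where GGh: "G = N * a" "Gh = Nh * c"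
  have GM: "G \<in> Mat" "Gh \<in> Mat" using E Eh by (auto simp: GGh)
  have 1: "N + G * (Gh * H) = H"
    unfolding GGh by (rule passage_resolvent[OF p _ HD(2,4)]) (use GM in \<open>simp add: GGh\<close>)
  have "b + a * (Nh * c) + c * (N * a) = b + c * (N * a) + a * (Nh * c)"
    using E Eh by (intro eq_MatI) auto
  hence 2: "Nh + Gh * (G * H) = H"
    unfolding GGh using HD(4) GM(1) by (intro passage_resolvent[OF ph _ HD(2)]) (simp_all only: GGh)
  define X where "X = H * (c * N) - Gh * H"
  have XM: "X \<in> Mat" using E GM HD by (simp add: X_def)
  have "Gh * (G * X) = X"
  proof (rule eq_MatI)
    fix i j assume ij: "i < m" "j < m"
    have "((Nh + Gh * (G * H)) * (c * N)) $$ (i, j) = (H * (c * N)) $$ (i, j)" by (simp add: 2)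
    moreover have "(Gh * (N + G * (Gh * H))) $$ (i, j) = (Gh * H) $$ (i, j)" by (simp add: 1)
    moreover have "Nh * (c * N) = Gh * N" using E Eh by (simp add: GGh mat_assoc)
    ultimately show "(Gh * (G * X)) $$ (i, j) = X $$ (i, j)"
      unfolding X_def using ij D(3,10) Dh(10) GM HD(2) by (simp add: mat_distrib)
  qed (use XM GM in auto)
  hence eq: "(One - Gh * G) * X = Zero" using XM GM by (intro eq_MatI) (simp_all add: mat_distrib)
  have "rows_le (s * s) (Gh * G)" using r by (auto simp: GGh intro: rows_le_mult)
  moreover have "s * s < 1" using s rows_le_nonneg[OF r(1)] mult_left_mono[of s 1 s] by simp
  ultimately have S: "neumann (Gh * G) (star (Gh * G))" by (rule neumann_star)
  have "X = star (Gh * G) * (One - Gh * G) * X" using XM by (simp add: neumann_inverse[OF S])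
  also have "\<dots> = star (Gh * G) * Zero"
    using XM GM neumannD[OF S] eq by (simp add: mat_assoc)
  also have "\<dots> = Zero" using neumannD(2)[OF S] by simp
  finally have X0: "X = Zero" .
  have "H * (c * N) = Gh * H"
  proof (rule eq_MatI)
    fix i j assume ij: "i < m" "j < m"
    have "X $$ (i, j) = 0" using X0 ij by simp
    thus "(H * (c * N)) $$ (i, j) = (Gh * H) $$ (i, j)" using ij GM HD E by (simp add: X_def)
  qed (use GM HD D in auto)
  thus "H * (c * N) = Nh * c * H" by (simp add: GGh)
  show "H = N + N * a * (Nh * c * H)" using 1 by (simp add: GGh)
qed

text \<open>Apply the hypothesis to the largest entry.\<close>

lemma entries_le_of_half:
  assumes X: "X \<in> Mat" "Zero \<le> X"
    and half: "\<And>h i j. 0 \<le> h \<Longrightarrow> (\<And>i j. i < m \<Longrightarrow> j < m \<Longrightarrow> X $$ (i, j) \<le> h) \<Longrightarrow>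
       i < m \<Longrightarrow> j < m \<Longrightarrow> X $$ (i, j) \<le> c + h / 2"
    and ij: "i < m" "j < m"
  shows "X $$ (i, j) \<le> 2 * c"
proof -
  define A where "A = (\<lambda>(i, j). X $$ (i, j)) ` ({..<m} \<times> {..<m})"
  have A: "finite A" "A \<noteq> {}" using m_pos by (auto simp: A_def)
  define h where "h = Max A"
  have le: "X $$ (i, j) \<le> h" if "i < m" "j < m" for i j
    unfolding h_def using A that by (intro Max_ge) (auto simp: A_def)
  have "h \<in> A" unfolding h_def using A by (rule Max_in)
  then obtain i0 j0 where h: "i0 < m" "j0 < m" "h = X $$ (i0, j0)" by (auto simp: A_def)
  have "0 \<le> h" using h X by (auto intro: nonneg_matD)
  from half[OF this le h(1,2)] have "h \<le> 2 * c" using h(3) by simp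
  thus ?thesis using le[OF ij] by linarith
qed

primrec green_sum :: "real mat \<Rightarrow> real mat \<Rightarrow> real mat \<Rightarrow> nat \<Rightarrow> real mat" where
  "green_sum G N R 0 = Zero"
| "green_sum G N R (Suc k) = green_sum G N R k + G ^\<^sub>m k * N * R ^\<^sub>m k"

lemma green_sum_closed [simp]:
  "G \<in> Mat \<Longrightarrow> N \<in> Mat \<Longrightarrow> R \<in> Mat \<Longrightarrow> green_sum G N R k \<in> Mat"
  by (induction k) auto

lemma green_sum_entry:
  assumes "G \<in> Mat" "N \<in> Mat" "R \<in> Mat" "i < m" "j < m"
  shows "green_sum G N R k $$ (i, j) = (\<Sum>l<k. (G ^\<^sub>m l * N * R ^\<^sub>m l) $$ (i, j))"
  using assms by (induction k) auto

lemma green_sum_mono: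
  assumes "G \<in> Mat" "N \<in> Mat" "R \<in> Mat" "G' \<in> Mat" "N' \<in> Mat" "R' \<in> Mat"
    "Zero \<le> G" "Zero \<le> N" "Zero \<le> R" "G \<le> G'" "N \<le> N'" "R \<le> R'"
  shows "green_sum G N R k \<le> green_sum G' N' R' k"
  using assms
  by (induction k) (auto intro!: add_mono_mat mult_mono_mat mult_nonneg_mat pow_mono_mat pow_nonneg_mat)

lemma green_sum_nonneg_terms:
  assumes "G \<in> Mat" "N \<in> Mat" "R \<in> Mat" "Zero \<le> G" "Zero \<le> N" "Zero \<le> R"
  shows "Zero \<le> G ^\<^sub>m k * N * R ^\<^sub>m k"
  using assms by (auto intro!: mult_nonneg_mat pow_nonneg_mat)

lemma green_sum_remainder:
  assumes M: "G \<in> Mat" "N \<in> Mat" "R \<in> Mat" "H \<in> Mat" and H: "H = N + G * (H * R)"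
  shows "H = green_sum G N R k + G ^\<^sub>m k * H * R ^\<^sub>m k"
proof (induction k)
  case 0
  show ?case using M by simp
next
  case (Suc k)
  have "G ^\<^sub>m k * H * R ^\<^sub>m k = G ^\<^sub>m k * (N + G * (H * R)) * R ^\<^sub>m k"
    using H by simp
  also have "\<dots> = G ^\<^sub>m k * N * R ^\<^sub>m k + (G ^\<^sub>m k * G) * H * (R * R ^\<^sub>m k)"
    using M by (simp add: mat_distrib)
  also have "\<dots> = G ^\<^sub>m k * N * R ^\<^sub>m k + G ^\<^sub>m Suc k * H * R ^\<^sub>m Suc k"
    using pow_mat_Suc_left[OF M(3)] by simp
  finally show ?case using Suc M by simp
qed

lemma intertwine_pow:
  assumes M: "Gh \<in> Mat" "R \<in> Mat" "H \<in> Mat" and HR: "H * R = Gh * H"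
  shows "H * R ^\<^sub>m k = Gh ^\<^sub>m k * H"
proof (induction k)
  case 0
  show ?case using M by simp
next
  case (Suc k)
  have "H * R ^\<^sub>m Suc k = (H * R ^\<^sub>m k) * R" using M by (simp add: mat_assoc)
  also have "\<dots> = Gh ^\<^sub>m k * (H * R)" using Suc M by (simp add: mat_assoc)
  also have "\<dots> = Gh ^\<^sub>m Suc k * H" using HR M by (simp add: mat_assoc)
  finally show ?case .
qed

text \<open>The limit of the increasing \<open>Ns\<close> is an inverse of \<open>I - U\<close>, and there is only one.\<close>

lemma neumann_mconv:
  assumes UN: "\<And>n. neumann (Us n) (Ns n)" and U: "mconv Us U" "\<And>n. Us n \<le> U"
    and mono: "\<And>n. Ns n \<le> Ns (Suc n)" and N: "neumann U N"
  shows "mconv Ns N"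
proof -
  note D = neumannD[OF UN] and ND = neumannD[OF N]
  have le: "Ns n \<le> N" for n by (rule neumann_mono[OF UN N U(2)])
  obtain N' where N': "mconv Ns N'"
    using mono_le_mconv[of Ns N, OF D(2) mono ND(2) le] by blast
  have N'M: "N' \<in> Mat" using mconvD(2)[OF N'] .
  from mconv_add[OF mconv_const mconv_mult[OF U(1) N'], of One]
  have "mconv (\<lambda>n. One + Us n * Ns n) (One + U * N')" by simp
  hence "mconv Ns (One + U * N')" by (simp add: D(4))
  from mconv_unique[OF this N'] have e: "One + U * N' = N'" .
  have "(One - U) * N' = One"
  proof (rule eq_MatI)
    fix i j assume ij: "i < m" "j < m"
    have "(One + U * N') $$ (i, j) = N' $$ (i, j)" by (simp add: e)
    thus "((One - U) * N') $$ (i, j) = One $$ (i, j)"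
      using ij ND(1) N'M by (simp add: mat_distrib)
  qed (use ND(1) N'M in auto)
  hence "N * ((One - U) * N') = N" using ND(2) by simp
  also have "N * ((One - U) * N') = N * (One - U) * N'"
    using ND(1,2) N'M by (intro mat_assoc[symmetric]) auto
  finally have "N' = N" using N'M by (simp add: neumann_inverse[OF N])
  thus ?thesis using N' by simp
qed

text \<open>For the killed walk these identities hold by construction; the first one is passed to the limit, the
  second one restates the equation of \<open>G\<close>.\<close>

lemma rate_matrix_eq:
  assumes abc: "a \<in> Mat" "b \<in> Mat" "c \<in> Mat" "Zero \<le> a" "Zero \<le> b" "Zero \<le> c"
    and rows: "rows_le 1 (a + b + c)"
    and G: "first_passage_matrix a b c G" and R: "rate_matrix a b c R"
    and N: "neumann (b + c * G) N"
  shows "R = c * N" "N * a = G"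
proof -
  note ND = neumannD[OF N]
  have GD: "G \<in> Mat" "a + b * G + c * G * G = G"
    using G by (auto simp: first_passage_matrix_def)
  show "R = c * N"
  proof (rule passage_limit[OF abc rows G], goal_cases)
    case (1 Us Ns)
    note PD = passageD[OF 1(1)]
    have "mconv (\<lambda>n. shrink n \<cdot>\<^sub>m b + (shrink n \<cdot>\<^sub>m c) * (Ns n * (shrink n \<cdot>\<^sub>m a))) (b + c * G)"
      using abc by (intro mconv_add mconv_mult shrink_mconv 1(5)) auto
    hence "mconv Us (b + c * G)" by (simp flip: PD(8))
    from neumann_mconv[OF PD(7) this 1(6,7) N] have "mconv Ns N" .
    hence "mconv (\<lambda>n. (shrink n \<cdot>\<^sub>m c) * Ns n) (c * N)"
      using abc by (intro mconv_mult shrink_mconv) auto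
    thus ?case by (rule mconv_unique[OF 1(9)[OF R]])
  qed
  have "a = (One - (b + c * G)) * G"
  proof (rule eq_MatI)
    fix i j assume ij: "i < m" "j < m"
    have "(a + b * G + c * G * G) $$ (i, j) = G $$ (i, j)" by (simp add: GD(2))
    thus "a $$ (i, j) = ((One - (b + c * G)) * G) $$ (i, j)"
      using ij abc GD(1) by (simp add: mat_distrib)
  qed (use abc GD(1) in auto)
  hence "N * a = N * (One - (b + c * G)) * G"
    using mat_assoc[of N "One - (b + c * G)" G] ND(1,2) GD(1) by simp
  thus "N * a = G" using GD(1) by (simp add: neumann_inverse[OF N])
qed

text \<open>The disjunction bounds the Green matrices \<open>Hs n\<close> of the killed walks uniformly in \<open>n\<close>: their remainder
  term after \<open>k\<close> steps is at most half of their largest entry. Hence they converge, and the identities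
  of \<open>strict_green\<close> pass to the limit \<open>H\<close>. The value of the series is found by exchanging two suprema:
  each \<open>Hs n\<close> is the sum of its own series, which is at most the sum for the limiting matrices,
  which in turn is at most \<open>H\<close>.\<close>

lemma green_limit:
  assumes abc: "a \<in> Mat" "b \<in> Mat" "c \<in> Mat" "Zero \<le> a" "Zero \<le> b" "Zero \<le> c"
    and rows: "rows_le 1 (a + b + c)"
    and G: "first_passage_matrix a b c G" and Gh: "first_passage_matrix c b a Gh"
    and R: "rate_matrix a b c R" and N: "neumann (b + c * G) N"
    and contr: "rows_le (1/2) (G ^\<^sub>m k) \<or> (\<forall>i<m. \<forall>j<m. (R ^\<^sub>m k) $$ (i, j) \<le> 1 / (2 * m))"
  obtains H where "H \<in> Mat" "H * R = Gh * H" "H = N + G * (H * R)"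
    "\<And>i j. i < m \<Longrightarrow> j < m \<Longrightarrow> (\<lambda>l. (G ^\<^sub>m l * N * R ^\<^sub>m l) $$ (i, j)) sums H $$ (i, j)"
proof -
  have eq: "c + b + a = a + b + c" using abc by (intro eq_MatI) auto
  have rows': "rows_le 1 (c + b + a)" using rows by (simp only: eq)
  obtain Us Ns where p:
    "\<And>n. passage (shrink n \<cdot>\<^sub>m a) (shrink n \<cdot>\<^sub>m b) (shrink n \<cdot>\<^sub>m c) (Us n) (Ns n)"
    "\<And>n. rows_le (shrink n) (Ns n * (shrink n \<cdot>\<^sub>m a))"
    "\<And>n. Ns n * (shrink n \<cdot>\<^sub>m a) \<le> Ns (Suc n) * (shrink (Suc n) \<cdot>\<^sub>m a)"
    "\<And>n. Ns n * (shrink n \<cdot>\<^sub>m a) \<le> G"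
    "mconv (\<lambda>n. Ns n * (shrink n \<cdot>\<^sub>m a)) G"
    "\<And>n. Us n \<le> b + c * G"
    "\<And>n. Ns n \<le> Ns (Suc n)"
    "\<And>R n. rate_matrix a b c R \<Longrightarrow> (shrink n \<cdot>\<^sub>m c) * Ns n \<le> R"
    "\<And>R. rate_matrix a b c R \<Longrightarrow> mconv (\<lambda>n. (shrink n \<cdot>\<^sub>m c) * Ns n) R"
  proof (rule passage_limit[OF abc rows G], goal_cases)
    case (1 U N)
    show ?case by (rule that[of U N]) (fact 1)+
  qed
  obtain Uh Nh where ph:
    "\<And>n. passage (shrink n \<cdot>\<^sub>m c) (shrink n \<cdot>\<^sub>m b) (shrink n \<cdot>\<^sub>m a) (Uh n) (Nh n)"
    "\<And>n. rows_le (shrink n) (Nh n * (shrink n \<cdot>\<^sub>m c))"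
    "\<And>n. Nh n * (shrink n \<cdot>\<^sub>m c) \<le> Nh (Suc n) * (shrink (Suc n) \<cdot>\<^sub>m c)"
    "mconv (\<lambda>n. Nh n * (shrink n \<cdot>\<^sub>m c)) Gh"
  proof (rule passage_limit[OF abc(3,2,1,6,5,4) rows' Gh], goal_cases)
    case (1 U N)
    show ?case by (rule that[of U N]) (fact 1)+
  qed
  define a' b' c' where defs: "a' n = shrink n \<cdot>\<^sub>m a" "b' n = shrink n \<cdot>\<^sub>m b" "c' n = shrink n \<cdot>\<^sub>m c" for n
  define Gs where "Gs n = Ns n * a' n" for n
  define Ghs where "Ghs n = Nh n * c' n" for n
  define Rs where "Rs n = c' n * Ns n" for n
  have abc': "a' n \<in> Mat" "b' n \<in> Mat" "c' n \<in> Mat" "Zero \<le> a' n" "Zero \<le> b' n" "Zero \<le> c' n"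
    "a' n \<le> a' (Suc n)" "b' n \<le> b' (Suc n)" "c' n \<le> c' (Suc n)" for n
    using abc by (auto simp: defs intro: shrink_nonneg shrink_le shrink_Suc)
  have P: "passage (a' n) (b' n) (c' n) (Us n) (Ns n)"
    and Ph: "passage (c' n) (b' n) (a' n) (Uh n) (Nh n)" for n
    using p(1) ph(1) by (simp_all add: defs)
  have Gr: "rows_le (shrink n) (Gs n)" and Ghr: "rows_le (shrink n) (Ghs n)" for n
    using p(2) ph(2) by (simp_all add: defs Gs_def Ghs_def)
  have Gmono: "Gs n \<le> Gs (Suc n)" and Ghmono: "Ghs n \<le> Ghs (Suc n)"
    and Gle: "Gs n \<le> G" and Rle: "Rs n \<le> R" for n
    using p(3,4,8) ph(3) R by (simp_all add: defs Gs_def Ghs_def Rs_def)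
  have Gconv: "mconv Gs G" and Ghconv: "mconv Ghs Gh" and Rconv: "mconv Rs R"
    using p(5,9) ph(4) R by (simp_all add: defs Gs_def[abs_def] Ghs_def[abs_def] Rs_def[abs_def])
  have M: "G \<in> Mat" "Gh \<in> Mat" "R \<in> Mat" "Zero \<le> G" "Zero \<le> R"
    using G Gh R by (auto simp: first_passage_matrix_def rate_matrix_def)
  note PD = passageD[OF P]
  note ND = neumannD[OF N]
  have Nle: "Ns n \<le> N" for n using neumann_mono[OF PD(7) N p(6)] .
  have Ms: "Gs n \<in> Mat" "Ghs n \<in> Mat" "Rs n \<in> Mat" "Ns n \<in> Mat"
    "Zero \<le> Gs n" "Zero \<le> Ghs n" "Zero \<le> Rs n" "Zero \<le> Ns n" for n
    using rows_leD[OF Gr] rows_leD[OF Ghr] PD(10,11) abc'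
    by (auto simp: Rs_def intro!: mult_nonneg_mat)

  define Q where "Q n = b' n + c' n * Gs n + a' n * Ghs n" for n
  have QM: "Q n \<in> Mat" "Zero \<le> Q n" for n
    using abc' Ms by (auto simp: Q_def intro!: add_nonneg_mat mult_nonneg_mat)
  have ones: "X * all_ones \<le> all_ones" if "rows_le (shrink n) X" for X n
  proof (rule le_matI)
    fix i j assume ij: "i < m" "j < m"
    have "rows_le 1 X" using that shrink_bounds(2)[of n] by (auto intro: rows_le_mono)
    thus "(X * all_ones) $$ (i, j) \<le> all_ones $$ (i, j)"
      using ij by (auto simp: mult_all_ones_entry rows_leD)
  qed (use that in \<open>auto dest: rows_leD\<close>)
  have Qr: "rows_le (shrink n) (Q n)" for n
    unfolding rows_le_iff
  proof (intro conjI QM)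
    have "Q n * all_ones = b' n * all_ones + c' n * (Gs n * all_ones) + a' n * (Ghs n * all_ones)"
      using abc' Ms by (simp add: Q_def mat_distrib)
    also have "\<dots> \<le> b' n * all_ones + c' n * all_ones + a' n * all_ones"
      using abc' Ms ones[OF Gr] ones[OF Ghr]
      by (intro add_mono_mat mult_left_mono_mat) auto
    also have "\<dots> = (a' n + b' n + c' n) * all_ones"
      using abc' by (intro eq_MatI) (simp_all add: mat_distrib)
    also have "\<dots> \<le> shrink n \<cdot>\<^sub>m all_ones"
      using shrink_rows[OF abc rows, of n] by (simp add: rows_le_iff defs)
    finally show "Q n * all_ones \<le> shrink n \<cdot>\<^sub>m all_ones" .
  qed
  define Hs where "Hs n = star (Q n)" for n
  have H: "neumann (Q n) (Hs n)" for n
    unfolding Hs_def by (rule neumann_star[OF Qr shrink_bounds(2)])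
  note HD = neumannD[OF H]
  have Hmono: "Hs n \<le> Hs (Suc n)" for n
    by (rule neumann_mono[OF H H]) (unfold Q_def, intro add_mono_mat mult_mono_mat;
      use abc' Ms Gmono Ghmono in auto)
  have Heq: "Hs n = Ns n + Gs n * (Ghs n * Hs n)" and HR: "Hs n * Rs n = Ghs n * Hs n" for n
    using strict_green[OF P Ph Gr[unfolded Gs_def] Ghr[unfolded Ghs_def] shrink_bounds(2)] H[of n]
    by (simp_all add: Q_def Gs_def Ghs_def Rs_def)
  have rem: "Hs n = green_sum (Gs n) (Ns n) (Rs n) l + Gs n ^\<^sub>m l * Ghs n ^\<^sub>m l * Hs n" for n l
  proof -
    have "Hs n = green_sum (Gs n) (Ns n) (Rs n) l + Gs n ^\<^sub>m l * Hs n * Rs n ^\<^sub>m l"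
      using Ms HD Heq[of n] HR[of n] by (intro green_sum_remainder) simp_all
    also have "Gs n ^\<^sub>m l * Hs n * Rs n ^\<^sub>m l = Gs n ^\<^sub>m l * (Hs n * Rs n ^\<^sub>m l)"
      using Ms HD(2) by (simp add: mat_assoc)
    also have "\<dots> = Gs n ^\<^sub>m l * Ghs n ^\<^sub>m l * Hs n"
      using Ms HD(2) intertwine_pow[OF Ms(2,3) HD(2) HR] by (simp add: mat_assoc)
    finally show ?thesis .
  qed
  have sum_le: "green_sum (Gs n) (Ns n) (Rs n) l \<le> green_sum G N R l" for n l
    using Ms M ND Gle Nle Rle by (intro green_sum_mono) auto

  note gsM = green_sum_closed[OF M(1) ND(2) M(3)]
  obtain e where e: "\<And>i j. i < m \<Longrightarrow> j < m \<Longrightarrow> green_sum G N R k $$ (i, j) \<le> e"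
    using entry_bound[OF green_sum_closed[OF M(1) ND(2) M(3)]] by metis
  have Gh1: "rows_le 1 (Ghs n ^\<^sub>m l)" for n l
    using rows_le_pow[OF rows_le_mono[OF Ghr, of _ 1]] shrink_bounds(2)[of n]
    by (metis less_imp_le power_one)
  have G1: "rows_le 1 (Gs n ^\<^sub>m l)" for n l
    using rows_le_pow[OF rows_le_mono[OF Gr, of _ 1]] shrink_bounds(2)[of n]
    by (metis less_imp_le power_one)
  (* The remainder has the two forms Gs^k Ghs^k Hs and Gs^k Hs Rs^k. The first one is small if G^k
     is, the second one if R^k is. *)
  have tail: "(Gs n ^\<^sub>m k * Ghs n ^\<^sub>m k * Hs n) $$ (i, j) \<le> h / 2"
    if h: "0 \<le> h" "\<And>i j. i < m \<Longrightarrow> j < m \<Longrightarrow> Hs n $$ (i, j) \<le> h" and ij: "i < m" "j < m"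
    for n h i j
    using contr
  proof
    assume "rows_le (1/2) (G ^\<^sub>m k)"
    hence "rows_le (1/2) (Gs n ^\<^sub>m k)"
      by (rule rows_le_antimono) (use Ms M Gle in \<open>auto intro: pow_mono_mat pow_nonneg_mat\<close>)
    hence "rows_le (1/2 * 1) (Gs n ^\<^sub>m k * Ghs n ^\<^sub>m k)"
      using Gh1 by (rule rows_le_mult)
    hence "(Gs n ^\<^sub>m k * Ghs n ^\<^sub>m k * Hs n) $$ (i, j) \<le> 1/2 * 1 * h"
      using h ij HD(2) by (intro rows_le_mult_entry) auto
    thus ?thesis by simp
  next
    assume Rk: "\<forall>i<m. \<forall>j<m. (R ^\<^sub>m k) $$ (i, j) \<le> 1 / (2 * m)"
    have "(Hs n * Rs n ^\<^sub>m k) $$ (l, j) \<le> h / 2" if l: "l < m" for l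
    proof -
      have "(Hs n * Rs n ^\<^sub>m k) $$ (l, j) = (\<Sum>q<m. Hs n $$ (l, q) * (Rs n ^\<^sub>m k) $$ (q, j))"
        using l ij HD(2) Ms by (intro mult_entry) auto
      also have "\<dots> \<le> (\<Sum>q<m. h * (1 / (2 * m)))"
      proof (intro sum_mono mult_mono h)
        fix q assume "q \<in> {..<m}"
        hence q: "q < m" by simp
        have "Rs n ^\<^sub>m k \<le> R ^\<^sub>m k" using Ms M Rle by (intro pow_mono_mat) auto
        from le_matD[OF this _ q ij(2)] show "(Rs n ^\<^sub>m k) $$ (q, j) \<le> 1 / (2 * m)"
          using Rk q ij M by (auto intro: order_trans)
        show "0 \<le> (Rs n ^\<^sub>m k) $$ (q, j)"
          using q ij Ms by (intro nonneg_matD pow_nonneg_mat) auto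
      qed (use l in auto)
      also have "\<dots> = h / 2" using m_pos by simp
      finally show ?thesis .
    qed
    hence "(Gs n ^\<^sub>m k * (Hs n * Rs n ^\<^sub>m k)) $$ (i, j) \<le> 1 * (h / 2)"
      using ij h Ms HD(2) by (intro rows_le_mult_entry[OF G1]) auto
    also have "Gs n ^\<^sub>m k * (Hs n * Rs n ^\<^sub>m k) = Gs n ^\<^sub>m k * Ghs n ^\<^sub>m k * Hs n"
      using Ms HD(2) intertwine_pow[OF Ms(2,3) HD(2) HR] by (simp add: mat_assoc)
    finally show ?thesis by simp
  qed
  have Hbound: "Hs n $$ (i, j) \<le> 2 * e" if "i < m" "j < m" for n i j
  proof (rule entries_le_of_half[OF HD(2,3) _ that])
    fix h i j assume h: "0 \<le> h" "\<And>i j. i < m \<Longrightarrow> j < m \<Longrightarrow> Hs n $$ (i, j) \<le> h" and ij: "i < m" "j < m"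
    have "Hs n $$ (i, j) = (green_sum (Gs n) (Ns n) (Rs n) k + Gs n ^\<^sub>m k * Ghs n ^\<^sub>m k * Hs n) $$ (i, j)"
      by (rule arg_cong[OF rem])
    also have "\<dots> = green_sum (Gs n) (Ns n) (Rs n) k $$ (i, j) + (Gs n ^\<^sub>m k * Ghs n ^\<^sub>m k * Hs n) $$ (i, j)"
      using ij Ms HD(2) by simp
    also have "\<dots> \<le> e + h / 2"
      using tail[OF h ij] order_trans[OF le_matD[OF sum_le gsM ij] e[OF ij]]
      by (intro add_mono) auto
    finally show "Hs n $$ (i, j) \<le> e + h / 2" .
  qed
  obtain H where Hc: "mconv Hs H"
    using mono_bounded_mconv[of Hs "2 * e"] HD(2) Hmono Hbound by metis
  have HM: "H \<in> Mat" using mconvD(2)[OF Hc] .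
  have H0: "Zero \<le> H" using HD(3) by (intro mconv_lower[OF Hc]) auto

  have "Us = (\<lambda>n. b' n + c' n * Gs n)" using PD(8) by (auto simp: Gs_def)
  moreover have "mconv (\<lambda>n. b' n + c' n * Gs n) (b + c * G)"
    using abc unfolding defs by (intro mconv_add mconv_mult shrink_mconv Gconv) auto
  ultimately have "mconv Us (b + c * G)" by simp
  from neumann_mconv[OF PD(7) this p(6,7) N] have N': "mconv Ns N" .
  have "mconv (\<lambda>n. Hs n * Rs n) (H * R)" by (intro mconv_mult Hc Rconv)
  moreover have "mconv (\<lambda>n. Hs n * Rs n) (Gh * H)" unfolding HR by (intro mconv_mult Hc Ghconv)
  ultimately have HR': "H * R = Gh * H" by (rule mconv_unique)
  have "mconv (\<lambda>n. Ns n + Gs n * (Ghs n * Hs n)) (N + G * (Gh * H))"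
    by (intro mconv_add N' mconv_mult Gconv Ghconv Hc)
  hence "mconv Hs (N + G * (Gh * H))" by (simp flip: Heq)
  hence Heq': "H = N + G * (H * R)" unfolding HR' by (rule mconv_unique[OF Hc])

  have gs_mono: "green_sum G N R l \<le> green_sum G N R (Suc l)" for l
  proof -
    have "green_sum G N R l + Zero \<le> green_sum G N R l + G ^\<^sub>m l * N * R ^\<^sub>m l"
      using M ND by (intro add_mono_mat green_sum_nonneg_terms) auto
    thus ?thesis using M ND by simp
  qed
  have gs_le: "green_sum G N R l \<le> H" for l
  proof -
    have "green_sum G N R l + Zero \<le> green_sum G N R l + G ^\<^sub>m l * H * R ^\<^sub>m l"
      using M ND HM H0 by (intro add_mono_mat green_sum_nonneg_terms) auto
    also have "\<dots> = H" by (rule green_sum_remainder[OF M(1) ND(2) M(3) HM Heq', symmetric])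
    finally show ?thesis using M ND by simp
  qed
  obtain S where S: "mconv (green_sum G N R) S" "\<And>l. green_sum G N R l \<le> S" "S \<le> H"
    using mono_le_mconv[of "green_sum G N R" H, OF gsM gs_mono HM gs_le] by blast
  have SM: "S \<in> Mat" using mconvD(2)[OF S(1)] .
  have "Hs n \<le> S" for n
  proof (rule le_matI)
    fix i j assume ij: "i < m" "j < m"
    obtain h where h: "0 \<le> h" "\<And>i j. i < m \<Longrightarrow> j < m \<Longrightarrow> Hs n $$ (i, j) \<le> h"
      using entry_bound[OF HD(2)[of n]] by metis
    have le: "Hs n $$ (i, j) \<le> S $$ (i, j) + shrink n ^ l * h" for l
    proof -
      have "rows_le (shrink n ^ l * 1) (Gs n ^\<^sub>m l * Ghs n ^\<^sub>m l)"
        by (rule rows_le_mult[OF rows_le_pow[OF Gr] Gh1])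
      hence t: "(Gs n ^\<^sub>m l * Ghs n ^\<^sub>m l * Hs n) $$ (i, j) \<le> shrink n ^ l * 1 * h"
        using ij h HD(2) by (intro rows_le_mult_entry) auto
      have "Hs n $$ (i, j) = (green_sum (Gs n) (Ns n) (Rs n) l + Gs n ^\<^sub>m l * Ghs n ^\<^sub>m l * Hs n) $$ (i, j)"
        by (rule arg_cong[OF rem])
      also have "\<dots> = green_sum (Gs n) (Ns n) (Rs n) l $$ (i, j) + (Gs n ^\<^sub>m l * Ghs n ^\<^sub>m l * Hs n) $$ (i, j)"
        using ij Ms HD(2) by simp
      also have "\<dots> \<le> S $$ (i, j) + shrink n ^ l * h"
        using t le_matD[OF order_trans[OF sum_le S(2)] SM ij, of n l] by linarith
      finally show ?thesis .
    qed
    have "(\<lambda>l. S $$ (i, j) + shrink n ^ l * h) \<longlonglongrightarrow> S $$ (i, j) + 0 * h"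
      using shrink_bounds[of n] by (intro tendsto_intros LIMSEQ_power_zero) auto
    thus "Hs n $$ (i, j) \<le> S $$ (i, j)"
      using le by (intro LIMSEQ_le_const[where X = "\<lambda>l. S $$ (i, j) + shrink n ^ l * h"]) auto
  qed (use HD SM in auto)
  hence "H \<le> S" using SM by (intro mconv_upper[OF Hc]) auto
  with S(3) have SH: "S = H" by simp
  have "(\<lambda>l. (G ^\<^sub>m l * N * R ^\<^sub>m l) $$ (i, j)) sums H $$ (i, j)" if "i < m" "j < m" for i j
    unfolding sums_def using mconvD(3)[OF S(1) that] that M ND(2)
    by (simp add: green_sum_entry SH)
  thus ?thesis using that[of H] HM HR' Heq' by blast
qed

end

section \<open>Hitting probabilities and expected hitting times\<close>

lemma irreducible_closed_set:
  assumes irr: "irreducible_kernel S P" and x: "x \<in> S" "x \<in> Z" and y: "y \<in> S"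
    and closed: "\<And>u v. u \<in> S \<Longrightarrow> v \<in> S \<Longrightarrow> u \<in> Z \<Longrightarrow> 0 < P u v \<Longrightarrow> v \<in> Z"
  shows "y \<in> Z"
proof -
  have "(x, y) \<in> (step_rel S P)\<^sup>*" using irr x y by (auto simp: irreducible_kernel_def)
  thus ?thesis
    by (induction rule: rtrancl_induct) (use x closed in \<open>auto simp: step_rel_def\<close>)
qed

text \<open>The next state is confined to a finite set \<open>T x\<close>, which turns the sums over the state space into
  finite sums.\<close>

locale finite_support_chain =
  fixes S :: "'s set" and P :: "'s \<Rightarrow> 's \<Rightarrow> real" and T :: "'s \<Rightarrow> 's set"
  assumes T: "x \<in> S \<Longrightarrow> finite (T x)" "x \<in> S \<Longrightarrow> T x \<subseteq> S"
    and P_support: "x \<in> S \<Longrightarrow> y \<in> S - T x \<Longrightarrow> P x y = 0"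
    and P_nonneg: "x \<in> S \<Longrightarrow> y \<in> S \<Longrightarrow> 0 \<le> P x y"
    and P_sum: "x \<in> S \<Longrightarrow> (\<Sum>y\<in>T x. P x y) = 1"
    and irr: "irreducible_kernel S P"
begin

context
  fixes j assumes j: "j \<in> S"
begin

abbreviation passage_prob :: "nat \<Rightarrow> 's \<Rightarrow> real" where
  "passage_prob n x \<equiv> first_passage S P n x j"

lemma passage_prob_Suc:
  assumes x: "x \<in> S"
  shows "passage_prob (Suc (Suc n)) x = (\<Sum>y\<in>T x - {j}. P x y * passage_prob (Suc n) y)"
proof -
  have "passage_prob (Suc (Suc n)) x = (\<Sum>\<^sub>\<infinity>y\<in>S - {j}. P x y * passage_prob (Suc n) y)" by simp
  also have "\<dots> = (\<Sum>\<^sub>\<infinity>y\<in>T x - {j}. P x y * passage_prob (Suc n) y)"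
    using P_support[OF x] T(2)[OF x] by (intro infsum_cong_neutral) auto
  finally show ?thesis using T(1)[OF x] by simp
qed

lemma passage_prob_nonneg: "x \<in> S \<Longrightarrow> 0 \<le> passage_prob n x"
proof (induction n arbitrary: x)
  case (Suc n)
  note IH = Suc.IH and x = Suc.prems
  show ?case
  proof (cases n)
    case 0
    thus ?thesis using P_nonneg x j by simp
  next
    case (Suc k)
    have "0 \<le> (\<Sum>y\<in>T x - {j}. P x y * passage_prob (Suc k) y)"
      using Suc IH x T(2)[OF x] P_nonneg[OF x]
      by (intro sum_nonneg mult_nonneg_nonneg) auto
    thus ?thesis unfolding Suc using passage_prob_Suc[OF x] by simp
  qed
qed auto

lemma sum_split:
  assumes x: "x \<in> S"
  shows "(\<Sum>y\<in>T x. P x y * h y) = P x j * h j + (\<Sum>y\<in>T x - {j}. P x y * h y)"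
proof (cases "j \<in> T x")
  case True
  thus ?thesis using T(1)[OF x] by (simp add: sum.remove)
next
  case False
  hence "P x j = 0" using P_support[OF x] j by auto
  thus ?thesis using False by simp
qed

lemma partial_hit_Suc:
  assumes x: "x \<in> S"
  shows "(\<Sum>n<Suc (Suc k). passage_prob n x) =
    P x j + (\<Sum>y\<in>T x - {j}. P x y * (\<Sum>n<Suc k. passage_prob n y))"
proof -
  have "(\<Sum>n<Suc (Suc k). passage_prob n x) = P x j + (\<Sum>n<k. passage_prob (Suc (Suc n)) x)"
    by (simp add: sum.lessThan_Suc_shift del: sum.lessThan_Suc first_passage.simps(3))
  also have "(\<Sum>n<k. passage_prob (Suc (Suc n)) x) =
      (\<Sum>n<k. \<Sum>y\<in>T x - {j}. P x y * passage_prob (Suc n) y)"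
    by (simp only: passage_prob_Suc[OF x])
  also have "\<dots> = (\<Sum>y\<in>T x - {j}. P x y * (\<Sum>n<k. passage_prob (Suc n) y))"
    by (subst sum.swap) (simp add: sum_distrib_left)
  also have "(\<lambda>y. \<Sum>n<k. passage_prob (Suc n) y) = (\<lambda>y. \<Sum>n<Suc k. passage_prob n y)"
    by (rule ext) (simp add: sum.lessThan_Suc_shift del: sum.lessThan_Suc)
  finally show ?thesis .
qed

lemma partial_hit_le: "x \<in> S \<Longrightarrow> (\<Sum>n<k. passage_prob n x) \<le> 1"
proof (induction k arbitrary: x)
  case (Suc k)
  note IH = Suc.IH and x = Suc.prems
  show ?case
  proof (cases k)
    case (Suc l)
    have "(\<Sum>n<Suc (Suc l). passage_prob n x)
        \<le> P x j + (\<Sum>y\<in>T x - {j}. P x y * 1)"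
      unfolding partial_hit_Suc[OF x]
      using Suc IH x T(2)[OF x] P_nonneg[OF x]
      by (intro add_left_mono sum_mono mult_left_mono) auto
    also have "\<dots> = 1"
      using sum_split[OF x, of "\<lambda>_. 1"] P_sum[OF x] by simp
    finally show ?thesis using Suc by simp
  qed simp
qed auto

lemma passage_summable: "x \<in> S \<Longrightarrow> summable (\<lambda>n. passage_prob n x)"
proof -
  assume x: "x \<in> S"
  have "(\<Sum>n\<le>k. passage_prob n x) \<le> 1" for k
    using partial_hit_le[OF x, of "Suc k"] by (simp only: lessThan_Suc_atMost)
  thus ?thesis using passage_prob_nonneg[OF x] by (intro bounded_imp_summable[of _ 1]) auto
qed

definition hit :: "'s \<Rightarrow> real" where "hit x = (\<Sum>n. passage_prob n x)"

lemma hit_sums: "x \<in> S \<Longrightarrow> (\<lambda>n. passage_prob n x) sums hit x"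
  using passage_summable by (simp add: hit_def summable_sums)

lemma hit_bounds: "x \<in> S \<Longrightarrow> 0 \<le> hit x" "x \<in> S \<Longrightarrow> hit x \<le> 1"
  using passage_summable passage_prob_nonneg partial_hit_le
  by (auto simp: hit_def intro!: suminf_nonneg suminf_le_const)

lemma hit_eq:
  assumes x: "x \<in> S"
  shows "hit x = P x j + (\<Sum>y\<in>T x - {j}. P x y * hit y)"
proof -
  have F: "(\<lambda>k. \<Sum>n<k. passage_prob n y) \<longlonglongrightarrow> hit y" if "y \<in> S" for y
    using hit_sums[OF that] by (simp add: sums_def)
  have "(\<lambda>k. P x j + (\<Sum>y\<in>T x - {j}. P x y * (\<Sum>n<Suc k. passage_prob n y)))
      \<longlonglongrightarrow> P x j + (\<Sum>y\<in>T x - {j}. P x y * hit y)"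
    using T(2)[OF x] by (intro tendsto_intros LIMSEQ_Suc F) auto
  moreover have "(\<lambda>k. \<Sum>n<Suc (Suc k). passage_prob n x) \<longlonglongrightarrow> hit x"
    using LIMSEQ_Suc[OF LIMSEQ_Suc[OF F[OF x]]] .
  ultimately show ?thesis unfolding partial_hit_Suc[OF x] by (rule LIMSEQ_unique[rotated])
qed

text \<open>The probability of visiting \<open>j\<close> at some time including time 0, whereas \<open>hit\<close> disregards time 0.
  It is this function that is superharmonic.\<close>

definition hit_or_at :: "'s \<Rightarrow> real" where "hit_or_at x = (if x = j then 1 else hit x)"

lemma hit_harmonic:
  assumes x: "x \<in> S"
  shows "(\<Sum>y\<in>T x. P x y * hit_or_at y) = hit x"
  unfolding sum_split[OF x] hit_eq[OF x] by (auto simp: hit_or_at_def)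

lemma hit_or_at_bounds: "x \<in> S \<Longrightarrow> 0 \<le> hit_or_at x" "x \<in> S \<Longrightarrow> hit_or_at x \<le> 1"
  "x \<in> S \<Longrightarrow> hit x \<le> hit_or_at x"
  using hit_bounds by (auto simp: hit_or_at_def)

text \<open>Minimum principle. If the minimum is below 1, it is not attained at \<open>j\<close>, so at every state where it
  is attained the function is harmonic and the minimum is attained at all successors as well. By
  irreducibility it is then attained at \<open>j\<close>.\<close>

lemma recurrent_of_minimum:
  assumes x0: "x0 \<in> S" and min: "\<And>x. x \<in> S \<Longrightarrow> hit_or_at x0 \<le> hit_or_at x"
  shows "recurrent_state S P j"
proof -
  let ?d = "hit_or_at x0"
  have "?d = 1"
  proof (rule ccontr)
    assume "?d \<noteq> 1"
    hence lt: "?d < 1" using hit_or_at_bounds(2)[OF x0] by simp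
    have "j \<in> {x. hit_or_at x = ?d}"
    proof (rule irreducible_closed_set[OF irr x0 _ j])
      fix u v assume uv: "u \<in> S" "v \<in> S" "u \<in> {x. hit_or_at x = ?d}" "0 < P u v"
      have "u \<noteq> j" using uv lt by (auto simp: hit_or_at_def)
      hence "hit u = ?d" using uv by (auto simp: hit_or_at_def)
      hence eq: "(\<Sum>y\<in>T u. P u y * (hit_or_at y - ?d)) = 0"
        using hit_harmonic[OF uv(1)] P_sum[OF uv(1)]
        by (simp add: right_diff_distrib sum_subtractf flip: sum_distrib_right)
      have v: "v \<in> T u" using P_support[OF uv(1)] uv by force
      have nn: "y \<in> T u \<Longrightarrow> 0 \<le> P u y * (hit_or_at y - ?d)" for y
        using T(2)[OF uv(1)] P_nonneg[OF uv(1)] min by auto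
      have "P u v * (hit_or_at v - ?d) = 0"
        using sum_nonneg_eq_0_iff[OF T(1)[OF uv(1)] nn] eq v by auto
      thus "v \<in> {x. hit_or_at x = ?d}" using uv by simp
    qed simp
    thus False using lt by (simp add: hit_or_at_def)
  qed
  hence "(\<Sum>y\<in>T j. P j y * 1) \<le> (\<Sum>y\<in>T j. P j y * hit_or_at y)"
    using T(2)[OF j] P_nonneg[OF j] min by (intro sum_mono mult_left_mono) auto
  hence "hit j = 1" using hit_bounds(2)[OF j] unfolding hit_harmonic[OF j] by (simp add: P_sum j)
  thus ?thesis using hit_sums[OF j] by (simp add: recurrent_state_def)
qed

text \<open>The function is the expected time \<open>\<tau>\<close> to reach \<open>j\<close>, with value 0 at \<open>j\<close>. Conditioning on the first
  step, finiteness of the expectation passes from a state to its successors, and so does the property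
  of reaching \<open>j\<close> almost surely; irreducibility extends both from \<open>j\<close> to all states.\<close>

lemma expected_time:
  assumes rec: "recurrent_state S P j" and fin: "summable (\<lambda>n. real n * passage_prob n j)"
  obtains \<tau> where "\<And>x. x \<in> S \<Longrightarrow> 0 \<le> \<tau> x"
    "\<And>x. x \<in> S \<Longrightarrow> x \<noteq> j \<Longrightarrow> \<tau> x = 1 + (\<Sum>y\<in>T x. P x y * \<tau> y)"
proof -
  have rel: "(real (Suc (Suc n))) * passage_prob (Suc (Suc n)) x =
      (\<Sum>y\<in>T x - {j}. P x y * (real (Suc n) * passage_prob (Suc n) y)) + passage_prob (Suc (Suc n)) x"
    if "x \<in> S" for n x
  proof -
    have "(\<Sum>y\<in>T x - {j}. P x y * (real (Suc n) * passage_prob (Suc n) y))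
      = real (Suc n) * passage_prob (Suc (Suc n)) x"
      unfolding passage_prob_Suc[OF that] sum_distrib_left by (simp only: mult_ac)
    thus ?thesis by (simp only: of_nat_Suc[of "Suc n"] distrib_right mult_1 add.commute)
  qed
  have sum_all: "summable (\<lambda>n. real n * passage_prob n x)" if x: "x \<in> S" for x
  proof -
    let ?Z = "{x. summable (\<lambda>n. real n * passage_prob n x)}"
    have "x \<in> ?Z"
    proof (rule irreducible_closed_set[OF irr j _ x])
      fix u v assume uv: "u \<in> S" "v \<in> S" "u \<in> ?Z" "0 < P u v"
      have "summable (\<lambda>n. real n * passage_prob n v)" if vj: "v \<noteq> j"
      proof -
        have v: "v \<in> T u - {j}" using P_support[OF uv(1)] uv vj by force
        have "summable (\<lambda>n. real (Suc (Suc n)) * passage_prob (Suc (Suc n)) u)"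
          using uv(3) summable_Suc_iff[of "\<lambda>n. real n * passage_prob n u"]
            summable_Suc_iff[of "\<lambda>n. real (Suc n) * passage_prob (Suc n) u"]
          by (simp only: mem_Collect_eq)
        hence "summable (\<lambda>n. P u v * (real (Suc n) * passage_prob (Suc n) v))"
        proof (rule summable_comparison_test'[where N = 0])
          fix n :: nat
          have nn: "0 \<le> P u y * (real (Suc n) * passage_prob (Suc n) y)" if "y \<in> T u - {j}" for y
            using that T(2)[OF uv(1)] P_nonneg passage_prob_nonneg uv(1)
            by (intro mult_nonneg_nonneg) auto
          have "P u v * (real (Suc n) * passage_prob (Suc n) v)
            \<le> (\<Sum>y\<in>T u - {j}. P u y * (real (Suc n) * passage_prob (Suc n) y))"
            using v nn T(1)[OF uv(1)] by (intro member_le_sum) auto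
          also have "\<dots> \<le> real (Suc (Suc n)) * passage_prob (Suc (Suc n)) u"
            unfolding rel[OF uv(1)] using passage_prob_nonneg[OF uv(1)] by (simp del: first_passage.simps)
          finally show "norm (P u v * (real (Suc n) * passage_prob (Suc n) v))
            \<le> real (Suc (Suc n)) * passage_prob (Suc (Suc n)) u"
            using nn[OF v] by (simp del: first_passage.simps of_nat_Suc)
        qed
        hence "summable (\<lambda>n. real (Suc n) * passage_prob (Suc n) v)"
          using uv(4) by (simp add: summable_cmult_iff del: first_passage.simps of_nat_Suc)
        thus ?thesis using summable_Suc_iff[of "\<lambda>n. real n * passage_prob n v"] by (simp only:)
      qed
      thus "v \<in> ?Z" using fin by (cases "v = j") auto
    qed (use fin in simp)
    thus ?thesis by simp
  qed
  have hit1: "hit x = 1" if x: "x \<in> S" for x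
  proof -
    have "x \<in> {x. hit x = 1}"
    proof (rule irreducible_closed_set[OF irr j _ x])
      show "j \<in> {x. hit x = 1}"
        using rec hit_sums[OF j] sums_unique2 by (auto simp: recurrent_state_def)
      fix u v assume uv: "u \<in> S" "v \<in> S" "u \<in> {x. hit x = 1}" "0 < P u v"
      have eq: "(\<Sum>y\<in>T u. P u y * (1 - hit_or_at y)) = 0"
        using hit_harmonic[OF uv(1)] P_sum[OF uv(1)] uv(3)
        by (simp add: right_diff_distrib sum_subtractf)
      have v: "v \<in> T u" using P_support[OF uv(1)] uv by force
      have nn: "y \<in> T u \<Longrightarrow> 0 \<le> P u y * (1 - hit_or_at y)" for y
        using T(2)[OF uv(1)] P_nonneg[OF uv(1)] hit_or_at_bounds by auto
      have "P u v * (1 - hit_or_at v) = 0"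
        using sum_nonneg_eq_0_iff[OF T(1)[OF uv(1)] nn] eq v by auto
      hence "hit_or_at v = 1" using uv by simp
      thus "v \<in> {x. hit x = 1}"
        using \<open>j \<in> {x. hit x = 1}\<close> by (cases "v = j") (auto simp: hit_or_at_def)
    qed
    thus ?thesis by simp
  qed
  define t where "t x = (\<Sum>n. real n * passage_prob n x)" for x
  define \<tau> where "\<tau> x = (if x = j then 0 else t x)" for x
  have t_sums: "(\<lambda>n. real (Suc n) * passage_prob (Suc n) x) sums t x" if "x \<in> S" for x
    using summable_sums[OF sum_all[OF that]] sums_Suc_iff[of "\<lambda>n. real n * passage_prob n x" "t x"]
    by (simp add: t_def del: first_passage.simps of_nat_Suc)
  have t0: "0 \<le> t x" if "x \<in> S" for x
    unfolding t_def using that sum_all passage_prob_nonneg by (intro suminf_nonneg) auto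
  have t_eq: "t x = 1 + (\<Sum>y\<in>T x - {j}. P x y * t y)" if x: "x \<in> S" for x
  proof -
    have e: "t x - P x j + real (Suc 0) * P x j = t x" by simp
    have "(\<lambda>n. real (Suc (Suc n)) * passage_prob (Suc (Suc n)) x) sums (t x - P x j)"
      using t_sums[OF x] sums_Suc_iff[of "\<lambda>n. real (Suc n) * passage_prob (Suc n) x" "t x - P x j"]
        e by (simp only: first_passage.simps(2))
    moreover have "(\<lambda>n. (\<Sum>y\<in>T x - {j}. P x y * (real (Suc n) * passage_prob (Suc n) y)) +
        passage_prob (Suc (Suc n)) x) sums ((\<Sum>y\<in>T x - {j}. P x y * t y) + (hit x - P x j))"
    proof (intro sums_add sums_sum sums_mult t_sums)
      fix y assume "y \<in> T x - {j}"
      thus "y \<in> S" using T(2)[OF x] by auto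
    next
      have "(\<lambda>n. passage_prob (Suc n) x) sums hit x"
        using hit_sums[OF x] sums_Suc_iff[of "\<lambda>n. passage_prob n x" "hit x"]
        by (simp del: first_passage.simps(2,3))
      thus "(\<lambda>n. passage_prob (Suc (Suc n)) x) sums (hit x - P x j)"
        using sums_Suc_iff[of "\<lambda>n. passage_prob (Suc n) x" "hit x - P x j"]
        by (simp del: first_passage.simps(3))
    qed
    ultimately have "t x - P x j = (\<Sum>y\<in>T x - {j}. P x y * t y) + (hit x - P x j)"
      unfolding rel[OF x] by (rule sums_unique2)
    thus ?thesis using hit1[OF x] by simp
  qed
  show ?thesis
  proof (rule that[of \<tau>])
    show "0 \<le> \<tau> x" if "x \<in> S" for x using t0[OF that] by (simp add: \<tau>_def)
    show "\<tau> x = 1 + (\<Sum>y\<in>T x. P x y * \<tau> y)" if "x \<in> S" "x \<noteq> j" for x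
      using t_eq[OF that(1)] that(2) unfolding sum_split[OF that(1)] by (simp add: \<tau>_def)
  qed
qed

end
end

section \<open>Powers of substochastic matrices\<close>

context square_mats begin

text \<open>Maximum principle: an average of values that are at most the maximum equals the maximum only if the
  weights add up to 1 and all values with positive weight equal it.\<close>

lemma fixed_column_maximum:
  assumes Q: "rows_le 1 Q" and L: "L \<in> Mat" "Q * L = L"
    and ij: "i < m" "j < m" and max: "\<And>k. k < m \<Longrightarrow> L $$ (k, j) \<le> L $$ (i, j)" and pos: "0 < L $$ (i, j)"
  shows "(\<Sum>k<m. Q $$ (i, k)) = 1"
    and "k < m \<Longrightarrow> 0 < Q $$ (i, k) \<Longrightarrow> L $$ (k, j) = L $$ (i, j)"
proof -
  let ?\<mu> = "L $$ (i, j)"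
  have QD: "Q \<in> Mat" "Zero \<le> Q" "(\<Sum>k<m. Q $$ (i, k)) \<le> 1" using rows_leD[OF Q] ij by auto
  have eq: "?\<mu> = (\<Sum>k<m. Q $$ (i, k) * L $$ (k, j))"
    using mult_entry[OF QD(1) L(1) ij] L(2) by simp
  have nn: "0 \<le> Q $$ (i, k) * (?\<mu> - L $$ (k, j))" if "k < m" for k
    using that ij max nonneg_matD[OF QD(2,1)] by (intro mult_nonneg_nonneg) auto
  have s: "(\<Sum>k<m. Q $$ (i, k) * (?\<mu> - L $$ (k, j))) = (\<Sum>k<m. Q $$ (i, k)) * ?\<mu> - ?\<mu>"
    by (simp add: right_diff_distrib sum_subtractf sum_distrib_right flip: eq)
  have "0 \<le> (\<Sum>k<m. Q $$ (i, k) * (?\<mu> - L $$ (k, j)))" using nn by (intro sum_nonneg) auto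
  hence "1 * ?\<mu> \<le> (\<Sum>k<m. Q $$ (i, k)) * ?\<mu>" unfolding s by simp
  hence "1 \<le> (\<Sum>k<m. Q $$ (i, k))" using pos by (subst (asm) mult_le_cancel_right_pos)
  thus one: "(\<Sum>k<m. Q $$ (i, k)) = 1" using QD(3) by simp
  assume k: "k < m" "0 < Q $$ (i, k)"
  have "(\<Sum>k<m. Q $$ (i, k) * (?\<mu> - L $$ (k, j))) = 0" unfolding s one by simp
  hence "\<forall>k\<in>{..<m}. Q $$ (i, k) * (?\<mu> - L $$ (k, j)) = 0"
    using nn by (subst (asm) sum_nonneg_eq_0_iff) (auto simp del: mult_eq_0_iff)
  hence "Q $$ (i, k) * (?\<mu> - L $$ (k, j)) = 0" using k(1) by blast
  thus "L $$ (k, j) = ?\<mu>" using k by simp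
qed

lemma substochastic_all_ones: "rows_le 1 Q \<Longrightarrow> Q * all_ones \<le> all_ones"
proof (rule le_matI)
  fix i j assume "rows_le 1 Q" "i < m" "j < m"
  thus "(Q * all_ones) $$ (i, j) \<le> all_ones $$ (i, j)"
    using rows_leD[of 1 Q] by (simp add: mult_all_ones_entry)
qed (auto dest: rows_leD)

lemma mult_substochastic_row_sum:
  assumes X: "X \<in> Mat" "Zero \<le> X" and Q: "rows_le 1 Q" and i: "i < m"
  shows "(\<Sum>j<m. (X * Q) $$ (i, j)) \<le> (\<Sum>j<m. X $$ (i, j))"
proof -
  note QD = rows_leD(1)[OF Q]
  have "X * (Q * all_ones) \<le> X * all_ones"
    using X QD substochastic_all_ones[OF Q] by (intro mult_left_mono_mat) auto
  hence "X * Q * all_ones \<le> X * all_ones" using X QD by (simp add: mat_assoc)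
  from le_matD[OF this _ i m_pos] show ?thesis
    using X QD i m_pos by (simp add: mult_all_ones_entry)
qed

lemma nonzero_column_maximum:
  assumes L: "L \<in> Mat" "Zero \<le> L" "L \<noteq> Zero"
  obtains i j where "i < m" "j < m" "0 < L $$ (i, j)" "\<And>k. k < m \<Longrightarrow> L $$ (k, j) \<le> L $$ (i, j)"
proof -
  obtain i0 j where ij: "i0 < m" "j < m" "L $$ (i0, j) \<noteq> 0"
    using L(1,3) eq_MatI[of L Zero] by auto
  have pos: "0 < L $$ (i0, j)" using ij nonneg_matD[OF L(2,1) ij(1,2)] by simp
  let ?A = "(\<lambda>k. L $$ (k, j)) ` {..<m}"
  have "Max ?A \<in> ?A" using m_pos by (intro Max_in) auto
  then obtain i where i: "i < m" "L $$ (i, j) = Max ?A" by auto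
  have "L $$ (k, j) \<le> L $$ (i, j)" if "k < m" for k
    using that unfolding i(2) by (intro Max_ge) auto
  moreover from this[OF ij(1)] have "0 < L $$ (i, j)" using pos by linarith
  ultimately show ?thesis using that i(1) ij(2) by blast
qed

text \<open>\<open>L\<close> is the limit of the decreasing sequence \<open>Q\<^sup>k 1\<close>, the probability that the chain with transition
  matrix \<open>Q\<close> is never killed.\<close>

lemma substochastic_power_limit:
  assumes Q: "rows_le 1 Q"
  obtains L where "L \<in> Mat" "Zero \<le> L" "Q * L = L"
    "L = Zero \<Longrightarrow> \<exists>k>0. rows_le (1/2) (Q ^\<^sub>m k)"
proof -
  note QD = rows_leD[OF Q]
  define X where "X k = Q ^\<^sub>m k * all_ones" for k
  have XM: "X k \<in> Mat" "Zero \<le> X k" for k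
    using QD by (auto simp: X_def intro!: mult_nonneg_mat pow_nonneg_mat)
  have X_Suc: "X (Suc k) = Q * X k" for k
    using QD pow_mat_Suc_left[of Q m k] by (simp add: X_def mat_assoc del: pow_mat.simps)
  have "Q * all_ones \<le> all_ones" by (rule substochastic_all_ones[OF Q])
  hence "Q ^\<^sub>m k * (Q * all_ones) \<le> Q ^\<^sub>m k * all_ones" for k
    using QD by (intro mult_left_mono_mat pow_nonneg_mat) auto
  hence dec: "X (Suc k) \<le> X k" for k using QD by (simp add: X_def mat_assoc)
  define Y where "Y k = all_ones - X k" for k
  have YM: "Y k \<in> Mat" for k using XM by (simp add: Y_def)
  have Y1: "Y k \<le> Y (Suc k)" for k
    using XM dec by (intro le_matI) (auto simp: Y_def intro!: le_matD)
  have Y2: "Y k \<le> all_ones" for k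
    using XM by (intro le_matI) (auto simp: Y_def intro!: nonneg_matD)
  obtain K where K: "mconv Y K"
    using mono_le_mconv[of Y all_ones, OF YM Y1 all_ones_carrier Y2] by blast
  define L where "L = all_ones - K"
  have "mconv (\<lambda>k. all_ones - Y k) L" unfolding L_def by (intro mconv_minus mconv_const K) auto
  moreover have "(\<lambda>k. all_ones - Y k) = X"
    using XM by (intro ext eq_MatI) (auto simp: Y_def)
  ultimately have L: "mconv X L" by simp
  have "mconv (\<lambda>k. X (Suc k)) (Q * L)"
    unfolding X_Suc using QD by (intro mconv_mult mconv_const L) auto
  from mconv_unique[OF this mconv_Suc[OF L]] have fixed: "Q * L = L" .
  have half: "\<exists>k>0. rows_le (1/2) (Q ^\<^sub>m k)" if "L = Zero"
  proof -
    have "\<forall>\<^sub>F k in sequentially. X k $$ (i, 0) < 1/2" if "i < m" for i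
      using mconvD(3)[OF L that m_pos] \<open>L = Zero\<close> that m_pos
      by (intro order_tendstoD(2)) auto
    hence "\<forall>\<^sub>F k in sequentially. \<forall>i\<in>{..<m}. X k $$ (i, 0) < 1/2"
      by (intro eventually_ball_finite) auto
    hence "\<forall>\<^sub>F k in sequentially. 0 < k \<and> (\<forall>i\<in>{..<m}. X k $$ (i, 0) < 1/2)"
      using eventually_gt_at_top[of 0] by eventually_elim auto
    then obtain k where k: "0 < k" "\<forall>i\<in>{..<m}. X k $$ (i, 0) < 1/2"
      by (auto simp: eventually_sequentially)
    have "rows_le (1/2) (Q ^\<^sub>m k)"
      unfolding rows_le_def using QD k(2) m_pos
      by (force simp: X_def mult_all_ones_entry intro: pow_nonneg_mat)
    thus ?thesis using k(1) by blast
  qed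
  show ?thesis
    using that[OF mconvD(2)[OF L] mconv_lower[OF L _ XM(2)] fixed half] by simp
qed

end

section \<open>From the QBD chain to the dichotomy for \<open>G\<close> and \<open>R\<close>\<close>

lemma qbd_states_iff [simp]: "(k, i) \<in> qbd_states m \<longleftrightarrow> i < m"
  by (simp add: qbd_states_def)

locale qbd_chain = square_mats m for m +
  fixes B a b c G :: "real mat"
  assumes qbd: "qbd m B a b c"
    and irrP: "irreducible_kernel (qbd_states m) (qbd_kernel B a b c)"
    and irrA: "irreducible_matrix m (a + b + c)"
    and G: "first_passage_matrix a b c G"
begin

abbreviation S :: "(nat \<times> nat) set" where "S \<equiv> qbd_states m"
abbreviation P :: "nat \<times> nat \<Rightarrow> nat \<times> nat \<Rightarrow> real" where "P \<equiv> qbd_kernel B a b c"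

definition T :: "nat \<times> nat \<Rightarrow> (nat \<times> nat) set" where "T x = {..Suc (fst x)} \<times> {..<m}"

lemma block_facts: "B \<in> Mat" "a \<in> Mat" "b \<in> Mat" "c \<in> Mat" "Zero \<le> B" "Zero \<le> a" "Zero \<le> b" "Zero \<le> c"
  and stochastic: "row_stochastic S P"
  using qbd by (auto simp: qbd_def)

lemma P_zero: "x \<in> S \<Longrightarrow> y \<in> S - T x \<Longrightarrow> P x y = 0"
  by (cases x; cases y) (auto simp: T_def)

sublocale finite_support_chain S P T
proof
  fix x assume x: "x \<in> S"
  show T: "finite (T x)" "T x \<subseteq> S" by (auto simp: T_def qbd_states_def)
  have "(P x has_sum 1) S" using stochastic x by (auto simp: row_stochastic_def)
  hence "(P x has_sum 1) (T x)"
    using P_zero[OF x] T by (subst has_sum_cong_neutral[of S "T x" "P x" "P x"]) auto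
  thus "(\<Sum>y\<in>T x. P x y) = 1" using has_sum_finite[OF T(1)] has_sum_unique by blast
  show "P x y = 0" if "y \<in> S - T x" for y using P_zero[OF x that] .
  show "0 \<le> P x y" if "y \<in> S" for y using stochastic x that by (auto simp: row_stochastic_def)
qed (rule irrP)

lemma kernel_sum:
  assumes i: "i < m"
  shows "(\<Sum>y\<in>T (Suc l, i). P (Suc l, i) y * h y) =
    (\<Sum>j<m. a $$ (i, j) * h (l, j)) + (\<Sum>j<m. b $$ (i, j) * h (Suc l, j))
      + (\<Sum>j<m. c $$ (i, j) * h (Suc (Suc l), j))"
proof -
  have "(\<Sum>y\<in>T (Suc l, i). P (Suc l, i) y * h y) =
    (\<Sum>k\<le>Suc (Suc l). \<Sum>j<m. P (Suc l, i) (k, j) * h (k, j))"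
    unfolding T_def fst_conv sum.cartesian_product
    by (rule sum.cong) (auto simp del: qbd_kernel.simps)
  also have "\<dots> = (\<Sum>k\<in>{l, Suc l, Suc (Suc l)}. \<Sum>j<m. P (Suc l, i) (k, j) * h (k, j))"
    by (rule sum.mono_neutral_right) auto
  finally show ?thesis by simp
qed

lemma block_row_sum:
  assumes i: "i < m"
  shows "(\<Sum>j<m. a $$ (i, j)) + (\<Sum>j<m. b $$ (i, j)) + (\<Sum>j<m. c $$ (i, j)) = 1"
  using kernel_sum[OF i, of 0 "\<lambda>_. 1"] P_sum[of "(1, i)"] i by simp

lemma blocks_rows_le: "rows_le 1 (a + b + c)"
  unfolding rows_le_def
proof (intro conjI allI impI)
  fix i assume i: "i < m"
  have "(\<Sum>j<m. (a + b + c) $$ (i, j)) = (\<Sum>j<m. a $$ (i, j)) + (\<Sum>j<m. b $$ (i, j)) + (\<Sum>j<m. c $$ (i, j))"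
    using i block_facts by (simp add: sum.distrib)
  thus "(\<Sum>j<m. (a + b + c) $$ (i, j)) \<le> 1" using block_row_sum[OF i] by simp
qed (use block_facts in \<open>auto intro!: add_nonneg_mat\<close>)

lemma G_facts: "G \<in> Mat" "Zero \<le> G" "a + b * G + c * G * G = G"
  using G by (auto simp: first_passage_matrix_def)

text \<open>The constant 1 is superharmonic, so the first fact is an instance of the second.\<close>

lemma G_rows_le: "rows_le 1 G"
  and superharmonic_passage: "superharmonic a b c D \<Longrightarrow> G * D k \<le> D (Suc k)"
proof -
  have harm: "G * D k \<le> D (Suc k)" if "superharmonic a b c D" for D k
  proof (rule passage_limit[OF block_facts(2-4,6-8) blocks_rows_le G], goal_cases)
    case 1
    show ?case by (rule 1(10)[OF that])
  qed
  thus "superharmonic a b c D \<Longrightarrow> G * D k \<le> D (Suc k)" .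
  have "superharmonic a b c (\<lambda>_. all_ones)"
    unfolding superharmonic_def
  proof (intro conjI allI)
    show "a * all_ones + b * all_ones + c * all_ones \<le> all_ones"
    proof (rule le_matI)
      fix i j assume "i < m" "j < m"
      thus "(a * all_ones + b * all_ones + c * all_ones) $$ (i, j) \<le> all_ones $$ (i, j)"
        using block_row_sum[of i] block_facts(2-4) by (simp add: mult_all_ones_entry)
    qed (use block_facts(2-4) in simp_all)
  qed simp_all
  hence "G * all_ones \<le> all_ones" using harm[of "\<lambda>_. all_ones" 0] by simp
  thus "rows_le 1 G"
    unfolding rows_le_def using G_facts le_matD[of "G * all_ones" all_ones _ 0] m_pos
    by (auto simp: mult_all_ones_entry)
qed

lemma U_rows_le: "rows_le 1 (b + c * G)"
  unfolding rows_le_def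
proof (intro conjI allI impI)
  fix i assume i: "i < m"
  have cG: "(\<Sum>j<m. (c * G) $$ (i, j)) \<le> (\<Sum>j<m. c $$ (i, j))"
    using block_facts by (intro mult_substochastic_row_sum G_rows_le i)
  have "0 \<le> (\<Sum>j<m. a $$ (i, j))"
    using i block_facts by (auto intro!: sum_nonneg nonneg_matD)
  moreover have "(\<Sum>j<m. (b + c * G) $$ (i, j)) = (\<Sum>j<m. b $$ (i, j)) + (\<Sum>j<m. (c * G) $$ (i, j))"
    using i block_facts G_facts by (simp add: sum.distrib)
  ultimately show "(\<Sum>j<m. (b + c * G) $$ (i, j)) \<le> 1"
    using cG block_row_sum[OF i] by linarith
qed (use block_facts G_facts in \<open>auto intro!: add_nonneg_mat mult_nonneg_mat\<close>)

text \<open>Otherwise some set \<open>C\<close> of phases is such that the walk started on level 1 in \<open>C\<close> returns to level 1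
  before visiting level 0, almost surely and again in \<open>C\<close>. Thus it never visits level 0, in
  contradiction to irreducibility. The set of states it can visit is enlarged to an explicitly closed one:
  \<open>\<Gamma> k\<close> consists of the phases from which the first visit \<open>k\<close> levels further down, if there is one,
  takes place in \<open>C\<close>, and the closed set consists of \<open>\<Gamma> k\<close> on level \<open>k + 1\<close>.\<close>

lemma U_neumann: obtains N where "neumann (b + c * G) N"
proof -
  let ?U = "b + c * G"
  note M = block_facts(2-4,6-8) G_facts(1,2)
  have UM: "?U \<in> Mat" "Zero \<le> ?U" using rows_leD[OF U_rows_le] by auto
  obtain L where L: "L \<in> Mat" "Zero \<le> L" "?U * L = L"
    "L = Zero \<Longrightarrow> \<exists>k>0. rows_le (1/2) (?U ^\<^sub>m k)"
    using substochastic_power_limit[OF U_rows_le] by metis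
  have "L = Zero"
  proof (rule ccontr)
    assume "L \<noteq> Zero"
    then obtain i0 j0 where ij0: "i0 < m" "j0 < m" "0 < L $$ (i0, j0)"
      and max: "\<And>k. k < m \<Longrightarrow> L $$ (k, j0) \<le> L $$ (i0, j0)"
      using nonzero_column_maximum[OF L(1,2)] by metis
    define C where "C = {i. i < m \<and> L $$ (i, j0) = L $$ (i0, j0)}"
    have U_sum: "(\<Sum>k<m. ?U $$ (i, k)) = 1"
      and U_closed: "k < m \<Longrightarrow> 0 < ?U $$ (i, k) \<Longrightarrow> k \<in> C" if "i \<in> C" for i k
    proof -
      have i: "i < m" "L $$ (i, j0) = L $$ (i0, j0)" using that by (simp_all add: C_def)
      have mx: "L $$ (k, j0) \<le> L $$ (i, j0)" if "k < m" for k using max[OF that] i(2) by simp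
      have pos: "0 < L $$ (i, j0)" using ij0(3) i(2) by simp
      note F = fixed_column_maximum[OF U_rows_le L(1,3) i(1) ij0(2) mx pos]
      show "(\<Sum>k<m. ?U $$ (i, k)) = 1" by (rule F(1))
      show "k \<in> C" if "k < m" "0 < ?U $$ (i, k)" for k
        using F(2)[OF _ that] that(1) i(2) by (simp add: C_def)
    qed
    have a0: "a $$ (i, k) = 0" if i: "i \<in> C" and k: "k < m" for i k
    proof -
      have im: "i < m" using i by (simp add: C_def)
      have "(\<Sum>k<m. (c * G) $$ (i, k)) \<le> (\<Sum>k<m. c $$ (i, k))"
        using M by (intro mult_substochastic_row_sum G_rows_le im)
      moreover have "(\<Sum>k<m. ?U $$ (i, k)) = (\<Sum>k<m. b $$ (i, k)) + (\<Sum>k<m. (c * G) $$ (i, k))"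
        using im M by (simp add: sum.distrib)
      ultimately have le: "(\<Sum>k<m. a $$ (i, k)) \<le> 0"
        using U_sum[OF i] block_row_sum[OF im] by linarith
      have nn: "0 \<le> a $$ (i, k)" if "k < m" for k using im that M by (auto intro: nonneg_matD)
      have "(\<Sum>k<m. a $$ (i, k)) = 0" using le nn by (intro antisym sum_nonneg) auto
      thus ?thesis using nn k by (subst (asm) sum_nonneg_eq_0_iff) auto
    qed
    have U_ge: "0 < ?U $$ (i, k)" if "i < m" "k < m" "0 < b $$ (i, k) \<or> 0 < (c * G) $$ (i, k)" for i k
    proof -
      have "0 \<le> b $$ (i, k)" "0 \<le> (c * G) $$ (i, k)"
        using that M by (auto intro!: nonneg_matD mult_nonneg_mat)
      thus ?thesis using that M by auto
    qed
    define \<Gamma> where "\<Gamma> k = {i. i < m \<and> (\<forall>j<m. j \<notin> C \<longrightarrow> (G ^\<^sub>m k) $$ (i, j) = 0)}" for k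
    have \<Gamma>0: "i \<in> \<Gamma> 0 \<longleftrightarrow> i \<in> C" for i
      using M by (auto simp: \<Gamma>_def C_def)
    have prod_pos: "0 < (X * Y) $$ (i, j)" if "X \<in> Mat" "Y \<in> Mat" "Zero \<le> X" "Zero \<le> Y"
      "i < m" "j < m" "k < m" "0 < X $$ (i, k)" "0 < Y $$ (k, j)" for X Y i j k
      unfolding mult_entry[OF that(1,2,5,6)]
      using that by (intro sum_pos2[of _ k]) (auto intro!: mult_nonneg_nonneg nonneg_matD)
    have G_pow: "G ^\<^sub>m Suc k = a * G ^\<^sub>m k + b * G ^\<^sub>m Suc k + c * G ^\<^sub>m Suc (Suc k)" for k
    proof -
      have "G ^\<^sub>m Suc k = (a + b * G + c * G * G) * G ^\<^sub>m k"
        unfolding G_facts(3) by (rule pow_mat_Suc_left[OF M(7)])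
      also have "\<dots> = a * G ^\<^sub>m k + b * (G * G ^\<^sub>m k) + c * (G * (G * G ^\<^sub>m k))"
        using M by (simp add: mat_distrib)
      also have "\<dots> = a * G ^\<^sub>m k + b * G ^\<^sub>m Suc k + c * G ^\<^sub>m Suc (Suc k)"
        using pow_mat_Suc_left[OF M(7), of k] pow_mat_Suc_left[OF M(7), of "Suc k"] by (simp only:)
      finally show ?thesis .
    qed
    have G_nn: "G ^\<^sub>m k \<in> Mat" "Zero \<le> G ^\<^sub>m k" for k using M by (auto intro: pow_nonneg_mat)
    have step: "(0 < a $$ (i, i') \<longrightarrow> i' \<in> \<Gamma> k) \<and> (0 < b $$ (i, i') \<longrightarrow> i' \<in> \<Gamma> (Suc k)) \<and>
        (0 < c $$ (i, i') \<longrightarrow> i' \<in> \<Gamma> (Suc (Suc k)))"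
      if i: "i \<in> \<Gamma> (Suc k)" "i' < m" for i i' k
    proof -
      have im: "i < m" using i by (simp add: \<Gamma>_def)
      have zero: "(a * G ^\<^sub>m k) $$ (i, j) = 0 \<and> (b * G ^\<^sub>m Suc k) $$ (i, j) = 0 \<and> (c * G ^\<^sub>m Suc (Suc k)) $$ (i, j) = 0"
        if j: "j < m" "j \<notin> C" for j
      proof -
        have "0 \<le> (a * G ^\<^sub>m k) $$ (i, j)" "0 \<le> (b * G ^\<^sub>m Suc k) $$ (i, j)"
          "0 \<le> (c * G ^\<^sub>m Suc (Suc k)) $$ (i, j)"
          using im j M G_nn by (auto intro!: nonneg_matD mult_nonneg_mat simp del: pow_mat.simps)
        moreover have "(a * G ^\<^sub>m k + b * G ^\<^sub>m Suc k + c * G ^\<^sub>m Suc (Suc k)) $$ (i, j) = 0"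
          using i j unfolding G_pow[symmetric] by (auto simp: \<Gamma>_def)
        ultimately show ?thesis using im j M G_nn by (simp del: pow_mat.simps)
      qed
      have mem: "i' \<in> \<Gamma> l" if X: "X \<in> Mat" "Zero \<le> X" "0 < X $$ (i, i')"
        "\<And>j. j < m \<Longrightarrow> j \<notin> C \<Longrightarrow> (X * G ^\<^sub>m l) $$ (i, j) = 0" for X l
        unfolding \<Gamma>_def
      proof (intro CollectI conjI allI impI i(2))
        fix j assume j: "j < m" "j \<notin> C"
        have "0 \<le> (G ^\<^sub>m l) $$ (i', j)" using j i(2) G_nn by (auto intro: nonneg_matD)
        moreover have "\<not> 0 < (G ^\<^sub>m l) $$ (i', j)"
          using prod_pos[OF X(1) G_nn(1) X(2) G_nn(2) im j(1) i(2) X(3)] X(4)[OF j] by force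
        ultimately show "(G ^\<^sub>m l) $$ (i', j) = 0" by linarith
      qed
      show ?thesis using mem[of a k] mem[of b "Suc k"] mem[of c "Suc (Suc k)"] M zero by auto
    qed
    have "(0, i0) \<in> {(Suc k, i) | k i. i \<in> \<Gamma> k}"
    proof (rule irreducible_closed_set[OF irrP])
      show "(1, i0) \<in> S" "(0, i0) \<in> S" using ij0 by auto
      show "(1, i0) \<in> {(Suc k, i) | k i. i \<in> \<Gamma> k}"
        using ij0 by (auto simp: \<Gamma>0 C_def)
      fix u v assume uv: "u \<in> S" "v \<in> S" "u \<in> {(Suc k, i) | k i. i \<in> \<Gamma> k}" "0 < P u v"
      then obtain k i where u: "u = (Suc k, i)" "i \<in> \<Gamma> k" "i < m" by auto
      obtain l j where v: "v = (l, j)" "j < m" using uv(2) by (cases v) auto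
      consider "l = Suc k" "0 < b $$ (i, j)" | "l = Suc (Suc k)" "0 < c $$ (i, j)" | "l = k" "0 < a $$ (i, j)"
        using uv(4) u v by (auto split: if_splits)
      thus "v \<in> {(Suc k, i) | k i. i \<in> \<Gamma> k}"
      proof cases
        case 1
        have "j \<in> \<Gamma> k"
        proof (cases k)
          case 0
          thus ?thesis using 1 u v U_ge[of i j] U_closed[of i j] by (auto simp: \<Gamma>0)
        qed (use step[of i _ j] 1 u v in auto)
        thus ?thesis using v 1 by auto
      next
        case 2
        have "j \<in> \<Gamma> (Suc k)"
        proof (cases k)
          case 0
          hence iC: "i \<in> C" using u by (simp add: \<Gamma>0)
          have "G $$ (j, q) = 0" if q: "q < m" "q \<notin> C" for q
          proof -
            have "\<not> 0 < (c * G) $$ (i, q)"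
              using U_closed[OF iC q(1)] U_ge[OF u(3) q(1)] q(2) by blast
            hence "\<not> 0 < G $$ (j, q)"
              using prod_pos[OF M(3,7,6,8) u(3) q(1) v(2) 2(2)] by blast
            moreover have "0 \<le> G $$ (j, q)" using v q M by (auto intro: nonneg_matD)
            ultimately show ?thesis by linarith
          qed
          thus ?thesis using 0 v M by (auto simp: \<Gamma>_def)
        qed (use step[of i _ j] 2 u v in auto)
        thus ?thesis using v 2 by auto
      next
        case 3
        show ?thesis
        proof (cases k)
          case 0
          thus ?thesis using a0[of i j] 3 u v by (auto simp: \<Gamma>0)
        next
          case (Suc k')
          thus ?thesis using step[of i k' j] 3 u v by auto
        qed
      qed
    qed
    thus False by simp
  qed
  then obtain k where "0 < k" "rows_le (1/2) (?U ^\<^sub>m k)" using L(4) by blast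
  thus ?thesis using neumann_of_contraction[of "1/2" ?U k] UM that by auto
qed

text \<open>The limit \<open>L\<close> of \<open>G\<^sup>k 1\<close> is fixed by \<open>G\<close>, hence by \<open>a + b G + c G\<^sup>2 = G\<close> also by \<open>a + b + c\<close>. By
  irreducibility it is constant, and a nonzero constant is fixed by \<open>G\<close> only if \<open>G\<close> is stochastic.\<close>

lemma G_powers_contract:
  assumes "G * all_ones \<noteq> all_ones"
  shows "\<exists>k. rows_le (1/2) (G ^\<^sub>m k)"
proof -
  note M = block_facts(2-4,6-8) G_facts(1,2)
  obtain L where L: "L \<in> Mat" "Zero \<le> L" "G * L = L"
    "L = Zero \<Longrightarrow> \<exists>k>0. rows_le (1/2) (G ^\<^sub>m k)"
    using substochastic_power_limit[OF G_rows_le] by metis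
  have "L = Zero"
  proof (rule ccontr)
    assume "L \<noteq> Zero"
    then obtain i0 j0 where ij0: "i0 < m" "j0 < m" "0 < L $$ (i0, j0)"
      and max: "\<And>k. k < m \<Longrightarrow> L $$ (k, j0) \<le> L $$ (i0, j0)"
      using nonzero_column_maximum[OF L(1,2)] by metis
    have "(a + b + c) * L = a * L + b * (G * L) + c * (G * (G * L))"
      using M L(1) by (simp add: mat_distrib L(3))
    also have "\<dots> = (a + b * G + c * G * G) * L" using M L(1) by (simp add: mat_distrib)
    also have "\<dots> = L" by (simp add: G_facts(3) L(3))
    finally have AL: "(a + b + c) * L = L" .
    have const: "L $$ (i, j0) = L $$ (i0, j0)" if i: "i < m" for i
    proof -
      have "i \<in> {i. L $$ (i, j0) = L $$ (i0, j0)}"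
      proof (rule irreducible_closed_set[OF irrA[unfolded irreducible_matrix_def]])
        show "i0 \<in> {..<m}" "i \<in> {..<m}" using ij0 i by auto
        fix u v assume uv: "u \<in> {..<m}" "v \<in> {..<m}" "u \<in> {i. L $$ (i, j0) = L $$ (i0, j0)}"
          "0 < (a + b + c) $$ (u, v)"
        have u: "u < m" "v < m" "L $$ (u, j0) = L $$ (i0, j0)" using uv by auto
        have mx: "L $$ (k, j0) \<le> L $$ (u, j0)" if "k < m" for k using max[OF that] u(3) by simp
        have pos: "0 < L $$ (u, j0)" using ij0(3) u(3) by simp
        from fixed_column_maximum(2)[OF blocks_rows_le L(1) AL u(1) ij0(2) mx pos u(2) uv(4)]
        show "v \<in> {i. L $$ (i, j0) = L $$ (i0, j0)}" using u(3) by simp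
      qed simp
      thus ?thesis by simp
    qed
    have "G * all_ones = all_ones"
    proof (rule eq_MatI)
      fix i j assume ij: "i < m" "j < m"
      have mx: "L $$ (k, j0) \<le> L $$ (i, j0)" if "k < m" for k using max[OF that] const[OF ij(1)] by simp
      have pos: "0 < L $$ (i, j0)" using ij0(3) const[OF ij(1)] by simp
      from fixed_column_maximum(1)[OF G_rows_le L(1,3) ij(1) ij0(2) mx pos]
      show "(G * all_ones) $$ (i, j) = all_ones $$ (i, j)"
        using ij M by (simp add: mult_all_ones_entry)
    qed (use M in auto)
    thus False using assms by simp
  qed
  thus ?thesis using L(4) by blast
qed

text \<open>The restriction of a function on the states to one level, as a matrix with equal columns.\<close>

definition level_matrix :: "(nat \<times> nat \<Rightarrow> real) \<Rightarrow> nat \<Rightarrow> real mat" where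
  "level_matrix h k = mat m m (\<lambda>(i, j). h (k, i))"

lemma level_matrix_carrier [simp]: "level_matrix h k \<in> Mat"
  by (simp add: level_matrix_def)

lemma level_matrix_entry [simp]: "i < m \<Longrightarrow> j < m \<Longrightarrow> level_matrix h k $$ (i, j) = h (k, i)"
  by (simp add: level_matrix_def)

lemma level_matrix_kernel:
  assumes "i < m" "j < m"
  shows "(a * level_matrix h k + b * level_matrix h (Suc k) + c * level_matrix h (Suc (Suc k))) $$ (i, j)
    = (\<Sum>y\<in>T (Suc k, i). P (Suc k, i) y * h y)"
  using assms block_facts(2-4) by (simp add: kernel_sum mult_entry)

text \<open>The probability of hitting \<open>j\<close> is superharmonic, so on level \<open>k + 1\<close> it is at least its average under
  \<open>G\<close> over level \<open>k\<close>. If \<open>G\<close> is stochastic, its minimum over level 0 is therefore a lower bound on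
  all levels.\<close>

lemma recurrent_of_stochastic_G:
  assumes GJ: "G * all_ones = all_ones" and j: "j \<in> S"
  shows "recurrent_state S P j"
proof -
  let ?d = "hit_or_at j" and ?D = "level_matrix (hit_or_at j)"
  have sup: "superharmonic a b c ?D"
    unfolding superharmonic_def
  proof (intro conjI allI)
    fix k
    show "Zero \<le> ?D k" using hit_or_at_bounds(1)[OF j] by (intro le_matI) auto
    show "a * ?D k + b * ?D (Suc k) + c * ?D (Suc (Suc k)) \<le> ?D (Suc k)"
    proof (rule le_matI)
      fix i l assume il: "i < m" "l < m"
      show "(a * ?D k + b * ?D (Suc k) + c * ?D (Suc (Suc k))) $$ (i, l) \<le> ?D (Suc k) $$ (i, l)"
        unfolding level_matrix_kernel[OF il] using il hit_harmonic[OF j] hit_or_at_bounds(3)[OF j] by simp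
    qed (use block_facts(2-4) in auto)
  qed simp
  let ?A = "(\<lambda>i. ?d (0, i)) ` {..<m}"
  have "Min ?A \<in> ?A" using m_pos by (intro Min_in) auto
  then obtain i0 where i0: "i0 < m" "?d (0, i0) = Min ?A" by auto
  let ?\<delta> = "?d (0, i0)"
  have G\<delta>: "G * (?\<delta> \<cdot>\<^sub>m all_ones) = ?\<delta> \<cdot>\<^sub>m all_ones"
  proof -
    have "G * (?\<delta> \<cdot>\<^sub>m all_ones) = ?\<delta> \<cdot>\<^sub>m (G * all_ones)"
      using G_facts(1) by (intro mult_smult_distrib[of _ m m _ m]) auto
    thus ?thesis using GJ by simp
  qed
  have ge: "?\<delta> \<cdot>\<^sub>m all_ones \<le> ?D k" for k
  proof (induction k)
    case 0
    show ?case unfolding i0(2) by (intro le_matI) (auto intro!: Min_le)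
  next
    case (Suc k)
    have "G * (?\<delta> \<cdot>\<^sub>m all_ones) \<le> G * ?D k"
      using G_facts(1,2) Suc by (intro mult_left_mono_mat) auto
    also have "\<dots> \<le> ?D (Suc k)" by (rule superharmonic_passage[OF sup])
    finally show ?case unfolding G\<delta> .
  qed
  show ?thesis
  proof (rule recurrent_of_minimum[OF j, of "(0, i0)"])
    fix x assume "x \<in> S"
    then obtain k i where x: "x = (k, i)" "i < m" by (cases x) auto
    from le_matD[OF ge[of k] _ x(2) m_pos] show "?\<delta> \<le> ?d x" using x m_pos by simp
  qed (use i0 in simp)
qed

text \<open>Above the level of \<open>j\<close>, the expected hitting time is at least the expected time spent before the first
  visit to the level below, which is \<open>N (\<Sum>l. R\<^sup>l) 1\<close>. The latter series therefore converges.\<close>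

lemma rate_powers_vanish:
  assumes j: "j \<in> S" and rec: "recurrent_state S P j"
    and fin: "summable (\<lambda>n. real n * first_passage S P n j j)"
    and R: "rate_matrix a b c R" and N: "neumann (b + c * G) N"
  shows "\<exists>k. \<forall>i<m. \<forall>l<m. (R ^\<^sub>m k) $$ (i, l) \<le> 1 / (2 * m)"
proof -
  note M = block_facts(2-4,6-8) G_facts(1,2)
  note ND = neumannD[OF N]
  note RN = rate_matrix_eq[OF M(1-6) blocks_rows_le G R N]
  have RM: "R \<in> Mat" "Zero \<le> R" using R by (auto simp: rate_matrix_def)
  obtain \<tau> where \<tau>: "\<And>x. x \<in> S \<Longrightarrow> 0 \<le> \<tau> x"
    "\<And>x. x \<in> S \<Longrightarrow> x \<noteq> j \<Longrightarrow> \<tau> x = 1 + (\<Sum>y\<in>T x. P x y * \<tau> y)"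
    using expected_time[OF j rec fin] by metis
  define D where "D k = level_matrix \<tau> (fst j + k)" for k
  have DM: "D k \<in> Mat" "Zero \<le> D k" for k
    using \<tau>(1) by (auto simp: D_def intro!: le_matI)
  have D_eq: "all_ones + (a * D k + b * D (Suc k) + c * D (Suc (Suc k))) = D (Suc k)" for k
  proof (rule eq_MatI)
    fix i l assume il: "i < m" "l < m"
    have "(Suc (fst j + k), i) \<noteq> j" by (cases j) auto
    hence "\<tau> (Suc (fst j + k), i) = 1 + (\<Sum>y\<in>T (Suc (fst j + k), i). P (Suc (fst j + k), i) y * \<tau> y)"
      using il by (intro \<tau>(2)) auto
    also have "(\<Sum>y\<in>T (Suc (fst j + k), i). P (Suc (fst j + k), i) y * \<tau> y)
      = (a * D k + b * D (Suc k) + c * D (Suc (Suc k))) $$ (i, l)"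
      using level_matrix_kernel[OF il, of \<tau> "fst j + k"] by (simp add: D_def)
    finally have "\<tau> (Suc (fst j + k), i) = 1 + (a * D k + b * D (Suc k) + c * D (Suc (Suc k))) $$ (i, l)" .
    moreover have "D (Suc k) $$ (i, l) = \<tau> (Suc (fst j + k), i)" using il by (simp add: D_def)
    moreover have "(all_ones + (a * D k + b * D (Suc k) + c * D (Suc (Suc k)))) $$ (i, l)
      = 1 + (a * D k + b * D (Suc k) + c * D (Suc (Suc k))) $$ (i, l)"
      using il M DM by (subst add_entry) auto
    ultimately show "(all_ones + (a * D k + b * D (Suc k) + c * D (Suc (Suc k)))) $$ (i, l) = D (Suc k) $$ (i, l)"
      by simp
  qed (use M DM in auto)
  have sup: "superharmonic a b c D"
    unfolding superharmonic_def
  proof (intro conjI allI DM)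
    fix k
    have "Zero + (a * D k + b * D (Suc k) + c * D (Suc (Suc k))) \<le>
      all_ones + (a * D k + b * D (Suc k) + c * D (Suc (Suc k)))"
      using M DM by (intro add_mono_mat) auto
    also note D_eq
    finally show "a * D k + b * D (Suc k) + c * D (Suc (Suc k)) \<le> D (Suc k)"
      using M DM by (simp add: left_add_zero_mat[of _ m m])
  qed
  define w where "w n = neumann_sum R n * all_ones" for n
  have wM: "w n \<in> Mat" "Zero \<le> w n" for n
    using RM by (auto simp: w_def intro!: mult_nonneg_mat neumann_sum_nonneg)
  have w_Suc: "w (Suc n) = all_ones + c * (N * w n)" for n
    using RM M ND by (simp add: w_def mat_distrib RN(1))
  (* D exceeds its G-average over the level below by the time spent up to there. Using the bound at
     the level above in D_eq yields the next partial sum, since w (Suc n) = 1 + c N (w n). *)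
  have bound: "N * w n + G * D k \<le> D (Suc k)" for n k
  proof (induction n arbitrary: k)
    case 0
    have "N * w 0 = Zero" using ND RM by (simp add: w_def right_mult_zero_mat[of _ m m] left_mult_zero_mat[of _ m m])
    thus ?case using superharmonic_passage[OF sup, of k] M DM by simp
  next
    case (Suc n)
    have "c * (N * w n + G * D (Suc k)) \<le> c * D (Suc (Suc k))"
      using Suc M ND wM DM by (intro mult_left_mono_mat) auto
    hence le: "(all_ones + (a * D k + b * D (Suc k))) + c * (N * w n + G * D (Suc k))
      \<le> (all_ones + (a * D k + b * D (Suc k))) + c * D (Suc (Suc k))"
      using M ND wM DM by (intro add_mono_mat) auto
    also have "(all_ones + (a * D k + b * D (Suc k))) + c * D (Suc (Suc k)) = D (Suc k)"
      using D_eq[of k] M DM by simp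
    also have "(all_ones + (a * D k + b * D (Suc k))) + c * (N * w n + G * D (Suc k))
      = (w (Suc n) + a * D k) + (b + c * G) * D (Suc k)"
      unfolding w_Suc using M(1-3,7) ND(2) wM(1) DM(1)
      by (intro eq_MatI) (simp_all add: mat_distrib)
    finally have "N * (w (Suc n) + a * D k) \<le> D (Suc k)"
      using M wM DM by (intro neumann_least_left[OF N]) auto
    also have "N * (w (Suc n) + a * D k) = N * w (Suc n) + G * D k"
      using M(1) ND(2) wM(1) DM(1) by (simp add: mat_distrib flip: RN(2))
    finally show ?case .
  qed
  have w_le: "w n \<le> D 1" for n
  proof (rule le_matI)
    fix i l assume il: "i < m" "l < m"
    have "(One + (b + c * G) * N) * w n = N * w n" using ND(4) by simp
    hence "(w n) $$ (i, l) + ((b + c * G) * N * w n) $$ (i, l) = (N * w n) $$ (i, l)"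
      using arg_cong[of "(One + (b + c * G) * N) * w n" "N * w n" "\<lambda>X. X $$ (i, l)"] il ND(1,2) wM(1)
      by (subst (asm) add_mult_distrib_mat[of _ m m _ _ m]) auto
    moreover have "0 \<le> ((b + c * G) * N * w n) $$ (i, l)"
      using il M ND wM by (intro nonneg_matD mult_nonneg_mat add_nonneg_mat) auto
    moreover have "0 \<le> (G * D 0) $$ (i, l)"
      using il M DM by (intro nonneg_matD mult_nonneg_mat) auto
    moreover have "(N * w n) $$ (i, l) + (G * D 0) $$ (i, l) \<le> D 1 $$ (i, l)"
      using le_matD[OF bound[of n 0] _ il] il M ND wM DM by simp
    ultimately show "w n $$ (i, l) \<le> D 1 $$ (i, l)" by linarith
  qed (use wM DM in auto)
  obtain e where e: "\<And>i l. i < m \<Longrightarrow> l < m \<Longrightarrow> D 1 $$ (i, l) \<le> e"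
    using entry_bound[OF DM(1)] by metis
  have ns: "neumann_sum R n $$ (i, l) \<le> e" if il: "i < m" "l < m" for n i l
  proof -
    have nn: "0 \<le> neumann_sum R n $$ (i, q)" if "q < m" for q
      using that il RM by (intro nonneg_matD neumann_sum_nonneg) auto
    have "neumann_sum R n $$ (i, l) \<le> (\<Sum>q<m. neumann_sum R n $$ (i, q))"
      using il nn by (intro member_le_sum) auto
    also have "\<dots> = w n $$ (i, 0)" using il m_pos RM by (simp add: w_def mult_all_ones_entry)
    also have "\<dots> \<le> e" using le_matD[OF w_le[of n] DM(1) il(1) m_pos] e[OF il(1) m_pos] by linarith
    finally show ?thesis .
  qed
  obtain K where K: "mconv (neumann_sum R) K"
    using mono_bounded_mconv[of "neumann_sum R" e] RM neumann_sum_mono ns by (metis neumann_sum_closed)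
  have pow: "neumann_sum R (Suc n) = neumann_sum R n + R ^\<^sub>m n" for n
    using neumann_sum_add[OF RM(1), of n 1] RM by (simp add: right_mult_zero_mat[of _ m m])
  have "\<forall>\<^sub>F n in sequentially. (R ^\<^sub>m n) $$ (i, l) < 1 / (2 * m)" if il: "i < m" "l < m" for i l
  proof -
    have "(\<lambda>n. neumann_sum R (Suc n) $$ (i, l) - neumann_sum R n $$ (i, l)) \<longlonglongrightarrow> K $$ (i, l) - K $$ (i, l)"
      by (intro tendsto_diff LIMSEQ_Suc mconvD(3)[OF K] il)
    moreover have "neumann_sum R (Suc n) $$ (i, l) - neumann_sum R n $$ (i, l) = (R ^\<^sub>m n) $$ (i, l)" for n
      unfolding pow using il RM by simp
    ultimately have "(\<lambda>n. (R ^\<^sub>m n) $$ (i, l)) \<longlonglongrightarrow> 0" by simp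
    thus ?thesis using m_pos by (intro order_tendstoD(2)) auto
  qed
  hence "\<forall>\<^sub>F n in sequentially. \<forall>i\<in>{..<m}. \<forall>l\<in>{..<m}. (R ^\<^sub>m n) $$ (i, l) < 1 / (2 * m)"
    by (intro eventually_ball_finite ballI) auto
  then obtain n where "\<forall>i\<in>{..<m}. \<forall>l\<in>{..<m}. (R ^\<^sub>m n) $$ (i, l) < 1 / (2 * m)"
    by (auto simp: eventually_sequentially)
  thus ?thesis by (intro exI[of _ n]) (auto intro: less_imp_le)
qed

text \<open>A state fails to be null recurrent either by not being recurrent or by having a finite mean return time.\<close>

lemma not_null_recurrent_contraction:
  assumes "\<not> qbd_null_recurrent m B a b c"
    and R: "rate_matrix a b c R" and N: "neumann (b + c * G) N"
  obtains k where "rows_le (1/2) (G ^\<^sub>m k) \<or> (\<forall>i<m. \<forall>l<m. (R ^\<^sub>m k) $$ (i, l) \<le> 1 / (2 * m))"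
proof -
  obtain j where j: "j \<in> S" "\<not> null_recurrent_state S P j"
    using assms(1) by (auto simp: qbd_null_recurrent_def null_recurrent_chain_def)
  show ?thesis
  proof (cases "recurrent_state S P j")
    case True
    hence "summable (\<lambda>n. real n * first_passage S P n j j)"
      using j(2) by (simp add: null_recurrent_state_def)
    thus ?thesis using rate_powers_vanish[OF j(1) True _ R N] that by blast
  next
    case False
    hence "G * all_ones \<noteq> all_ones" using recurrent_of_stochastic_G[OF _ j(1)] by blast
    thus ?thesis using G_powers_contract that by blast
  qed
qed

end

section \<open>Nilpotency, inverses and sums of vectors\<close>

text \<open>All Jordan blocks belong to the eigenvalue 0, and such a block vanishes when raised to a power
  that is at least its size.\<close>

lemma spectral_radius_0_nilpotent:
  assumes A: "A \<in> carrier_mat n n" and sr: "0 < n \<longrightarrow> spectral_radius A = 0"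
  shows "\<exists>k>0. A ^\<^sub>m k = 0\<^sub>m n n"
proof (cases "n = 0")
  case True
  have "A ^\<^sub>m 1 = 0\<^sub>m n n" using A True by (intro eq_matI) auto
  thus ?thesis by blast
next
  case False
  obtain as where "char_poly A = (\<Prod>a\<leftarrow>as. [:- a, 1:])" using char_poly_factorized[OF A] by blast
  then obtain bs where jnf: "jordan_nf A bs" using jordan_nf_exists[OF A] by blast
  obtain P Q where PQ: "P \<in> carrier_mat n n" "Q \<in> carrier_mat n n"
    and cp: "char_poly A = (\<Prod>(na, a)\<leftarrow>bs. [:- a, 1:] ^ na)"
    and pow: "\<And>k. A ^\<^sub>m k = P * (jordan_matrix bs) ^\<^sub>m k * Q"
    using jordan_nf_powE[OF A jnf] by blast
  have zero: "a = 0" if ka: "(k, a) \<in> set bs" for k a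
  proof -
    have "k \<noteq> 0" using jnf ka by (force simp: jordan_nf_def)
    hence "poly (char_poly A) a = 0"
      unfolding cp using ka by (force simp: poly_prod_list prod_list_zero_iff)
    hence "a \<in> spectrum A" using spectrum_root_char_poly[OF A] by auto
    hence "norm a \<le> spectral_radius A" using False by (intro spectral_radius_mem_max(2)[OF A]) auto
    thus "a = 0" using sr False by simp
  qed
  define k where "k = Suc (sum_list (map fst bs))"
  have small: "l < k" if "(l, a) \<in> set bs" for l a
    using member_le_sum_list[of l "map fst bs"] that by (force simp: k_def)
  have "diag_block_mat (map (\<lambda>(l, a). jordan_block l a ^\<^sub>m k) cs)
      = 0\<^sub>m (sum_list (map fst cs)) (sum_list (map fst cs))" if "set cs \<subseteq> set bs" for cs
    using that
  proof (induction cs)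
    case (Cons x cs)
    obtain l a where x: "x = (l, a)" by (cases x)
    have "a = 0" "l < k" using Cons.prems x zero small by auto
    hence "jordan_block l a ^\<^sub>m k = 0\<^sub>m l l"
      unfolding \<open>a = 0\<close> jordan_block_zero_pow by (intro eq_matI) auto
    thus ?case using Cons x by (simp add: Let_def)
  qed simp
  hence "jordan_matrix bs ^\<^sub>m k = 0\<^sub>m (sum_list (map fst bs)) (sum_list (map fst bs))"
    unfolding jordan_matrix_pow by simp
  moreover have "sum_list (map fst bs) = n"
  proof -
    have "similar_mat A (jordan_matrix bs)" using jnf by (simp add: jordan_nf_def)
    from similar_matD[OF this] obtain n' where n': "A \<in> carrier_mat n' n'" "jordan_matrix bs \<in> carrier_mat n' n'"
      by blast
    show ?thesis using carrier_matD(1)[OF n'(1)] carrier_matD(1)[OF n'(2)] carrier_matD(1)[OF A] by simp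
  qed
  ultimately have "A ^\<^sub>m k = P * 0\<^sub>m n n * Q" by (simp add: pow)
  also have "\<dots> = 0\<^sub>m n n" using PQ by simp
  finally show ?thesis by (auto simp: k_def)
qed

lemma mat_inv_eqI:
  assumes "A \<in> carrier_mat n n" "X \<in> carrier_mat n n" "A * X = 1\<^sub>m n" "X * A = 1\<^sub>m n"
  shows "mat_inv A = X"
proof -
  have "A \<in> Units (ring_mat TYPE('a) n ())"
    using assms by (auto simp: Units_def ring_mat_def)
  then obtain Y where Y: "mat_inverse A = Some Y"
    using mat_inverse(1)[OF assms(1), where b = "()"] by (cases "mat_inverse A") auto
  have YD: "A * Y = 1\<^sub>m n" "Y * A = 1\<^sub>m n" "Y \<in> carrier_mat n n"
    using mat_inverse(2)[OF assms(1) Y] by auto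
  have "Y = Y * (A * X)" using YD assms by simp
  also have "\<dots> = (Y * A) * X" using YD assms by (intro assoc_mult_mat[symmetric])
  also have "\<dots> = X" using YD assms by simp
  finally show ?thesis by (simp add: mat_inv_def Y)
qed

lemma mat_inv_invertible:
  assumes A: "A \<in> carrier_mat n n" and inv: "invertible_mat A"
  shows "mat_inv A \<in> carrier_mat n n" "A * mat_inv A = 1\<^sub>m n" "mat_inv A * A = 1\<^sub>m n"
proof -
  obtain X where X: "A * X = 1\<^sub>m (dim_row A)" "X * A = 1\<^sub>m (dim_row X)"
    using inv by (auto simp: invertible_mat_def inverts_mat_def)
  have "dim_col X = n" using A arg_cong[OF X(1), of dim_col] by simp
  moreover have "dim_row X = n" using A arg_cong[OF X(2), of dim_col] by simp
  ultimately have XC: "X \<in> carrier_mat n n" by auto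
  have "mat_inv A = X" using A XC X by (intro mat_inv_eqI) auto
  thus "mat_inv A \<in> carrier_mat n n" "A * mat_inv A = 1\<^sub>m n" "mat_inv A * A = 1\<^sub>m n"
    using A XC X by auto
qed

lemma mult_vsum:
  assumes "A \<in> carrier_mat m m" "finite I" "\<And>k. k \<in> I \<Longrightarrow> f k \<in> carrier_vec m"
  shows "A *\<^sub>v vsum m f I = vsum m (\<lambda>k. A *\<^sub>v f k) I"
  using assms(2,3)
proof (induction I)
  case empty
  have "A *\<^sub>v 0\<^sub>v m = 0\<^sub>v m" using assms(1) by (intro eq_vecI) auto
  thus ?case by (simp add: finsum_vec_empty)
next
  case (insert x I)
  have c: "f \<in> I \<rightarrow> carrier_vec m" "f x \<in> carrier_vec m"
    "(\<lambda>k. A *\<^sub>v f k) \<in> I \<rightarrow> carrier_vec m" "A *\<^sub>v f x \<in> carrier_vec m"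
    using insert.prems assms(1) by auto
  show ?case
    unfolding finsum_vec_insert[OF insert.hyps c(1,2)] finsum_vec_insert[OF insert.hyps c(3,4)]
    using mult_add_distrib_mat_vec[OF assms(1) c(2) finsum_vec_closed[OF c(1)]] insert.IH c insert.prems
    by simp
qed

lemma vsum_carrier [simp]: "(\<And>k. k \<in> I \<Longrightarrow> f k \<in> carrier_vec m) \<Longrightarrow> vsum m f I \<in> carrier_vec m"
  by (intro finsum_vec_closed) auto

lemma vsum_index:
  "finite I \<Longrightarrow> i < m \<Longrightarrow> (\<And>k. k \<in> I \<Longrightarrow> f k \<in> carrier_vec m) \<Longrightarrow> vsum m f I $ i = (\<Sum>k\<in>I. f k $ i)"
  by (intro index_finsum_vec) auto

lemma mult_vsum_index:
  assumes A: "A \<in> carrier_mat m m" and I: "finite I" and i: "i < m"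
    and f: "\<And>k. k \<in> I \<Longrightarrow> f k \<in> carrier_vec m"
  shows "(A *\<^sub>v vsum m f I) $ i = (\<Sum>k\<in>I. (A *\<^sub>v f k) $ i)"
proof -
  have "A *\<^sub>v vsum m f I = vsum m (\<lambda>k. A *\<^sub>v f k) I"
    by (rule mult_vsum[OF A I]) (rule f)
  moreover have "vsum m (\<lambda>k. A *\<^sub>v f k) I $ i = (\<Sum>k\<in>I. (A *\<^sub>v f k) $ i)"
    using A f by (intro vsum_index[OF I i]) auto
  ultimately show ?thesis by simp
qed

lemma vsum_cong:
  assumes "finite I" "\<And>k. k \<in> I \<Longrightarrow> f k = f' k" "\<And>k. k \<in> I \<Longrightarrow> f' k \<in> carrier_vec m"
  shows "vsum m f I = vsum m f' I"
proof (rule eq_vecI)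
  have f: "f k \<in> carrier_vec m" if "k \<in> I" for k using assms that by simp
  show "dim_vec (vsum m f I) = dim_vec (vsum m f' I)"
    using carrier_vecD[OF vsum_carrier[OF f]] carrier_vecD[OF vsum_carrier[OF assms(3)]] by simp
  fix i assume "i < dim_vec (vsum m f' I)"
  hence "i < m" using carrier_vecD[OF vsum_carrier[OF assms(3)]] by simp
  thus "vsum m f I $ i = vsum m f' I $ i"
    using assms f by (simp add: vsum_index)
qed

section \<open>The difference equation\<close>

text \<open>Linear consequences over the complex numbers, with variables for entries of vectors. They are
  split into real and imaginary parts, where linear arithmetic applies.\<close>

lemma lin_green:
  fixes t X A y b c :: complex
  shows "t - X = y \<Longrightarrow> A = - X \<Longrightarrow> b + c = t \<Longrightarrow> A + b + c = y"
  by (auto simp: algebra_simps)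

lemma lin_factor:
  fixes A B C P Q D Qg S :: complex
  shows "A + B + C = 0 \<Longrightarrow> A = - P \<Longrightarrow> C = - Q \<Longrightarrow> B + D = S \<Longrightarrow> D = - Qg \<Longrightarrow> S - P = Q - Qg"
  by (auto simp: complex_eq_iff)

lemma lin_split:
  fixes P Q Hh B' C' B C L R' :: complex
  shows "P + Q = Hh \<Longrightarrow> B' = B + P \<Longrightarrow> C' + Q = C \<Longrightarrow> L = B - C \<Longrightarrow> R' = B' - C' - Hh \<Longrightarrow> L = R'"
  by (auto simp: complex_eq_iff)

lemma lin_solution:
  fixes A1 A2 A3 B1 B2 B3 C1 C2 C3 g L1 L2 L3 L h :: complex
  shows "L1 = A1 - C1 - A2 \<Longrightarrow> L2 = A3 - (B1 + C2) \<Longrightarrow> L3 = B2 - B3 - C3 \<Longrightarrow>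
    A2 + B1 + B3 = 0 \<Longrightarrow> A1 + A3 + B2 = 0 \<Longrightarrow> C1 + C2 + C3 = g \<Longrightarrow> h = - g \<Longrightarrow>
    L = L1 + L2 + L3 \<Longrightarrow> L = h"
  by (auto simp: complex_eq_iff)

text \<open>The coefficients \<open>b\<close> and \<open>T\<close> are \<open>A\<^sub>0 - I\<close> and \<open>U - I\<close>, and \<open>N\<close> is the inverse of \<open>T\<close>. The decomposition of \<open>Gh\<close>
  into an invertible and a nilpotent part enters through the square matrices \<open>Lp k = L V\<^sub>1\<^sup>-\<^sup>k E\<close> and
  \<open>Kq k = K V\<^sub>0\<^sup>k F\<close>: multiplication by \<open>Gh\<close> lowers the index of the former and raises that of the
  latter.\<close>

locale recurrence_split =
  fixes m \<nu> :: nat and a b c T N G Gh R W :: "complex mat" and Lp Kq :: "nat \<Rightarrow> complex mat"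
  assumes carriers: "a \<in> carrier_mat m m" "b \<in> carrier_mat m m" "c \<in> carrier_mat m m"
      "T \<in> carrier_mat m m" "N \<in> carrier_mat m m" "G \<in> carrier_mat m m"
      "Gh \<in> carrier_mat m m" "R \<in> carrier_mat m m" "W \<in> carrier_mat m m"
      "\<And>k. Lp k \<in> carrier_mat m m" "\<And>k. Kq k \<in> carrier_mat m m"
    and factor: "a + T * G = 0\<^sub>m m m" "c + R * T = 0\<^sub>m m m" "b + c * G = T"
    and TN: "T * N = 1\<^sub>m m" "N * T = 1\<^sub>m m"
    and W_eq: "W - G * (W * R) = N" "W * R = Gh * W"
    and Gh_eq: "c + b * Gh + a * (Gh * Gh) = 0\<^sub>m m m"
    and split: "Lp 0 + Kq 0 = 1\<^sub>m m"
    and Gh_Lp: "\<And>k. Gh * Lp (Suc k) = Lp k" and Lp_Gh: "\<And>k. Lp (Suc k) * Gh = Lp k"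
    and Gh_Kq: "\<And>k. Gh * Kq k = Kq (Suc k)" and Kq_Gh: "\<And>k. Kq k * Gh = Kq (Suc k)"
    and \<nu>: "0 < \<nu>" "Kq \<nu> = 0\<^sub>m m m"
begin

declare index_mult_mat_vec [simp del] assoc_mult_mat [simp del] mult_carrier_mat [simp del] assoc_mult_mat_vec [simp del]
  mult_mat_vec_carrier [simp del] row_mult [simp del] col_mult [simp del] assoc_add_vec [simp del]

lemma mm_closed [simp]: "A \<in> carrier_mat m m \<Longrightarrow> B \<in> carrier_mat m m \<Longrightarrow> A * B \<in> carrier_mat m m"
  by (rule mult_carrier_mat)

declare minus_carrier_mat [simp]

abbreviation V :: "complex vec set" where "V \<equiv> carrier_vec m"

lemma mv_closed [simp]: "A \<in> carrier_mat m m \<Longrightarrow> x \<in> V \<Longrightarrow> A *\<^sub>v x \<in> V"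
  by (rule mult_mat_vec_carrier)

lemmas vec_distrib = assoc_mult_mat_vec[of _ m m _ m]
  add_mult_distrib_mat_vec[of _ m m] mult_add_distrib_mat_vec[of _ m m]
  minus_mult_distrib_mat_vec[of _ m m] mult_minus_distrib_mat_vec[of _ m m]

lemma eq_VI: "x \<in> V \<Longrightarrow> y \<in> V \<Longrightarrow> (\<And>i. i < m \<Longrightarrow> x $ i = y $ i) \<Longrightarrow> x = y"
  by (intro eq_vecI) auto

lemma vec_add_entry [simp]: "x \<in> V \<Longrightarrow> y \<in> V \<Longrightarrow> i < m \<Longrightarrow> (x + y) $ i = x $ i + y $ i"
  by simp

lemma vec_minus_entry [simp]: "x \<in> V \<Longrightarrow> y \<in> V \<Longrightarrow> i < m \<Longrightarrow> (x - y) $ i = x $ i - y $ i"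
  by simp

lemma apply_zero: "x \<in> V \<Longrightarrow> i < m \<Longrightarrow> (0\<^sub>m m m *\<^sub>v x) $ i = 0"
  by (simp add: index_mult_mat_vec)

definition solves :: "(nat \<Rightarrow> complex vec) \<Rightarrow> (nat \<Rightarrow> complex vec) \<Rightarrow> bool" where
  "solves g u \<longleftrightarrow> (\<forall>r. u r \<in> V) \<and>
     (\<forall>r. a *\<^sub>v u r + b *\<^sub>v u (r + 1) + c *\<^sub>v u (r + 2) = - g (r + 1))"

context
  fixes x :: "complex vec" and i :: nat
  assumes x: "x \<in> V" and i: "i < m"
begin

lemma vec_factor:
  "(a *\<^sub>v x) $ i = - (T *\<^sub>v (G *\<^sub>v x)) $ i"
  "(c *\<^sub>v x) $ i = - (R *\<^sub>v (T *\<^sub>v x)) $ i"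
  "(b *\<^sub>v x) $ i + (c *\<^sub>v (G *\<^sub>v x)) $ i = (T *\<^sub>v x) $ i"
proof -
  have "((a + T * G) *\<^sub>v x) $ i = 0" "((c + R * T) *\<^sub>v x) $ i = 0"
    unfolding factor using x i by (auto simp: apply_zero)
  thus "(a *\<^sub>v x) $ i = - (T *\<^sub>v (G *\<^sub>v x)) $ i" "(c *\<^sub>v x) $ i = - (R *\<^sub>v (T *\<^sub>v x)) $ i"
    using x i carriers by (auto simp: vec_distrib add_eq_0_iff)
  have "((b + c * G) *\<^sub>v x) $ i = (T *\<^sub>v x) $ i" by (simp add: factor)
  thus "(b *\<^sub>v x) $ i + (c *\<^sub>v (G *\<^sub>v x)) $ i = (T *\<^sub>v x) $ i"
    using x i carriers by (simp add: vec_distrib)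
qed

lemma vec_G: "(a *\<^sub>v x) $ i + (b *\<^sub>v (G *\<^sub>v x)) $ i + (c *\<^sub>v (G *\<^sub>v (G *\<^sub>v x))) $ i = 0"
proof -
  have "((a + (b + c * G) * G) *\<^sub>v x) $ i = 0" unfolding factor using x i by (simp add: apply_zero)
  thus ?thesis using x i carriers by (simp add: vec_distrib add.assoc)
qed

lemma vec_Gh: "(a *\<^sub>v (Gh *\<^sub>v (Gh *\<^sub>v x))) $ i + (b *\<^sub>v (Gh *\<^sub>v x)) $ i + (c *\<^sub>v x) $ i = 0"
proof -
  have "((c + b * Gh + a * (Gh * Gh)) *\<^sub>v x) $ i = 0" unfolding Gh_eq using x i by (simp add: apply_zero)
  thus ?thesis using x i carriers by (simp add: vec_distrib algebra_simps)
qed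

lemma vec_green: "(a *\<^sub>v (Gh *\<^sub>v (W *\<^sub>v x))) $ i + (b *\<^sub>v (W *\<^sub>v x)) $ i + (c *\<^sub>v (G *\<^sub>v (W *\<^sub>v x))) $ i = x $ i"
proof -
  have "((T * (W - G * (W * R))) *\<^sub>v x) $ i = x $ i"
    using x i carriers TN W_eq(1) by simp
  hence "(T *\<^sub>v (W *\<^sub>v x)) $ i - (T *\<^sub>v (G *\<^sub>v (Gh *\<^sub>v (W *\<^sub>v x)))) $ i = x $ i"
    unfolding W_eq(2) using x i carriers by (simp add: vec_distrib)
  moreover have "(a *\<^sub>v (Gh *\<^sub>v (W *\<^sub>v x))) $ i = - (T *\<^sub>v (G *\<^sub>v (Gh *\<^sub>v (W *\<^sub>v x)))) $ i"
  proof -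
    have "((a + T * G) *\<^sub>v (Gh *\<^sub>v (W *\<^sub>v x))) $ i = 0"
      unfolding factor using x i carriers by (auto simp: apply_zero)
    thus ?thesis using x i carriers by (auto simp: vec_distrib add_eq_0_iff)
  qed
  moreover have "((b + c * G) *\<^sub>v (W *\<^sub>v x)) $ i = (T *\<^sub>v (W *\<^sub>v x)) $ i" by (simp add: factor)
  hence "(b *\<^sub>v (W *\<^sub>v x)) $ i + (c *\<^sub>v (G *\<^sub>v (W *\<^sub>v x))) $ i = (T *\<^sub>v (W *\<^sub>v x)) $ i"
    using x i carriers by (simp add: vec_distrib)
  ultimately show ?thesis by (rule lin_green)
qed

end

text \<open>The forward sequence \<open>\<alpha>\<close> contributes \<open>- (b W + c G W) g\<^sub>r\<^sub>+\<^sub>1 - c W g\<^sub>r\<^sub>+\<^sub>2\<close> to the left-hand side of the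
  equation, the backward sequence \<open>\<rho>\<close> contributes \<open>- a Gh W g\<^sub>r\<^sub>+\<^sub>1 + c W g\<^sub>r\<^sub>+\<^sub>2\<close>, and
  \<open>a Gh W + b W + c G W = I\<close> by \<open>vec_green\<close>.\<close>

lemma solution_of_split:
  assumes V: "\<And>r. \<alpha> r \<in> V" "\<And>r. \<rho> r \<in> V" "\<And>r. g (Suc r) \<in> V"
    and \<alpha>: "\<And>r. \<alpha> (Suc r) = G *\<^sub>v \<alpha> r + W *\<^sub>v g (Suc r)"
    and \<rho>: "\<And>r. \<rho> r = Gh *\<^sub>v (\<rho> (Suc r) - W *\<^sub>v g (Suc r))"
  shows "solves g (\<lambda>r. \<rho> r - \<alpha> r)"
  unfolding solves_def
proof (intro conjI allI)
  fix r
  show "\<rho> r - \<alpha> r \<in> V" using V by simp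
  define y where "y = W *\<^sub>v g (Suc r)"
  define z where "z = W *\<^sub>v g (Suc (Suc r))"
  define e where "e = \<rho> (Suc (Suc r)) - z"
  have yV: "y \<in> V" "z \<in> V" "e \<in> V" using V carriers by (auto simp: y_def z_def e_def)
  have \<rho>2: "\<rho> (Suc (Suc r)) = e + z" using V yV by (intro eq_VI) (auto simp: e_def)
  have \<rho>1: "\<rho> (Suc r) = Gh *\<^sub>v e" using \<rho>[of "Suc r"] by (simp add: e_def z_def)
  have \<rho>0: "\<rho> r = Gh *\<^sub>v (Gh *\<^sub>v e - y)" using \<rho>[of r] by (simp add: y_def \<rho>1)
  have \<alpha>1: "\<alpha> (Suc r) = G *\<^sub>v \<alpha> r + y" using \<alpha>[of r] by (simp add: y_def)
  have \<alpha>2: "\<alpha> (Suc (Suc r)) = G *\<^sub>v (G *\<^sub>v \<alpha> r + y) + z" using \<alpha>[of "Suc r"] by (simp add: z_def \<alpha>1)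
  have "a *\<^sub>v (Gh *\<^sub>v (Gh *\<^sub>v e - y) - \<alpha> r) + b *\<^sub>v (Gh *\<^sub>v e - (G *\<^sub>v \<alpha> r + y))
    + c *\<^sub>v ((e + z) - (G *\<^sub>v (G *\<^sub>v \<alpha> r + y) + z)) = - g (Suc r)"
  proof (rule eq_VI)
    fix i assume i: "i < m"
    note * = carriers V(1)[of r] yV i
    have "(a *\<^sub>v (Gh *\<^sub>v (Gh *\<^sub>v e - y) - \<alpha> r)) $ i
        = (a *\<^sub>v (Gh *\<^sub>v (Gh *\<^sub>v e))) $ i - (a *\<^sub>v (Gh *\<^sub>v y)) $ i - (a *\<^sub>v \<alpha> r) $ i"
      "(b *\<^sub>v (Gh *\<^sub>v e - (G *\<^sub>v \<alpha> r + y))) $ i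
        = (b *\<^sub>v (Gh *\<^sub>v e)) $ i - ((b *\<^sub>v (G *\<^sub>v \<alpha> r)) $ i + (b *\<^sub>v y) $ i)"
      "(c *\<^sub>v ((e + z) - (G *\<^sub>v (G *\<^sub>v \<alpha> r + y) + z))) $ i
        = (c *\<^sub>v e) $ i - (c *\<^sub>v (G *\<^sub>v (G *\<^sub>v \<alpha> r))) $ i - (c *\<^sub>v (G *\<^sub>v y)) $ i"
      using * by (simp_all add: vec_distrib)
    moreover note vec_G[OF V(1)[of r] i] vec_Gh[OF yV(3) i] vec_green[OF V(3)[of r] i, folded y_def]
    moreover have "(- g (Suc r)) $ i = - (g (Suc r) $ i)" using i V(3)[of r] by simp
    moreover have "(a *\<^sub>v (Gh *\<^sub>v (Gh *\<^sub>v e - y) - \<alpha> r) + b *\<^sub>v (Gh *\<^sub>v e - (G *\<^sub>v \<alpha> r + y))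
        + c *\<^sub>v ((e + z) - (G *\<^sub>v (G *\<^sub>v \<alpha> r + y) + z))) $ i
      = (a *\<^sub>v (Gh *\<^sub>v (Gh *\<^sub>v e - y) - \<alpha> r)) $ i + (b *\<^sub>v (Gh *\<^sub>v e - (G *\<^sub>v \<alpha> r + y))) $ i
        + (c *\<^sub>v ((e + z) - (G *\<^sub>v (G *\<^sub>v \<alpha> r + y) + z))) $ i"
      using * by (subst vec_add_entry, simp_all)+
    ultimately show "(a *\<^sub>v (Gh *\<^sub>v (Gh *\<^sub>v e - y) - \<alpha> r) + b *\<^sub>v (Gh *\<^sub>v e - (G *\<^sub>v \<alpha> r + y))
        + c *\<^sub>v ((e + z) - (G *\<^sub>v (G *\<^sub>v \<alpha> r + y) + z))) $ i = (- g (Suc r)) $ i"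
      by (rule lin_solution)
  qed (use carriers V yV in auto)
  thus "a *\<^sub>v (\<rho> r - \<alpha> r) + b *\<^sub>v (\<rho> (r + 1) - \<alpha> (r + 1)) + c *\<^sub>v (\<rho> (r + 2) - \<alpha> (r + 2)) = - g (r + 1)"
    by (simp add: \<rho>0 \<rho>1 \<rho>2 \<alpha>1 \<alpha>2)
qed

text \<open>The factorisation turns the equation into the recurrence \<open>v\<^sub>r = R v\<^sub>r\<^sub>+\<^sub>1\<close>, and \<open>W\<close> turns \<open>R\<close> into \<open>Gh\<close>.\<close>

lemma homogeneous_solution:
  assumes u: "solves (\<lambda>_. 0\<^sub>v m) u"
  obtains x w where "x \<in> V" "w \<in> V" "\<And>r. u r = G ^\<^sub>m r *\<^sub>v x + Gh *\<^sub>v (Lp r *\<^sub>v w)"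
proof -
  have uV: "u r \<in> V" and ueq: "a *\<^sub>v u r + b *\<^sub>v u (Suc r) + c *\<^sub>v u (Suc (Suc r)) = 0\<^sub>v m" for r
    using u by (auto simp: solves_def)
  define v where "v r = T *\<^sub>v (u (Suc r) - G *\<^sub>v u r)" for r
  have vV: "v r \<in> V" for r using uV carriers by (simp add: v_def)
  have v_eq: "v r = R *\<^sub>v v (Suc r)" for r
  proof (rule eq_VI)
    fix i assume i: "i < m"
    have e: "(a *\<^sub>v u r) $ i + (b *\<^sub>v u (Suc r)) $ i + (c *\<^sub>v u (Suc (Suc r))) $ i = 0"
      using arg_cong[OF ueq, of "\<lambda>x. x $ i"] i uV carriers by simp
    from lin_factor[OF e vec_factor(1)[OF uV[of r] i] vec_factor(2)[OF uV[of "Suc (Suc r)"] i]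
        vec_factor(3)[OF uV[of "Suc r"] i] vec_factor(2)[OF mv_closed[OF carriers(6) uV[of "Suc r"]] i]]
    show "v r $ i = (R *\<^sub>v v (Suc r)) $ i"
      using carriers uV i by (simp add: v_def vec_distrib)
  qed (use vV carriers in auto)
  define w where "w r = W *\<^sub>v v r" for r
  have wV: "w r \<in> V" for r using vV carriers by (simp add: w_def)
  have w_eq: "w r = Gh *\<^sub>v w (Suc r)" for r
  proof -
    have "w r = (W * R) *\<^sub>v v (Suc r)"
      using v_eq[of r] vV carriers by (simp add: w_def vec_distrib)
    thus ?thesis unfolding W_eq(2) using vV carriers by (simp add: w_def vec_distrib)
  qed
  have u_eq: "u (Suc r) - G *\<^sub>v u r = w r - G *\<^sub>v (Gh *\<^sub>v w r)" for r
  proof -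
    have "u (Suc r) - G *\<^sub>v u r = (N * T) *\<^sub>v (u (Suc r) - G *\<^sub>v u r)"
      unfolding TN using uV carriers by simp
    also have "\<dots> = N *\<^sub>v v r" using uV carriers by (simp add: v_def vec_distrib(1))
    also have "\<dots> = (W - G * (W * R)) *\<^sub>v v r" by (simp add: W_eq(1))
    also have "\<dots> = w r - G *\<^sub>v (Gh *\<^sub>v w r)"
      unfolding W_eq(2) using vV carriers by (simp add: w_def vec_distrib)
    finally show ?thesis .
  qed
  have Kw: "Kq l *\<^sub>v w r = Kq (l + k) *\<^sub>v w (r + k)" for l r k
  proof (induction k)
    case (Suc k)
    have "Kq (l + k) *\<^sub>v w (r + k) = (Kq (l + k) * Gh) *\<^sub>v w (Suc (r + k))"
      using w_eq[of "r + k"] wV carriers by (simp add: vec_distrib)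
    thus ?case using Suc by (simp add: Kq_Gh)
  qed simp
  have Lw: "Lp r *\<^sub>v w 0 = Lp 0 *\<^sub>v w r" for r
  proof -
    have "Lp r *\<^sub>v w 0 = Lp (r - k) *\<^sub>v w k" if "k \<le> r" for k
      using that
    proof (induction k)
      case (Suc k)
      have "Lp (r - k) *\<^sub>v w k = (Lp (Suc (r - Suc k)) * Gh) *\<^sub>v w (Suc k)"
        using w_eq[of k] wV carriers Suc.prems by (simp add: vec_distrib Suc_diff_Suc)
      thus ?case using Suc by (simp add: Lp_Gh)
    qed simp
    from this[of r] show ?thesis by simp
  qed
  have w_r: "w r = Lp r *\<^sub>v w 0" for r
  proof -
    (* Shifting by \<nu> steps: Kq 0 (w r) = Kq \<nu> (w (r + \<nu>)). *)
    have "Kq 0 *\<^sub>v w r = 0\<^sub>v m"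
      using Kw[of 0 r \<nu>] wV \<nu>(2) by (intro eq_VI) (auto simp: apply_zero carriers)
    moreover have "(Lp 0 + Kq 0) *\<^sub>v w r = Lp 0 *\<^sub>v w r + Kq 0 *\<^sub>v w r"
      using wV carriers by (simp add: vec_distrib)
    moreover have "(Lp 0 + Kq 0) *\<^sub>v w r = w r" unfolding split using wV by simp
    moreover have "Lp 0 *\<^sub>v w r \<in> V" using wV carriers by simp
    ultimately have "w r = Lp 0 *\<^sub>v w r" by simp
    thus ?thesis by (simp only: Lw)
  qed
  define x where "x = u 0 - Gh *\<^sub>v w 0"
  have xV: "x \<in> V" using uV wV carriers by (simp add: x_def)
  have "u r = G ^\<^sub>m r *\<^sub>v x + Gh *\<^sub>v w r" for r
  proof (induction r)
    case 0
    show ?case using uV wV carriers by (intro eq_VI) (auto simp: x_def vec_distrib)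
  next
    case (Suc r)
    have GS: "G ^\<^sub>m Suc r *\<^sub>v x = G *\<^sub>v (G ^\<^sub>m r *\<^sub>v x)"
      unfolding pow_mat_Suc_left[OF carriers(6)] using carriers xV by (simp add: vec_distrib)
    have Gx: "G ^\<^sub>m r *\<^sub>v x \<in> V" using carriers xV by simp
    show ?case
    proof (rule eq_VI)
      fix i assume i: "i < m"
      have "(u (Suc r) - G *\<^sub>v u r) $ i = (w r - G *\<^sub>v (Gh *\<^sub>v w r)) $ i" by (simp only: u_eq)
      hence "u (Suc r) $ i = (w r) $ i + (G *\<^sub>v (G ^\<^sub>m r *\<^sub>v x)) $ i"
        using i uV wV carriers Gx Suc by (simp add: vec_distrib diff_eq_eq)
      thus "u (Suc r) $ i = (G ^\<^sub>m Suc r *\<^sub>v x + Gh *\<^sub>v w (Suc r)) $ i"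
        unfolding GS w_eq[of r, symmetric] using i wV carriers Gx by simp
    qed (use uV xV wV carriers in auto)
  qed
  thus ?thesis using that[OF xV wV[of 0]] w_r by metis
qed

lemma solves_diff:
  assumes u: "solves g u" and v: "solves g v"
  shows "solves (\<lambda>_. 0\<^sub>v m) (\<lambda>r. u r - v r)"
  unfolding solves_def
proof (intro conjI allI)
  have uV: "u r \<in> V" "v r \<in> V" for r using u v by (auto simp: solves_def)
  show "u r - v r \<in> V" for r using uV by simp
  fix r
  have eq: "a *\<^sub>v u r + b *\<^sub>v u (r + 1) + c *\<^sub>v u (r + 2) = a *\<^sub>v v r + b *\<^sub>v v (r + 1) + c *\<^sub>v v (r + 2)"
    using u v by (simp add: solves_def)
  show "a *\<^sub>v (u r - v r) + b *\<^sub>v (u (r + 1) - v (r + 1)) + c *\<^sub>v (u (r + 2) - v (r + 2)) = - 0\<^sub>v m"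
  proof (rule eq_VI)
    fix i assume i: "i < m"
    have "(a *\<^sub>v u r + b *\<^sub>v u (r + 1) + c *\<^sub>v u (r + 2)) $ i
      = (a *\<^sub>v v r + b *\<^sub>v v (r + 1) + c *\<^sub>v v (r + 2)) $ i" by (simp only: eq)
    thus "(a *\<^sub>v (u r - v r) + b *\<^sub>v (u (r + 1) - v (r + 1)) + c *\<^sub>v (u (r + 2) - v (r + 2))) $ i
      = (- 0\<^sub>v m) $ i"
      using i uV carriers by (simp add: vec_distrib algebra_simps)
  qed (use uV carriers in auto)
qed

lemma shift_sum:
  fixes f :: "nat \<Rightarrow> complex"
  shows "(\<Sum>j\<in>{1..n}. f (Suc j)) + f 1 = (\<Sum>j\<in>{1..n}. f j) + f (Suc n)"
  by (induction n) auto

text \<open>The first sum of \<open>\<sigma>\<close> is \<open>\<alpha> - \<beta>\<close> with \<open>\<alpha>\<close> built from powers of \<open>G\<close> and \<open>\<beta>\<close> from \<open>Lp\<close>; the second one is \<open>\<gamma>\<close>, built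
  from \<open>Kq\<close>. The backward recurrence holds for \<open>\<rho> = \<beta> - \<gamma>\<close>: applying \<open>Gh\<close> shifts the indices, the two
  boundary terms at \<open>g\<^sub>r\<^sub>+\<^sub>1\<close> combine by \<open>Lp 0 + Kq 0 = I\<close>, and the term with \<open>Kq \<nu>\<close> vanishes. Adding
  \<open>G\<^sup>r x\<close> to \<open>- \<alpha>\<close> and a solution \<open>t\<close> of \<open>t\<^sub>r = Gh t\<^sub>r\<^sub>+\<^sub>1\<close> to \<open>\<rho>\<close> preserves both recurrences, which gives
  the whole family of solutions at once.\<close>

lemma particular_solution:
  assumes g: "\<And>r. 1 \<le> r \<Longrightarrow> g r \<in> V"
    and \<sigma>: "\<And>r. \<sigma> r =
      - vsum m (\<lambda>k. ((G ^\<^sub>m (r - k) - Lp (r - k)) * W) *\<^sub>v g k) {1..r}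
      - vsum m (\<lambda>j. (Kq j * W) *\<^sub>v g (j + r)) {1..\<nu> - 1}"
    and x: "x \<in> V" and t: "\<And>r. t r \<in> V" "\<And>r. t r = Gh *\<^sub>v t (Suc r)"
  shows "solves g (\<lambda>r. G ^\<^sub>m r *\<^sub>v x + t r + \<sigma> r)" "\<And>r. \<sigma> r \<in> V"
proof -
  define h where "h k = W *\<^sub>v g k" for k
  have hV: "h k \<in> V" if "1 \<le> k" for k using g[OF that] carriers by (simp add: h_def)
  define \<alpha> where "\<alpha> r = vsum m (\<lambda>k. G ^\<^sub>m (r - k) *\<^sub>v h k) {1..r}" for r
  define \<beta> where "\<beta> r = vsum m (\<lambda>k. Lp (r - k) *\<^sub>v h k) {1..r}" for r
  define \<gamma> where "\<gamma> r = vsum m (\<lambda>j. Kq j *\<^sub>v h (j + r)) {1..\<nu> - 1}" for r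
  have V: "\<alpha> r \<in> V" "\<beta> r \<in> V" "\<gamma> r \<in> V" for r
    using hV carriers by (auto simp: \<alpha>_def \<beta>_def \<gamma>_def intro!: vsum_carrier)
  have s1: "(\<Sum>k\<in>{1..r}. (((G ^\<^sub>m (r - k) - Lp (r - k)) * W) *\<^sub>v g k) $ i) = \<alpha> r $ i - \<beta> r $ i"
    if i: "i < m" for r i
  proof -
    have "(((G ^\<^sub>m (r - k) - Lp (r - k)) * W) *\<^sub>v g k) $ i
        = (G ^\<^sub>m (r - k) *\<^sub>v h k) $ i - (Lp (r - k) *\<^sub>v h k) $ i" if "k \<in> {1..r}" for k
      using that i g carriers by (simp add: h_def vec_distrib minus_carrier_mat)
    moreover have "\<alpha> r $ i = (\<Sum>k\<in>{1..r}. (G ^\<^sub>m (r - k) *\<^sub>v h k) $ i)"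
      unfolding \<alpha>_def using i hV carriers by (subst vsum_index) auto
    moreover have "\<beta> r $ i = (\<Sum>k\<in>{1..r}. (Lp (r - k) *\<^sub>v h k) $ i)"
      unfolding \<beta>_def using i hV carriers by (subst vsum_index) auto
    ultimately show ?thesis by (simp add: sum_subtractf)
  qed
  have c1: "((G ^\<^sub>m (r - k) - Lp (r - k)) * W) *\<^sub>v g k \<in> V" if "1 \<le> k" for r k
    using g[OF that] carriers
    by (intro mv_closed mult_carrier_mat[of _ m m] minus_carrier_mat) auto
  have c2: "(Kq j * W) *\<^sub>v g (j + r) \<in> V" if "1 \<le> j" for r j
    using g[of "j + r"] that carriers by (intro mv_closed mult_carrier_mat[of _ m m]) auto
  show \<sigma>V: "\<sigma> r \<in> V" for r
    unfolding \<sigma> using c1 c2 by (auto intro!: minus_carrier_vec vsum_carrier)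
  have \<sigma>_eq: "\<sigma> r = (\<beta> r - \<gamma> r) - \<alpha> r" for r
  proof (rule eq_VI)
    fix i assume i: "i < m"
    have "vsum m (\<lambda>j. (Kq j * W) *\<^sub>v g (j + r)) {1..\<nu> - 1} = \<gamma> r"
      unfolding \<gamma>_def using hV g carriers
      by (intro vsum_cong) (auto simp: h_def vec_distrib)
    moreover have "vsum m (\<lambda>k. ((G ^\<^sub>m (r - k) - Lp (r - k)) * W) *\<^sub>v g k) {1..r} $ i = \<alpha> r $ i - \<beta> r $ i"
      by (subst vsum_index[OF _ i]) (use c1 s1[OF i] in \<open>simp_all del: One_nat_def\<close>)
    moreover have "vsum m (\<lambda>k. ((G ^\<^sub>m (r - k) - Lp (r - k)) * W) *\<^sub>v g k) {1..r} \<in> V"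
      using c1 by (intro vsum_carrier) auto
    ultimately show "\<sigma> r $ i = ((\<beta> r - \<gamma> r) - \<alpha> r) $ i"
      unfolding \<sigma> using i V by simp
  qed (use \<sigma>V V in auto)

  have GS: "G ^\<^sub>m Suc k *\<^sub>v y = G *\<^sub>v (G ^\<^sub>m k *\<^sub>v y)" if "y \<in> V" for k y
    unfolding pow_mat_Suc_left[OF carriers(6)] using carriers that by (simp add: vec_distrib)
  have ivl: "{1..Suc r} = insert (Suc r) {1..r}" for r by auto
  have \<alpha>_Suc: "\<alpha> (Suc r) = G *\<^sub>v \<alpha> r + h (Suc r)" for r
  proof (rule eq_VI)
    fix i assume i: "i < m"
    have "\<alpha> (Suc r) $ i = (\<Sum>k\<in>{1..r}. (G ^\<^sub>m (Suc r - k) *\<^sub>v h k) $ i) + h (Suc r) $ i"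
      unfolding \<alpha>_def using i hV carriers by (subst vsum_index) (auto simp: ivl)
    also have "(\<Sum>k\<in>{1..r}. (G ^\<^sub>m (Suc r - k) *\<^sub>v h k) $ i) = (\<Sum>k\<in>{1..r}. (G *\<^sub>v (G ^\<^sub>m (r - k) *\<^sub>v h k)) $ i)"
      using hV by (intro sum.cong) (auto simp: Suc_diff_le GS simp del: pow_mat.simps)
    also have "\<dots> = (G *\<^sub>v \<alpha> r) $ i"
      unfolding \<alpha>_def using i hV carriers by (subst mult_vsum_index) auto
    finally show "\<alpha> (Suc r) $ i = (G *\<^sub>v \<alpha> r + h (Suc r)) $ i" using i V hV carriers by simp
  qed (use V hV carriers in auto)
  have \<beta>_Suc: "(Gh *\<^sub>v \<beta> (Suc r)) $ i = \<beta> r $ i + (Gh *\<^sub>v (Lp 0 *\<^sub>v h (Suc r))) $ i" if i: "i < m" for r i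
  proof -
    have "(Gh *\<^sub>v \<beta> (Suc r)) $ i = (\<Sum>k\<in>{1..Suc r}. (Gh *\<^sub>v (Lp (Suc r - k) *\<^sub>v h k)) $ i)"
      unfolding \<beta>_def using i hV carriers by (subst mult_vsum_index) auto
    also have "\<dots> = (\<Sum>k\<in>{1..r}. (Gh *\<^sub>v (Lp (Suc r - k) *\<^sub>v h k)) $ i) + (Gh *\<^sub>v (Lp 0 *\<^sub>v h (Suc r))) $ i"
      by (simp add: ivl)
    also have "(\<Sum>k\<in>{1..r}. (Gh *\<^sub>v (Lp (Suc r - k) *\<^sub>v h k)) $ i) = (\<Sum>k\<in>{1..r}. (Lp (r - k) *\<^sub>v h k) $ i)"
    proof (rule sum.cong)
      fix k assume k: "k \<in> {1..r}"
      have "Gh *\<^sub>v (Lp (Suc (r - k)) *\<^sub>v h k) = (Gh * Lp (Suc (r - k))) *\<^sub>v h k"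
        using k hV carriers by (simp add: vec_distrib)
      thus "(Gh *\<^sub>v (Lp (Suc r - k) *\<^sub>v h k)) $ i = (Lp (r - k) *\<^sub>v h k) $ i"
        using k by (simp add: Suc_diff_le Gh_Lp)
    qed simp
    also have "\<dots> = \<beta> r $ i"
      unfolding \<beta>_def using i hV carriers by (subst vsum_index) auto
    finally show ?thesis .
  qed
  have \<gamma>_Suc: "(Gh *\<^sub>v \<gamma> (Suc r)) $ i + (Gh *\<^sub>v (Kq 0 *\<^sub>v h (Suc r))) $ i = \<gamma> r $ i" if i: "i < m" for r i
  proof -
    define f where "f j = (Kq j *\<^sub>v h (j + r)) $ i" for j
    have step: "Gh *\<^sub>v (Kq j *\<^sub>v h k) = Kq (Suc j) *\<^sub>v h k" if "1 \<le> k" for j k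
    proof -
      have "Gh *\<^sub>v (Kq j *\<^sub>v h k) = (Gh * Kq j) *\<^sub>v h k" using that hV carriers by (simp add: vec_distrib)
      thus ?thesis by (simp add: Gh_Kq)
    qed
    have "(Gh *\<^sub>v \<gamma> (Suc r)) $ i = (\<Sum>j\<in>{1..\<nu> - 1}. (Gh *\<^sub>v (Kq j *\<^sub>v h (j + Suc r))) $ i)"
      unfolding \<gamma>_def using i hV carriers by (subst mult_vsum_index) auto
    also have "\<dots> = (\<Sum>j\<in>{1..\<nu> - 1}. f (Suc j))"
      by (simp add: step f_def)
    finally have "(Gh *\<^sub>v \<gamma> (Suc r)) $ i + f 1 = (\<Sum>j\<in>{1..\<nu> - 1}. f j) + f (Suc (\<nu> - 1))"
      using shift_sum[of f "\<nu> - 1"] by simp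
    moreover have "f (Suc (\<nu> - 1)) = 0"
      using \<nu> i hV[of "\<nu> + r"] by (simp add: f_def apply_zero)
    moreover have "(\<Sum>j\<in>{1..\<nu> - 1}. f j) = \<gamma> r $ i"
      unfolding \<gamma>_def f_def using i hV carriers by (subst vsum_index) auto
    moreover have "f 1 = (Gh *\<^sub>v (Kq 0 *\<^sub>v h (Suc r))) $ i" by (simp add: f_def step)
    ultimately show ?thesis by simp
  qed
  have \<rho>_eq: "\<beta> r - \<gamma> r = Gh *\<^sub>v ((\<beta> (Suc r) - \<gamma> (Suc r)) - h (Suc r))" for r
  proof (rule eq_VI)
    fix i assume i: "i < m"
    have "(Gh *\<^sub>v ((Lp 0 + Kq 0) *\<^sub>v h (Suc r))) $ i = (Gh *\<^sub>v h (Suc r)) $ i"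
      unfolding split using hV by simp
    hence "(Gh *\<^sub>v (Lp 0 *\<^sub>v h (Suc r))) $ i + (Gh *\<^sub>v (Kq 0 *\<^sub>v h (Suc r))) $ i = (Gh *\<^sub>v h (Suc r)) $ i"
      using i hV carriers by (simp add: vec_distrib)
    thus "(\<beta> r - \<gamma> r) $ i = (Gh *\<^sub>v ((\<beta> (Suc r) - \<gamma> (Suc r)) - h (Suc r))) $ i"
      by (rule lin_split[OF _ \<beta>_Suc[OF i] \<gamma>_Suc[OF i]])
        (use i V hV carriers in \<open>simp_all add: vec_distrib\<close>)
  qed (use V hV carriers in auto)

  have "solves g (\<lambda>r. ((\<beta> r - \<gamma> r) + t r) - (\<alpha> r - G ^\<^sub>m r *\<^sub>v x))"
  proof (rule solution_of_split)
    fix r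
    show "\<alpha> r - G ^\<^sub>m r *\<^sub>v x \<in> V" "\<beta> r - \<gamma> r + t r \<in> V" "g (Suc r) \<in> V"
      using V x t(1) g carriers by simp_all
    show "\<alpha> (Suc r) - G ^\<^sub>m Suc r *\<^sub>v x = G *\<^sub>v (\<alpha> r - G ^\<^sub>m r *\<^sub>v x) + W *\<^sub>v g (Suc r)"
      unfolding \<alpha>_Suc GS[OF x] h_def[symmetric] using V x hV carriers
      by (intro eq_VI) (simp_all add: vec_distrib)
    show "\<beta> r - \<gamma> r + t r = Gh *\<^sub>v (\<beta> (Suc r) - \<gamma> (Suc r) + t (Suc r) - W *\<^sub>v g (Suc r))"
      unfolding \<rho>_eq[of r] t(2)[of r] h_def[symmetric] using V t(1) hV carriers
      by (intro eq_VI) (simp_all add: vec_distrib)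
  qed
  moreover have "((\<beta> r - \<gamma> r) + t r) - (\<alpha> r - G ^\<^sub>m r *\<^sub>v x) = G ^\<^sub>m r *\<^sub>v x + t r + \<sigma> r" for r
    unfolding \<sigma>_eq using V x t(1) carriers by (intro eq_VI) simp_all
  ultimately show "solves g (\<lambda>r. G ^\<^sub>m r *\<^sub>v x + t r + \<sigma> r)" by simp
qed

end

section \<open>Spectral splitting and the solution of the difference equation\<close>

lemma sum_split_at:
  fixes f :: "nat \<Rightarrow> 'a :: comm_monoid_add"
  assumes "p \<le> m"
  shows "(\<Sum>q<m. f q) = (\<Sum>q<p. f q) + (\<Sum>q<m - p. f (p + q))"
proof -
  have "(\<Sum>q<p + d. f q) = (\<Sum>q<p. f q) + (\<Sum>q<d. f (p + q))" for d
    by (induction d) (simp_all add: add.assoc)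
  from this[of "m - p"] show ?thesis using assms by simp
qed

lemma block_column_decomposition:
  fixes M Mi A V1 V0 :: "'a :: comm_ring_1 mat"
  assumes p: "p \<le> m"
    and M: "M \<in> carrier_mat m m" "Mi \<in> carrier_mat m m" "M * Mi = 1\<^sub>m m" "Mi * M = 1\<^sub>m m"
    and A: "A \<in> carrier_mat m m" and V1: "V1 \<in> carrier_mat p p" and V0: "V0 \<in> carrier_mat (m - p) (m - p)"
    and J: "A * M = M * four_block_mat V1 (0\<^sub>m p (m - p)) (0\<^sub>m (m - p) p) V0"
    and L: "L = mat m p (\<lambda>(i, j). M $$ (i, j))"
    and K: "K = mat m (m - p) (\<lambda>(i, j). M $$ (i, p + j))"
    and E: "E = mat p m (\<lambda>(i, j). Mi $$ (i, j))"
    and F: "F = mat (m - p) m (\<lambda>(i, j). Mi $$ (p + i, j))"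
  shows "L * E + K * F = 1\<^sub>m m" "E * L = 1\<^sub>m p" "F * K = 1\<^sub>m (m - p)"
    "E * K = 0\<^sub>m p (m - p)" "F * L = 0\<^sub>m (m - p) p" "A * L = L * V1" "A * K = K * V0"
proof -
  have C: "L \<in> carrier_mat m p" "K \<in> carrier_mat m (m - p)" "E \<in> carrier_mat p m" "F \<in> carrier_mat (m - p) m"
    by (auto simp: L K E F)
  show "L * E + K * F = 1\<^sub>m m"
  proof (rule eq_matI)
    fix i j assume "i < dim_row (1\<^sub>m m :: 'a mat)" "j < dim_col (1\<^sub>m m :: 'a mat)"
    hence ij: "i < m" "j < m" by auto
    have "(L * E) $$ (i, j) + (K * F) $$ (i, j) = (M * Mi) $$ (i, j)"
      unfolding mult_entry_sum[OF C(1,3) ij] mult_entry_sum[OF C(2,4) ij] mult_entry_sum[OF M(1,2) ij]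
        sum_split_at[OF p] using ij p by (simp add: L K E F)
    thus "(L * E + K * F) $$ (i, j) = 1\<^sub>m m $$ (i, j)" using ij C M(3) by simp
  qed (use C in auto)
  have left: "(mat n m (\<lambda>(i, j). Mi $$ (d + i, j)) * mat m l (\<lambda>(i, j). M $$ (i, e + j))) $$ (i, j)
      = (1\<^sub>m m :: 'a mat) $$ (d + i, e + j)" if "i < n" "j < l" "d + n \<le> m" "e + l \<le> m" for n l d e i j
  proof -
    have "(mat n m (\<lambda>(i, j). Mi $$ (d + i, j)) * mat m l (\<lambda>(i, j). M $$ (i, e + j))) $$ (i, j)
        = (Mi * M) $$ (d + i, e + j)"
      using that M(1,2)
      by (subst mult_entry_sum[of _ n m _ l], simp, simp, simp, simp, subst mult_entry_sum[of _ m m _ m])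
        auto
    thus ?thesis using M(4) by simp
  qed
  show "E * L = 1\<^sub>m p"
    using left[of _ p _ p 0 0] p by (intro eq_matI) (auto simp: E L)
  show "F * K = 1\<^sub>m (m - p)"
    using left[of _ "m - p" _ "m - p" p p] p by (intro eq_matI) (auto simp: F K)
  show "E * K = 0\<^sub>m p (m - p)"
    using left[of _ p _ "m - p" 0 p] p by (intro eq_matI) (auto simp: E K)
  show "F * L = 0\<^sub>m (m - p) p"
    using left[of _ "m - p" _ p p 0] p by (intro eq_matI) (auto simp: F L)
  let ?J = "four_block_mat V1 (0\<^sub>m p (m - p)) (0\<^sub>m (m - p) p) V0"
  have JC: "?J \<in> carrier_mat m m" using four_block_carrier_mat[OF V1 V0] p by simp
  have JE: "?J $$ (q, j) = (if q < p then if j < p then V1 $$ (q, j) else 0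
      else if j < p then 0 else V0 $$ (q - p, j - p))" if "q < m" "j < m" for q j
    using that V1 V0 p by auto
  show "A * L = L * V1"
  proof (rule eq_matI)
    fix i j assume "i < dim_row (L * V1)" "j < dim_col (L * V1)"
    hence ij: "i < m" "j < p" "j < m" using C V1 p by auto
    have "(A * L) $$ (i, j) = (A * M) $$ (i, j)"
      unfolding mult_entry_sum[OF A C(1) ij(1,2)] mult_entry_sum[OF A M(1) ij(1,3)]
      using ij by (intro sum.cong) (auto simp: L)
    also have "\<dots> = (\<Sum>q<p. M $$ (i, q) * ?J $$ (q, j)) + (\<Sum>q<m - p. M $$ (i, p + q) * ?J $$ (p + q, j))"
      unfolding J mult_entry_sum[OF M(1) JC ij(1,3)] sum_split_at[OF p] ..
    also have "(\<Sum>q<m - p. M $$ (i, p + q) * ?J $$ (p + q, j)) = 0"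
      using ij by (intro sum.neutral) (auto simp: JE simp del: index_mat_four_block)
    also have "(\<Sum>q<p. M $$ (i, q) * ?J $$ (q, j)) = (L * V1) $$ (i, j)"
      unfolding mult_entry_sum[OF C(1) V1 ij(1,2)]
      using ij p by (intro sum.cong) (auto simp: L JE simp del: index_mat_four_block)
    finally show "(A * L) $$ (i, j) = (L * V1) $$ (i, j)" by simp
  qed (use A C V1 in auto)
  show "A * K = K * V0"
  proof (rule eq_matI)
    fix i j assume "i < dim_row (K * V0)" "j < dim_col (K * V0)"
    hence ij: "i < m" "j < m - p" "p + j < m" using C V0 p by auto
    have "(A * K) $$ (i, j) = (A * M) $$ (i, p + j)"
      unfolding mult_entry_sum[OF A C(2) ij(1,2)] mult_entry_sum[OF A M(1) ij(1,3)]
      using ij by (intro sum.cong) (auto simp: K)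
    also have "\<dots> = (\<Sum>q<p. M $$ (i, q) * ?J $$ (q, p + j)) + (\<Sum>q<m - p. M $$ (i, p + q) * ?J $$ (p + q, p + j))"
      unfolding J mult_entry_sum[OF M(1) JC ij(1,3)] sum_split_at[OF p] ..
    also have "(\<Sum>q<p. M $$ (i, q) * ?J $$ (q, p + j)) = 0"
      using ij p by (intro sum.neutral) (auto simp: JE simp del: index_mat_four_block)
    also have "(\<Sum>q<m - p. M $$ (i, p + q) * ?J $$ (p + q, p + j)) = (K * V0) $$ (i, j)"
      unfolding mult_entry_sum[OF C(2) V0 ij(1,2)]
      using ij p by (intro sum.cong) (auto simp: K JE simp del: index_mat_four_block)
    finally show "(A * K) $$ (i, j) = (K * V0) $$ (i, j)" by simp
  qed (use A C V0 in auto)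
qed

lemma conjugated_pow_step:
  assumes C: "A \<in> carrier_mat m m" "L \<in> carrier_mat m p" "E \<in> carrier_mat p m" "V \<in> carrier_mat p p" "X \<in> carrier_mat p p"
  shows "A * L = L * V \<Longrightarrow> A * (L * X * E) = L * (V * X) * E"
    and "E * A = V * E \<Longrightarrow> (L * X * E) * A = L * (X * V) * E"
proof -
  assume AL: "A * L = L * V"
  have "A * (L * X * E) = A * L * X * E"
    using C by (simp add: assoc_mult_mat[of _ m m _ p _ m] assoc_mult_mat[of _ m m _ p _ p]
        assoc_mult_mat[of _ m p _ p _ m])
  also have "\<dots> = L * (V * X) * E" unfolding AL using C by (simp add: assoc_mult_mat[of _ m p _ p _ p])
  finally show "A * (L * X * E) = L * (V * X) * E" .
next
  assume EA: "E * A = V * E"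
  have "(L * X * E) * A = L * X * (E * A)" using C by (intro assoc_mult_mat[of _ m p _ m _ m]) auto
  also have "\<dots> = L * X * V * E"
    unfolding EA using C by (intro assoc_mult_mat[of _ m p _ p _ m, symmetric]) auto
  also have "\<dots> = L * (X * V) * E" using C by (simp add: assoc_mult_mat[of _ m p _ p _ p])
  finally show "(L * X * E) * A = L * (X * V) * E" .
qed

context square_mats begin

lemma difference_zero_iff:
  assumes "Z \<in> Mat" "X \<in> Mat" "Y \<in> Mat"
    and "\<And>i j. i < m \<Longrightarrow> j < m \<Longrightarrow> Z $$ (i, j) = X $$ (i, j) - Y $$ (i, j)"
  shows "Z = Zero \<longleftrightarrow> X = Y"
proof
  assume "Z = Zero"
  hence "X $$ (i, j) - Y $$ (i, j) = 0" if "i < m" "j < m" for i j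
    using assms(4)[OF that] that by simp
  thus "X = Y" using assms(2,3) by (intro eq_MatI) auto
qed (use assms in \<open>auto intro!: eq_MatI\<close>)

lemma min_sol_first_passage:
  assumes abc: "a \<in> Mat" "b \<in> Mat" "c \<in> Mat"
    and G: "minimal_nonneg_solution m (\<lambda>X. a + (b - 1\<^sub>m m) * X + c * X ^\<^sub>m 2) G"
  shows "first_passage_matrix a b c G"
proof -
  have "a + (b - 1\<^sub>m m) * Y + c * Y ^\<^sub>m 2 = Zero \<longleftrightarrow> a + b * Y + c * Y * Y = Y" if "Y \<in> Mat" for Y
    using abc that by (intro difference_zero_iff) (simp_all add: numeral_2_eq_2 mat_distrib)
  thus ?thesis using G by (auto simp: minimal_nonneg_solution_def first_passage_matrix_def)
qed

lemma min_sol_rate: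
  assumes abc: "a \<in> Mat" "b \<in> Mat" "c \<in> Mat"
    and R: "minimal_nonneg_solution m (\<lambda>X. c + X * (b - 1\<^sub>m m) + X ^\<^sub>m 2 * a) R"
  shows "rate_matrix a b c R"
proof -
  have "c + Y * (b - 1\<^sub>m m) + Y ^\<^sub>m 2 * a = Zero \<longleftrightarrow> c + Y * b + Y * Y * a = Y" if "Y \<in> Mat" for Y
    using abc that by (intro difference_zero_iff) (simp_all add: numeral_2_eq_2 mat_distrib)
  thus ?thesis using R by (auto simp: minimal_nonneg_solution_def rate_matrix_def)
qed

end

context qbd_chain begin

text \<open>The series for \<open>W\<close> is the one of \<open>green_limit\<close> up to sign, because \<open>(U - I)\<^sup>-\<^sup>1 = - N\<close>.\<close>

lemma green_identities:
  assumes nn: "\<not> qbd_null_recurrent m B a b c"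
    and Gh: "first_passage_matrix c b a Gh" and R: "rate_matrix a b c R"
    and U: "U = b + R * a"
    and W: "W = mat_suminf m m (\<lambda>n. G ^\<^sub>m n * mat_inv (U - One) * R ^\<^sub>m n)"
  shows "\<exists>N\<in>Mat. W \<in> Mat \<and> U \<in> Mat \<and> (U - One) * N = One \<and> N * (U - One) = One \<and>
    W - G * (W * R) = N \<and> W * R = Gh * W \<and>
    a + (U - One) * G = Zero \<and> c + R * (U - One) = Zero \<and> (b - One) + c * G = U - One"
proof -
  note M = block_facts(2-4,6-8) G_facts(1,2)
  have RM: "R \<in> Mat" "c + R * b + R * R * a = R" using R by (auto simp: rate_matrix_def)
  have GhM: "Gh \<in> Mat" using Gh by (auto simp: first_passage_matrix_def)
  obtain X where X: "neumann (b + c * G) X" by (rule U_neumann)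
  note XD = neumannD[OF X]
  note RX = rate_matrix_eq[OF M(1-6) blocks_rows_le G R X]
  have U_eq: "U = b + c * G"
    unfolding U using M RM(1) XD(2) by (simp add: RX(1) mat_assoc RX(2))
  obtain k where k: "rows_le (1/2) (G ^\<^sub>m k) \<or> (\<forall>i<m. \<forall>l<m. (R ^\<^sub>m k) $$ (i, l) \<le> 1 / (2 * m))"
    using not_null_recurrent_contraction[OF nn R X] by blast
  obtain H where H: "H \<in> Mat" "H * R = Gh * H" "H = X + G * (H * R)"
    and sums: "\<And>i j. i < m \<Longrightarrow> j < m \<Longrightarrow> (\<lambda>l. (G ^\<^sub>m l * X * R ^\<^sub>m l) $$ (i, j)) sums H $$ (i, j)"
    by (rule green_limit[OF M(1-6) blocks_rows_le G Gh R X k]) blast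
  have UM: "U \<in> Mat" using XD(1) by (simp add: U_eq)
  have inv1: "(One - U) * X = One" "X * (One - U) = One"
    using neumann_inverse[OF X] by (simp_all add: U_eq)
  have neg: "U - One = - (One - U)" using UM by (intro eq_MatI) auto
  have TN: "(U - One) * (- X) = One" "(- X) * (U - One) = One"
    unfolding neg using UM XD(2) inv1 by simp_all
  have "mat_inv (U - One) = - X"
    by (rule mat_inv_eqI[of _ m]) (use UM XD(2) TN in auto)
  hence "W = mat_suminf m m (\<lambda>n. G ^\<^sub>m n * (- X) * R ^\<^sub>m n)" unfolding W by simp
  also have "\<dots> = - H"
  proof (rule eq_MatI)
    fix i j assume ij: "i < m" "j < m"
    have e: "(G ^\<^sub>m n * (- X) * R ^\<^sub>m n) $$ (i, j) = - (G ^\<^sub>m n * X * R ^\<^sub>m n) $$ (i, j)" for n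
      using ij M(7) RM(1) XD(2) by simp
    have "(\<lambda>n. (G ^\<^sub>m n * (- X) * R ^\<^sub>m n) $$ (i, j)) sums (- H $$ (i, j))"
      unfolding e by (rule sums_minus[OF sums[OF ij]])
    thus "mat_suminf m m (\<lambda>n. G ^\<^sub>m n * (- X) * R ^\<^sub>m n) $$ (i, j) = (- H) $$ (i, j)"
      using ij H(1) by (simp add: mat_suminf_def sums_unique[symmetric])
  qed (use H(1) in \<open>auto simp: mat_suminf_def\<close>)
  finally have W_eq: "W = - H" .
  have XM: "- X \<in> Mat" "- H \<in> Mat" using XD(2) H(1) by auto
  have 1: "W - G * (W * R) = - X"
  proof (rule eq_MatI)
    fix i j assume ij: "i < m" "j < m"
    have "(X + G * (H * R)) $$ (i, j) = H $$ (i, j)" using H(3) by simp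
    moreover have "G * ((- H) * R) = - (G * (H * R))" using M(7) RM(1) H(1) by simp
    ultimately show "(W - G * (W * R)) $$ (i, j) = (- X) $$ (i, j)"
      unfolding W_eq using ij M(7) RM(1) H(1) XD(2) by simp
  qed (use M(7) RM(1) H(1) XD(2) XM in \<open>auto simp: W_eq\<close>)
  have 2: "W * R = Gh * W" unfolding W_eq using H(1,2) RM(1) GhM by simp
  have 3: "a + (U - One) * G = Zero"
  proof (rule eq_MatI)
    fix i j assume ij: "i < m" "j < m"
    have "(a + b * G + c * G * G) $$ (i, j) = G $$ (i, j)" by (simp add: G_facts(3))
    thus "(a + (U - One) * G) $$ (i, j) = Zero $$ (i, j)"
      unfolding U_eq using ij M(1-3,7) by (simp add: mat_distrib)
  qed (use M UM in auto)
  have 4: "c + R * (U - One) = Zero"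
  proof (rule eq_MatI)
    fix i j assume ij: "i < m" "j < m"
    have "(c + R * b + R * R * a) $$ (i, j) = R $$ (i, j)" by (simp add: RM(2))
    thus "(c + R * (U - One)) $$ (i, j) = Zero $$ (i, j)"
      unfolding U using ij M(1-3) RM(1) by (simp add: mat_distrib)
  qed (use M UM RM(1) in auto)
  have 5: "(b - One) + c * G = U - One"
    unfolding U_eq using M(2,3,7) by (intro eq_MatI) auto
  show ?thesis using XM(1) TN 1 2 3 4 5 UM XM(2) W_eq by blast
qed

end

theorem lemma7:
  fixes m p \<nu> :: nat
    and B Am1 A0 A1 G Gh R U W :: "real mat"
    and M V1 V0 L K E F :: "complex mat"
    and g \<sigma> :: "nat \<Rightarrow> complex vec"
  assumes qbd: "qbd m B Am1 A0 A1"
    and standing: "qbd_standing_assumptions m B Am1 A0 A1"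
    and not_null: "\<not> qbd_null_recurrent m B Am1 A0 A1"
    and G: "minimal_nonneg_solution m (\<lambda>X. Am1 + (A0 - 1\<^sub>m m) * X + A1 * X ^\<^sub>m 2) G"
    and Gh: "minimal_nonneg_solution m (\<lambda>X. A1 + (A0 - 1\<^sub>m m) * X + Am1 * X ^\<^sub>m 2) Gh"
    and R: "minimal_nonneg_solution m (\<lambda>X. A1 + X * (A0 - 1\<^sub>m m) + X ^\<^sub>m 2 * Am1) R"
    and U: "U = A0 + R * Am1"
    and W: "W = mat_suminf m m (\<lambda>n. G ^\<^sub>m n * mat_inv (U - 1\<^sub>m m) * R ^\<^sub>m n)"
    and p: "p \<le> m"
    and M: "M \<in> carrier_mat m m" "invertible_mat M"
    and V1: "V1 \<in> carrier_mat p p" "invertible_mat V1"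
    and V0: "V0 \<in> carrier_mat (m - p) (m - p)" "p < m \<longrightarrow> spectral_radius V0 = 0"
    and J: "cmat Gh * M = M * four_block_mat V1 (0\<^sub>m p (m - p)) (0\<^sub>m (m - p) p) V0"
    and L: "L = mat m p (\<lambda>(i, j). M $$ (i, j))"
    and K: "K = mat m (m - p) (\<lambda>(i, j). M $$ (i, p + j))"
    and E: "E = mat p m (\<lambda>(i, j). mat_inv M $$ (i, j))"
    and F: "F = mat (m - p) m (\<lambda>(i, j). mat_inv M $$ (p + i, j))"
    and \<nu>: "\<nu> = (LEAST n. 0 < n \<and> V0 ^\<^sub>m n = 0\<^sub>m (m - p) (m - p))"
    and g: "\<And>r. 1 \<le> r \<Longrightarrow> g r \<in> carrier_vec m"
    and \<sigma>: "\<And>r. \<sigma> r =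
      - vsum m (\<lambda>k. ((cmat G ^\<^sub>m (r - k) - L * mat_inv V1 ^\<^sub>m (r - k) * E) * cmat W) *\<^sub>v g k) {1..r}
      - vsum m (\<lambda>j. (K * V0 ^\<^sub>m j * F * cmat W) *\<^sub>v g (j + r)) {1..\<nu> - 1}"
  shows "difference_solution m Am1 A0 A1 g \<sigma> \<and>
    (\<forall>u. difference_solution m Am1 A0 A1 g u \<longleftrightarrow>
       (\<exists>x\<in>carrier_vec m. \<exists>y\<in>carrier_vec p. \<forall>r.
          u r = cmat G ^\<^sub>m r *\<^sub>v x + (L * mat_inv V1 ^\<^sub>m r) *\<^sub>v y + \<sigma> r))"
proof -
  have abc: "B \<in> carrier_mat m m" "Am1 \<in> carrier_mat m m" "A0 \<in> carrier_mat m m" "A1 \<in> carrier_mat m m"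
    and m: "0 < m"
    using qbd by (auto simp: qbd_def)
  interpret square_mats m by unfold_locales (rule m)
  have G': "first_passage_matrix Am1 A0 A1 G" and Gh': "first_passage_matrix A1 A0 Am1 Gh"
    and R': "rate_matrix Am1 A0 A1 R"
    using min_sol_first_passage[OF abc(2,3,4) G] min_sol_first_passage[OF abc(4,3,2) Gh]
      min_sol_rate[OF abc(2,3,4) R] by auto
  interpret qbd_chain m B Am1 A0 A1 G
    by unfold_locales (use qbd standing G' in \<open>auto simp: qbd_standing_assumptions_def\<close>)
  obtain N where N: "N \<in> Mat" and real: "W \<in> Mat" "U \<in> Mat" "(U - One) * N = One" "N * (U - One) = One"
    "W - G * (W * R) = N" "W * R = Gh * W"
    "Am1 + (U - One) * G = Zero" "A1 + R * (U - One) = Zero" "(A0 - One) + A1 * G = U - One"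
    using green_identities[OF not_null Gh' R' U W] by blast
  have GhM: "Gh \<in> Mat" and Gh_fix: "A1 + A0 * Gh + Am1 * Gh * Gh = Gh"
    using Gh' by (auto simp: first_passage_matrix_def)
  have GM: "G \<in> Mat" and RM: "R \<in> Mat" using G' R' by (auto simp: first_passage_matrix_def rate_matrix_def)
  have Gh_real: "A1 + (A0 - One) * Gh + Am1 * (Gh * Gh) = Zero"
  proof (rule eq_MatI)
    fix i j assume ij: "i < m" "j < m"
    have "(A1 + A0 * Gh + Am1 * Gh * Gh) $$ (i, j) = Gh $$ (i, j)" by (simp add: Gh_fix)
    thus "(A1 + (A0 - One) * Gh + Am1 * (Gh * Gh)) $$ (i, j) = Zero $$ (i, j)"
      using ij abc GhM by (simp add: mat_distrib)
  qed (use abc GhM in auto)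

  have cm: "cmat (X * Y) = cmat X * cmat Y" if "X \<in> Mat" "Y \<in> Mat" for X Y
    by (rule of_real_hom.mat_hom_mult[OF that])
  have ca: "cmat (X + Y) = cmat X + cmat Y" "cmat (X - Y) = cmat X - cmat Y" if "X \<in> Mat" "Y \<in> Mat" for X Y
    using that by (auto intro!: eq_matI)
  have c1: "cmat One = 1\<^sub>m m" "cmat Zero = 0\<^sub>m m m" by (auto intro!: eq_matI)
  have cC: "cmat X \<in> carrier_mat m m" if "X \<in> Mat" for X using that by simp

  let ?q = "m - p"
  define Mi where "Mi = mat_inv M"
  define V1i where "V1i = mat_inv V1"
  have Mi: "Mi \<in> carrier_mat m m" "M * Mi = 1\<^sub>m m" "Mi * M = 1\<^sub>m m"
    unfolding Mi_def using mat_inv_invertible[OF M] .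
  have V1i: "V1i \<in> carrier_mat p p" "V1 * V1i = 1\<^sub>m p" "V1i * V1 = 1\<^sub>m p"
    unfolding V1i_def using mat_inv_invertible[OF V1] .
  have C: "L \<in> carrier_mat m p" "K \<in> carrier_mat m ?q" "E \<in> carrier_mat p m" "F \<in> carrier_mat ?q m"
    by (auto simp: L K E F)
  note dec = block_column_decomposition[OF p M(1) Mi cC[OF GhM] V1(1) V0(1) J L K E[folded Mi_def] F[folded Mi_def]]
  let ?Gh = "cmat Gh"
  have GhC: "?Gh \<in> carrier_mat m m" using GhM by simp
  have Gh_split: "?Gh = L * V1 * E + K * V0 * F"
  proof -
    have "?Gh = ?Gh * (L * E + K * F)" unfolding dec(1) using GhC by simp
    also have "\<dots> = ?Gh * (L * E) + ?Gh * (K * F)"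
      using GhC C by (intro mult_add_distrib_mat[of _ m m _ m]) auto
    also have "?Gh * (L * E) = L * V1 * E"
      using GhC C by (simp add: assoc_mult_mat[of _ m m _ p _ m, symmetric] dec(6))
    also have "?Gh * (K * F) = K * V0 * F"
      using GhC C by (simp add: assoc_mult_mat[of _ m m _ ?q _ m, symmetric] dec(7))
    finally show ?thesis .
  qed
  have E_Gh: "E * ?Gh = V1 * E"
  proof -
    have "E * ?Gh = E * (L * (V1 * E)) + E * (K * (V0 * F))"
      unfolding Gh_split using C V1(1) V0(1)
      by (subst mult_add_distrib_mat[of _ p m _ m])
        (auto simp: assoc_mult_mat[of _ m p _ p _ m] assoc_mult_mat[of _ m ?q _ ?q _ m])
    also have "E * (L * (V1 * E)) = (E * L) * (V1 * E)"
      using C V1(1) by (intro assoc_mult_mat[of _ p m _ p _ m, symmetric]) auto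
    also have "E * (K * (V0 * F)) = (E * K) * (V0 * F)"
      using C V0(1) by (intro assoc_mult_mat[of _ p m _ ?q _ m, symmetric]) auto
    also have "(E * L) * (V1 * E) + (E * K) * (V0 * F) = V1 * E"
      unfolding dec(2,4) using C V1(1) V0(1) by (intro eq_matI) auto
    finally show ?thesis .
  qed
  have F_Gh: "F * ?Gh = V0 * F"
  proof -
    have "F * ?Gh = F * (L * (V1 * E)) + F * (K * (V0 * F))"
      unfolding Gh_split using C V1(1) V0(1)
      by (subst mult_add_distrib_mat[of _ ?q m _ m])
        (auto simp: assoc_mult_mat[of _ m p _ p _ m] assoc_mult_mat[of _ m ?q _ ?q _ m])
    also have "F * (L * (V1 * E)) = (F * L) * (V1 * E)"
      using C V1(1) by (intro assoc_mult_mat[of _ ?q m _ p _ m, symmetric]) auto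
    also have "F * (K * (V0 * F)) = (F * K) * (V0 * F)"
      using C V0(1) by (intro assoc_mult_mat[of _ ?q m _ ?q _ m, symmetric]) auto
    also have "(F * L) * (V1 * E) + (F * K) * (V0 * F) = V0 * F"
      unfolding dec(3,5) using C V1(1) V0(1) by (intro eq_matI) auto
    finally show ?thesis .
  qed

  define Lp where "Lp k = L * V1i ^\<^sub>m k * E" for k
  define Kq where "Kq k = K * V0 ^\<^sub>m k * F" for k
  have LKC: "Lp k \<in> carrier_mat m m" "Kq k \<in> carrier_mat m m" for k
    unfolding Lp_def Kq_def using C V1i(1) V0(1) by auto
  have pow1: "V1 * V1i ^\<^sub>m Suc k = V1i ^\<^sub>m k" for k
  proof -
    have "V1 * V1i ^\<^sub>m Suc k = V1 * V1i * V1i ^\<^sub>m k"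
      unfolding pow_mat_Suc_left[OF V1i(1)]
      using V1(1) V1i(1) by (intro assoc_mult_mat[of _ p p _ p _ p, symmetric]) auto
    thus ?thesis using V1i by simp
  qed
  have pow2: "V1i ^\<^sub>m Suc k * V1 = V1i ^\<^sub>m k" for k
    using V1(1) V1i by (simp add: assoc_mult_mat[of _ p p _ p _ p])
  have \<nu>': "0 < \<nu>" "V0 ^\<^sub>m \<nu> = 0\<^sub>m ?q ?q"
    using LeastI_ex[OF spectral_radius_0_nilpotent[OF V0(1), simplified]] V0(2)
    unfolding \<nu> by auto

  interpret rs: recurrence_split m \<nu> "cmat Am1" "cmat (A0 - One)" "cmat A1" "cmat (U - One)" "cmat N"
    "cmat G" ?Gh "cmat R" "cmat W" Lp Kq
  proof unfold_locales
    show "cmat Am1 + cmat (U - One) * cmat G = 0\<^sub>m m m" "cmat A1 + cmat R * cmat (U - One) = 0\<^sub>m m m"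
      "cmat (A0 - One) + cmat A1 * cmat G = cmat (U - One)"
      using arg_cong[OF real(7), of cmat] arg_cong[OF real(8), of cmat] arg_cong[OF real(9), of cmat]
        abc GM RM real(2) by (simp_all only: cm ca(1) c1 minus_closed one_carrier_mat mult_closed)
    show "cmat (U - One) * cmat N = 1\<^sub>m m" "cmat N * cmat (U - One) = 1\<^sub>m m"
      using arg_cong[OF real(3), of cmat] arg_cong[OF real(4), of cmat]
        N real(2) by (simp_all only: cm c1 minus_closed one_carrier_mat)
    show "cmat W - cmat G * (cmat W * cmat R) = cmat N" "cmat W * cmat R = ?Gh * cmat W"
      using arg_cong[OF real(5), of cmat] arg_cong[OF real(6), of cmat]
        N real(1) GM RM GhM by (simp_all only: cm ca(2) mult_closed)
    show "cmat A1 + cmat (A0 - One) * ?Gh + cmat Am1 * (?Gh * ?Gh) = 0\<^sub>m m m"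
      using arg_cong[OF Gh_real, of cmat] abc GhM
      by (simp_all only: cm ca(1) c1 minus_closed one_carrier_mat mult_closed add_closed)
    show "Lp 0 + Kq 0 = 1\<^sub>m m"
      unfolding Lp_def Kq_def using C V1i(1) V0(1) dec(1) by simp
    show "?Gh * Lp (Suc k) = Lp k" "Lp (Suc k) * ?Gh = Lp k" for k
      unfolding Lp_def
      using conjugated_pow_step[OF GhC C(1,3) V1(1) pow_carrier_mat[OF V1i(1), of "Suc k"]]
        dec(6) E_Gh pow1[of k] pow2[of k] by (simp_all del: pow_mat.simps)
    show "?Gh * Kq k = Kq (Suc k)" "Kq k * ?Gh = Kq (Suc k)" for k
      unfolding Kq_def
      using conjugated_pow_step[OF GhC C(2,4) V0(1) pow_carrier_mat[OF V0(1), of k]]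
        dec(7) F_Gh pow_mat_Suc_left[OF V0(1), of k] by simp_all
    show "0 < \<nu>" by (rule \<nu>'(1))
    show "Kq \<nu> = 0\<^sub>m m m" unfolding Kq_def \<nu>'(2) using C by simp
  qed (use abc GM GhM RM N real(1,2) LKC in auto)

  have solves_iff: "difference_solution m Am1 A0 A1 h u \<longleftrightarrow> rs.solves h u" for h u
    by (simp add: difference_solution_def rs.solves_def)
  define t where "t y r = (L * V1i ^\<^sub>m r) *\<^sub>v y" for y r
  have tV: "t y r \<in> carrier_vec m" if "y \<in> carrier_vec p" for y r
    unfolding t_def using C(1) V1i(1) that by (intro mult_mat_vec_carrier[of _ m p]) auto
  have t_step: "t y r = ?Gh *\<^sub>v t y (Suc r)" if y: "y \<in> carrier_vec p" for y r
  proof -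
    have "?Gh *\<^sub>v t y (Suc r) = (?Gh * (L * V1i ^\<^sub>m Suc r)) *\<^sub>v y"
      unfolding t_def using GhC C(1) V1i(1) y
      by (intro assoc_mult_mat_vec[of _ m m _ p, symmetric]) (auto simp del: pow_mat.simps)
    also have "?Gh * (L * V1i ^\<^sub>m Suc r) = L * V1 * V1i ^\<^sub>m Suc r"
      using GhC C(1) V1i(1) unfolding dec(6)[symmetric]
      by (intro assoc_mult_mat[of _ m m _ p _ p, symmetric]) (auto simp del: pow_mat.simps)
    also have "\<dots> = L * (V1 * V1i ^\<^sub>m Suc r)"
      using C(1) V1(1) V1i(1) by (intro assoc_mult_mat[of _ m p _ p _ p]) (auto simp del: pow_mat.simps)
    also have "\<dots> = L * V1i ^\<^sub>m r" by (simp only: pow1)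
    finally show ?thesis by (simp add: t_def)
  qed
  have \<sigma>': "\<sigma> r = - vsum m (\<lambda>k. ((cmat G ^\<^sub>m (r - k) - Lp (r - k)) * cmat W) *\<^sub>v g k) {1..r}
      - vsum m (\<lambda>j. (Kq j * cmat W) *\<^sub>v g (j + r)) {1..\<nu> - 1}" for r
    unfolding \<sigma> Lp_def Kq_def V1i_def ..
  have z: "0\<^sub>v m \<in> carrier_vec m" "0\<^sub>v p \<in> carrier_vec p" by auto
  note part = rs.particular_solution[where g = g and \<sigma> = \<sigma>, OF _ \<sigma>']
  have \<sigma>V: "\<sigma> r \<in> carrier_vec m" for r
    by (rule part(2)[where t = "t (0\<^sub>v p)", OF _ z(1) tV[OF z(2)] t_step[OF z(2)]]) (rule g)
  have general: "rs.solves g (\<lambda>r. cmat G ^\<^sub>m r *\<^sub>v x + t y r + \<sigma> r)"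
    if "x \<in> carrier_vec m" "y \<in> carrier_vec p" for x y
    by (rule part(1)[where t = "t y", OF _ that(1) tV[OF that(2)] t_step[OF that(2)]]) (rule g)
  have particular: "rs.solves g \<sigma>"
  proof -
    have "cmat G ^\<^sub>m r *\<^sub>v 0\<^sub>v m + t (0\<^sub>v p) r + \<sigma> r = \<sigma> r" for r
    proof -
      have zero: "X *\<^sub>v 0\<^sub>v l = 0\<^sub>v k" if "X \<in> carrier_mat k l" for X :: "complex mat" and k l
        using that by (auto intro!: eq_vecI simp: index_mult_mat_vec)
      have "cmat G ^\<^sub>m r *\<^sub>v 0\<^sub>v m = 0\<^sub>v m" using GM by (intro zero) simp
      moreover have "t (0\<^sub>v p) r = 0\<^sub>v m"
        unfolding t_def using C(1) V1i(1) by (intro zero mult_carrier_mat[of _ m p]) simp_all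
      ultimately show ?thesis using \<sigma>V[of r] by simp
    qed
    thus ?thesis using general[OF z] by simp
  qed
  have "\<exists>x\<in>carrier_vec m. \<exists>y\<in>carrier_vec p. \<forall>r. u r = cmat G ^\<^sub>m r *\<^sub>v x + (L * V1i ^\<^sub>m r) *\<^sub>v y + \<sigma> r"
    if u: "rs.solves g u" for u
  proof -
    have uV: "u r \<in> carrier_vec m" for r using u by (simp add: rs.solves_def)
    have "rs.solves (\<lambda>_. 0\<^sub>v m) (\<lambda>r. u r - \<sigma> r)"
      by (rule rs.solves_diff[OF u particular])
    then obtain x w where xw: "x \<in> carrier_vec m" "w \<in> carrier_vec m"
      "\<And>r. u r - \<sigma> r = cmat G ^\<^sub>m r *\<^sub>v x + ?Gh *\<^sub>v (Lp r *\<^sub>v w)"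
      using rs.homogeneous_solution by blast
    define y where "y = V1 *\<^sub>v (E *\<^sub>v w)"
    have Ew: "E *\<^sub>v w \<in> carrier_vec p" using C(3) xw(2) by (rule mult_mat_vec_carrier)
    have yV: "y \<in> carrier_vec p" unfolding y_def using V1(1) Ew by (rule mult_mat_vec_carrier)
    have "?Gh *\<^sub>v (Lp r *\<^sub>v w) = t y r" for r
    proof -
      have "Lp r *\<^sub>v w = (L * V1i ^\<^sub>m r) *\<^sub>v (E *\<^sub>v w)"
        unfolding Lp_def using C V1i(1) xw(2) by (intro assoc_mult_mat_vec[of _ m p _ m]) auto
      also have "\<dots> = t (E *\<^sub>v w) r" by (simp add: t_def)
      also have "?Gh *\<^sub>v t (E *\<^sub>v w) r = (?Gh * (L * V1i ^\<^sub>m r)) *\<^sub>v (E *\<^sub>v w)"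
        unfolding t_def using GhC C(1) V1i(1) Ew
        by (intro assoc_mult_mat_vec[of _ m m _ p, symmetric]) auto
      also have "?Gh * (L * V1i ^\<^sub>m r) = L * V1i ^\<^sub>m r * V1"
      proof -
        have "?Gh * (L * V1i ^\<^sub>m r) = L * V1 * V1i ^\<^sub>m r"
          using GhC C(1) V1i(1) unfolding dec(6)[symmetric]
          by (intro assoc_mult_mat[of _ m m _ p _ p, symmetric]) auto
        also have "\<dots> = L * (V1 * V1i ^\<^sub>m r)"
          using C(1) V1(1) V1i(1) by (intro assoc_mult_mat[of _ m p _ p _ p]) auto
        also have "V1 * V1i ^\<^sub>m r = V1i ^\<^sub>m r * V1"
          by (cases r) (use pow1 pow2 V1(1) V1i(1) in \<open>auto simp del: pow_mat.simps(2)\<close>)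
        also have "L * (V1i ^\<^sub>m r * V1) = L * V1i ^\<^sub>m r * V1"
          using C(1) V1(1) V1i(1) by (intro assoc_mult_mat[of _ m p _ p _ p, symmetric]) auto
        finally show ?thesis .
      qed
      also have "(L * V1i ^\<^sub>m r * V1) *\<^sub>v (E *\<^sub>v w) = t y r"
        unfolding t_def y_def using C(1) V1(1) V1i(1) Ew
        by (intro assoc_mult_mat_vec[of _ m p _ p]) auto
      finally show ?thesis .
    qed
    hence diff: "u r - \<sigma> r = cmat G ^\<^sub>m r *\<^sub>v x + t y r" for r using xw(3) by simp
    have "u r = cmat G ^\<^sub>m r *\<^sub>v x + (L * V1i ^\<^sub>m r) *\<^sub>v y + \<sigma> r" for r
    proof -
      have "u r = (u r - \<sigma> r) + \<sigma> r" using uV[of r] \<sigma>V[of r] by (intro eq_vecI) auto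
      thus ?thesis unfolding diff by (simp add: t_def)
    qed
    thus ?thesis using xw(1) yV by blast
  qed
  moreover have "rs.solves g u" if "x \<in> carrier_vec m" "y \<in> carrier_vec p"
    "\<forall>r. u r = cmat G ^\<^sub>m r *\<^sub>v x + (L * V1i ^\<^sub>m r) *\<^sub>v y + \<sigma> r" for x y u
  proof -
    have "u = (\<lambda>r. cmat G ^\<^sub>m r *\<^sub>v x + t y r + \<sigma> r)" using that(3) by (auto simp: t_def)
    thus ?thesis using general[OF that(1,2)] by simp
  qed
  ultimately show ?thesis
    using particular unfolding solves_iff V1i_def by blast
qed

end
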